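(* Let $\tau$ be large and let $\kappa$ be the unique real solution of $M'(r)=\tau$. Then $$\mathbb{P}(\gamma_{\mathbb{Q}(\sqrt{\mathbb{X}})}>\tau)= \frac{\Lambda(\kappa)e^{-\tau \kappa}}{\kappa \sqrt{2\pi M''(\kappa)}}\left(1+O\left(\frac{1}{ \sqrt{\kappa}} \right)\right).$$ Similarly, if $\widetilde{\kappa}$ is the unique real solution of $M'(-r)=-\tau$, then $$ \mathbb{P}(\gamma_{\mathbb{Q}(\sqrt{\mathbb{X}})}<-\tau)= \frac{\Lambda(-\widetilde{\kappa})e^{-\tau \widetilde{\kappa}}}{\widetilde{\kappa} \sqrt{2\pi M''(-\widetilde{\kappa})}}\left(1+O\left(\frac{1}{ \sqrt{\widetilde{\kappa}}} \right)\right).$$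
   Context: $\gamma$ is the Euler–Mascheroni constant. Let $\{X(p)\}_{p}$ be independent random variables indexed by primes with $\mathbb{P}(X(p)=1)=\mathbb{P}(X(p)=-1)=\frac{p}{2(p+1)}$ and $\mathbb{P}(X(p)=0)=\frac{1}{p+1}$, and $\gamma_{\mathbb{Q}(\sqrt{\mathbb{X}})}:=\gamma-\sum_{p}\frac{(\log p)X(p)}{p-X(p)}$ (almost surely convergent). For $s\in\mathbb{C}$, $\Lambda(s):=\mathbb{E}\big(\exp(s\cdot\gamma_{\mathbb{Q}(\sqrt{\mathbb{X}})})\big)$ (the Laplace transform, not the von Mangoldt function) and, for real $r$, $M(r):=\log\Lambda(r)$. The function $M'$ is strictly increasing on $\mathbb{R}$ with $M'(r)\to\pm\infty$ as $r\to\pm\infty$, so the solutions $\kappa$, $\widetilde\kappa$ exist and are unique; for large $\tau$ they are large and positive. *)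

theory Defs
  imports "HOL-Probability.Probability" "HOL-Computational_Algebra.Primes"
    "HOL-Library.Landau_Symbols"
begin

text \<open>The law of one \<open>X(p)\<close>; the three probabilities add up to \<open>1\<close>.\<close>

definition has_prime_law :: "'a measure \<Rightarrow> nat \<Rightarrow> ('a \<Rightarrow> real) \<Rightarrow> bool" where
  "has_prime_law M p Y \<longleftrightarrow>
     measure M {\<omega> \<in> space M. Y \<omega> = 1} = real p / (2 * (real p + 1)) \<and>
     measure M {\<omega> \<in> space M. Y \<omega> = -1} = real p / (2 * (real p + 1)) \<and>
     measure M {\<omega> \<in> space M. Y \<omega> = 0} = 1 / (real p + 1)"

text \<open>The sum over primes converges almost surely, but not absolutely; it is taken in
  increasing order of the primes. On the null set where it diverges the value of
  \<open>suminf\<close> is irrelevant.\<close>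

definition gamma_rand :: "(nat \<Rightarrow> 'a \<Rightarrow> real) \<Rightarrow> 'a \<Rightarrow> real" where
  "gamma_rand X \<omega> = euler_mascheroni -
     (\<Sum>p. if prime p then ln (real p) * X p \<omega> / (real p - X p \<omega>) else 0)"

definition Laplace :: "'a measure \<Rightarrow> (nat \<Rightarrow> 'a \<Rightarrow> real) \<Rightarrow> complex \<Rightarrow> complex" where
  "Laplace M X s = (\<integral>\<omega>. exp (s * complex_of_real (gamma_rand X \<omega>)) \<partial>M)"

text \<open>At a real argument the Laplace transform is a positive real number, so its real part
  is the number itself.\<close>

definition Laplace_real :: "'a measure \<Rightarrow> (nat \<Rightarrow> 'a \<Rightarrow> real) \<Rightarrow> real \<Rightarrow> real" where
  "Laplace_real M X r = Re (Laplace M X (complex_of_real r))"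

definition log_Laplace :: "'a measure \<Rightarrow> (nat \<Rightarrow> 'a \<Rightarrow> real) \<Rightarrow> real \<Rightarrow> real" where
  "log_Laplace M X r = ln (Laplace_real M X r)"

definition kappa :: "'a measure \<Rightarrow> (nat \<Rightarrow> 'a \<Rightarrow> real) \<Rightarrow> real \<Rightarrow> real" where
  "kappa M X \<tau> = (THE r. deriv (log_Laplace M X) r = \<tau>)"

definition kappa_tilde :: "'a measure \<Rightarrow> (nat \<Rightarrow> 'a \<Rightarrow> real) \<Rightarrow> real \<Rightarrow> real" where
  "kappa_tilde M X \<tau> = (THE r. deriv (log_Laplace M X) (- r) = - \<tau>)"

end

theory Submission
  imports Defs "HOL-Number_Theory.Prime_Powers" "HOL-Real_Asymp.Real_Asymp"
begin

text \<open>
  Saddle point method. Both tails are upper tails of a series \<open>G = c0 + (\<Sum>p. Y p)\<close> of independent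
  three-valued variables of size \<open>ln p / p\<close>, whose logarithmic Laplace transform \<open>LL\<close> is a sum over
  primes with \<open>LL'' r\<close> of exact order \<open>1 / r\<close>. Under the measure with density \<open>exp (r G - LL r)\<close> the
  variable \<open>G - LL' r\<close> is centred with variance \<open>LL'' r\<close>. Its characteristic function is a product of
  factors that differ from Gaussian ones by third moments of total size \<open>r\<^sup>-\<^sup>2\<close>, while the primes with
  \<open>(r + |y|) ln p / p\<close> small give decay like \<open>exp (- c y\<^sup>2 / (r + |y|))\<close>; so it differs from the
  Gaussian one by \<open>O(1)\<close> in the \<open>L\<^sup>1\<close> norm. By Levy inversion the probabilities of \<open>{0<..x}\<close> differ by
  \<open>O(x)\<close>, hence the integrals of \<open>exp (- r x)\<close> over \<open>x > 0\<close> differ by \<open>O(1 / r)\<close>, against a main term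
  \<open>1 / (r sqrt (2 pi LL'' r))\<close> of order \<open>1 / sqrt r\<close>.
\<close>

section \<open>Sums over primes\<close>

text \<open>A uniform Berry-Esseen bound is too weak here: third moments of total size
  \<open>1 / r^2\<close> over the variance to the power 3/2 give an error of order
  \<open>1 / sqrt r\<close> in the distribution function, which is the size of the main term. The
  gain comes from an error proportional to the length of the interval, which
  \<open>exp (- r x)\<close> then weighs by \<open>1 / r\<close>. The price is a bound for the
  difference of characteristic functions that is integrable on the whole line. No fixed finite set
  of primes gives it, a finite product of three-point characteristic functions being almost
  periodic, so the primes used must move with \<open>y\<close>. Those with \<open>xp p\<close> just
  below a multiple of \<open>1 / L\<close>, \<open>L = r + |y|\<close>, have squares summing to at
  least a constant over \<open>L\<close>; hence the exponent \<open>y^2 / (r + |y|)\<close>,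
  Gaussian up to \<open>|y| = r\<close> and exponential beyond. The arithmetic input is Chebyshev's
  upper bound for theta and Mertens' first theorem. Since the sum of \<open>ln p / p\<close>
  diverges, the random series converges only conditionally, and its convergence is proved before its
  Laplace transform is written as a product.\<close>

definition primes_upto :: "nat \<Rightarrow> nat set" where
  "primes_upto n = {p. prime p \<and> p \<le> n}"

lemma finite_primes_upto [simp, intro]: "finite (primes_upto n)"
  by (rule finite_subset[of _ "{..n}"]) (auto simp: primes_upto_def)

lemma primes_upto_mono: "m \<le> n \<Longrightarrow> primes_upto m \<subseteq> primes_upto n"
  by (auto simp: primes_upto_def)

section \<open>Chebyshev's function theta and a linear upper bound\<close>

definition primes_theta :: "nat \<Rightarrow> real" where
  "primes_theta n = (\<Sum>p\<in>primes_upto n. ln (real p))"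

lemma prod_primes_dvd:
  fixes A :: "nat set"
  assumes "finite A" "\<And>p. p \<in> A \<Longrightarrow> prime p" "\<And>p. p \<in> A \<Longrightarrow> p dvd m"
  shows "\<Prod>A dvd m"
  using assms
proof (induction A rule: finite_induct)
  case (insert p A)
  have "coprime p (\<Prod>A)"
    by (rule prod_coprime_right) (use insert in \<open>auto intro!: primes_coprime\<close>)
  then show ?case using insert by (simp add: divides_mult)
qed auto

text \<open>Every prime in \<open>(n, 2n]\<close> divides the central binomial coefficient, since it
  divides \<open>fact (2 * n)\<close> but not \<open>fact n\<close>, and that coefficient is at most
  \<open>2 ^ (2 * n) = 4 ^ n\<close>.\<close>

lemma primes_theta_double:
  "primes_theta (2 * n) \<le> primes_theta n + real n * ln 4"
proof -
  let ?A = "{p. prime p \<and> n < p \<and> p \<le> 2 * n}"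
  have fin: "finite ?A" by (rule finite_subset[of _ "{..2*n}"]) auto
  have dvd: "p dvd ((2 * n) choose n)" if "p \<in> ?A" for p
  proof -
    have p: "prime p" "n < p" "p \<le> 2 * n" using that by auto
    have "fact n * fact n * ((2 * n) choose n) = (fact (2 * n) :: nat)"
      using binomial_fact_lemma[of n "2 * n"] by (simp add: mult_2)
    moreover have "p dvd (fact (2 * n) :: nat)" using p by (simp add: prime_dvd_fact_iff)
    moreover have "\<not> p dvd (fact n :: nat)" using p by (simp add: prime_dvd_fact_iff)
    ultimately show ?thesis using p(1) by (metis prime_dvd_mult_iff)
  qed
  have "\<Prod>?A dvd ((2 * n) choose n)"
    by (rule prod_primes_dvd[OF fin]) (use dvd in auto)
  hence "\<Prod>?A \<le> ((2 * n) choose n)" by (rule dvd_imp_le) simp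
  also have "\<dots> \<le> 4 ^ n"
    using binomial_le_pow2[of "2 * n" n] by (simp add: power_mult)
  finally have le: "real (\<Prod>?A) \<le> 4 ^ n"
    by (metis of_nat_le_iff of_nat_numeral of_nat_power)
  have pos: "real (\<Prod>?A) > 0"
    unfolding of_nat_prod by (intro prod_pos) (auto dest: prime_gt_0_nat)
  have "(\<Sum>p\<in>?A. ln (real p)) = ln (real (\<Prod>?A))"
    unfolding of_nat_prod by (subst ln_prod) (auto simp: fin dest: prime_gt_0_nat)
  also have "\<dots> \<le> ln (4 ^ n)" using le pos by (subst ln_le_cancel_iff) auto
  also have "\<dots> = real n * ln 4" by (simp add: ln_realpow)
  finally have A: "(\<Sum>p\<in>?A. ln (real p)) \<le> real n * ln 4" .
  have "primes_upto (2 * n) = primes_upto n \<union> ?A" by (auto simp: primes_upto_def)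
  moreover have disj: "primes_upto n \<inter> ?A = {}" by (auto simp: primes_upto_def)
  ultimately have "primes_theta (2 * n) = primes_theta n + (\<Sum>p\<in>?A. ln (real p))"
    unfolding primes_theta_def
    by (metis (no_types, lifting) fin finite_primes_upto sum.union_disjoint disj)
  with A show ?thesis by linarith
qed

lemma primes_theta_le: "primes_theta n \<le> 4 * real n"
proof -
  have ln4: "ln 4 \<le> (3/2 :: real)"
  proof -
    have "ln (4::real) = 2 * ln 2" using ln_realpow[of 2 2] by simp
    thus ?thesis using ln2_le_25_over_36 by simp
  qed
  \<comment> \<open>The logarithm pays for odd \<open>n\<close>: from \<open>m\<close> to
    \<open>n = 2 * m + 1\<close> it grows by exactly \<open>2 * ln 2\<close>, which covers the
    constant in the bound for the one extra term \<open>ln n\<close>. The slope 3 leaves room for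
    \<open>ln 4 <= 3/2\<close> and for the remaining \<open>1.5 * m\<close>.\<close>
  have aux: "primes_theta n \<le> 3 * real n + 2 * ln (real n + 1)" for n
  proof (induction n rule: less_induct)
    case (less n)
    show ?case
    proof (cases "n \<le> 1")
      case True
      hence "primes_upto n = {}" by (auto simp: primes_upto_def dest: prime_ge_2_nat)
      thus ?thesis by (simp add: primes_theta_def)
    next
      case False
      define m where "m = n div 2"
      have m: "m < n" "n = 2 * m \<or> n = 2 * m + 1" "m \<ge> 1" using False by (auto simp: m_def)
      have dbl: "primes_theta (2 * m) \<le> 3 * real m + 2 * ln (real m + 1) + real m * ln 4"
        using primes_theta_double[of m] less[OF m(1)] by linarith
      have l: "real m * ln 4 \<le> real m * (3/2)" using ln4 by (intro mult_left_mono) auto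
      show ?thesis using m(2)
      proof
        assume n: "n = 2 * m"
        have "ln (real m + 1) \<le> ln (real n + 1)" "real n = 2 * real m" using n by simp_all
        moreover have "primes_theta n = primes_theta (2 * m)" by (simp add: n)
        ultimately show ?thesis using dbl l by linarith
      next
        assume n: "n = 2 * m + 1"
        have "primes_theta n \<le> primes_theta (2 * m) + ln (real n)"
        proof -
          have "primes_upto n \<subseteq> insert n (primes_upto (2 * m))" using n by (auto simp: primes_upto_def)
          hence "primes_theta n \<le> (\<Sum>p\<in>insert n (primes_upto (2 * m)). ln (real p))"
            unfolding primes_theta_def using n
            by (intro sum_mono2) (auto simp: primes_upto_def intro!: ln_ge_zero dest: prime_gt_0_nat)
          also have "\<dots> = primes_theta (2 * m) + ln (real n)"
            unfolding primes_theta_def using n by (subst sum.insert) (auto simp: primes_upto_def)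
          finally show ?thesis .
        qed
        moreover have "ln (real m + 1) + ln 2 = ln (real n + 1)"
        proof -
          have "ln (real m + 1) + ln 2 = ln ((real m + 1) * 2)" by (rule ln_mult_pos[symmetric]) auto
          thus ?thesis using n by (simp add: algebra_simps)
        qed
        moreover have "ln (real n) \<le> 2 * ln 2 + 1.5 * real m"
        proof -
          have "real n \<le> 4 * exp (real m)"
          proof -
            have "1 + real m \<le> exp (real m)" by (rule exp_ge_add_one_self)
            moreover have "real n = 2 * real m + 1" using n by simp
            ultimately show ?thesis by linarith
          qed
          hence "ln (real n) \<le> ln (4 * exp (real m))" using n by (subst ln_le_cancel_iff) auto
          also have "\<dots> = 2 * ln 2 + real m" using ln_realpow[of 2 2] by (simp add: ln_mult_pos)
          finally show ?thesis by simp
        qed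
        ultimately show ?thesis using dbl l n by simp
      qed
    qed
  qed
  \<comment> \<open>Absorbs \<open>2 * ln (real n + 1)\<close> into the slope 4; the tangent to
    \<open>ln\<close> at 4 is sharp enough from \<open>n = 3\<close> on.\<close>
  have "ln (real n + 1) \<le> real n / 2" if "n \<ge> 3"
  proof -
    have "ln (real n + 1) = ln ((real n + 1) / 4) + ln 4" using ln_div[of "real n + 1" 4] by simp
    also have "\<dots> \<le> ((real n + 1) / 4 - 1) + 25/18"
      using ln_le_minus_one[of "(real n + 1) / 4"] ln2_le_25_over_36 ln_realpow[of 2 2] by simp
    also have "\<dots> \<le> real n / 2" using of_nat_mono[OF that, where 'a = real] by (simp add: field_simps)
    finally show ?thesis .
  qed
  hence "primes_theta n \<le> 4 * real n" if "n \<ge> 3" using aux[of n] that by simp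
  moreover have "primes_theta n \<le> 4 * real n" if "n < 3"
  proof -
    have "primes_upto n = (if n = 2 then {2} else {})"
      using that by (auto simp: primes_upto_def dest: prime_ge_2_nat)
    thus ?thesis using ln2_le_25_over_36 by (simp add: primes_theta_def)
  qed
  ultimately show ?thesis by linarith
qed

section \<open>Mertens' first theorem, upper and lower bound\<close>

text \<open>Summing the von Mangoldt identity over \<open>m \<le> n\<close> replaces Legendre's formula.\<close>

lemma sum_ln_eq_mangoldt:
  "(\<Sum>m=1..n. ln (real m)) = (\<Sum>d=1..n. mangoldt d * real (n div d))"
proof -
  have "(\<Sum>m=1..n. ln (real m)) = (\<Sum>m=1..n. \<Sum>d\<in>{d\<in>{1..n}. d dvd m}. mangoldt d)"
  proof (rule sum.cong[OF refl])
    fix m assume m: "m \<in> {1..n}"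
    hence "{d\<in>{1..n}. d dvd m} = {d. d dvd m}"
      by (auto dest: dvd_imp_le intro: Suc_leI dvd_pos_nat)
    thus "ln (real m) = (\<Sum>d\<in>{d\<in>{1..n}. d dvd m}. mangoldt d)"
      using mangoldt_sum[of m, where 'a = real] m by simp
  qed
  also have "\<dots> = (\<Sum>d=1..n. \<Sum>m\<in>{m\<in>{1..n}. d dvd m}. mangoldt d)"
    by (rule sum.swap_restrict) auto
  also have "\<dots> = (\<Sum>d=1..n. mangoldt d * real (n div d))"
  proof (rule sum.cong[OF refl])
    fix d assume d: "d \<in> {1..n}"
    have "{m\<in>{1..n}. d dvd m} = (\<lambda>k. d * k) ` {1..n div d}"
    proof (intro equalityI subsetI)
      fix m assume "m \<in> {m\<in>{1..n}. d dvd m}"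
      then obtain k where "m = d * k" "1 \<le> d * k" "d * k \<le> n" by auto
      with d show "m \<in> (\<lambda>k. d * k) ` {1..n div d}"
        by (auto simp: less_eq_div_iff_mult_less_eq mult.commute intro!: imageI Suc_leI)
    next
      fix m assume "m \<in> (\<lambda>k. d * k) ` {1..n div d}"
      with d show "m \<in> {m\<in>{1..n}. d dvd m}"
        by (auto simp: less_eq_div_iff_mult_less_eq mult.commute)
    qed
    moreover have "inj_on (\<lambda>k. d * k) {1..n div d}" using d by (auto simp: inj_on_def)
    ultimately have "card {m\<in>{1..n}. d dvd m} = n div d" by (simp add: card_image)
    thus "(\<Sum>m\<in>{m\<in>{1..n}. d dvd m}. mangoldt d) = mangoldt d * real (n div d)" by simp
  qed
  finally show ?thesis .
qed

lemma sum_ln_ge: "(\<Sum>m=1..n. ln (real m)) \<ge> real n * ln (real n) - real n"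
proof (induction n)
  case (Suc n)
  show ?case
  proof (cases "n = 0")
    case False
    have "ln (real (Suc n) / real n) \<le> real (Suc n) / real n - 1"
      using False by (intro ln_le_minus_one) auto
    hence "ln (real (Suc n)) \<le> ln (real n) + 1 / real n"
      using False by (subst (asm) ln_div) (auto simp: field_simps)
    hence "real n * ln (real (Suc n)) \<le> real n * (ln (real n) + 1 / real n)"
      by (intro mult_left_mono) auto
    also have "\<dots> = real n * ln (real n) + 1" using False by (simp add: field_simps)
    finally show ?thesis using Suc.IH by (simp add: algebra_simps)
  qed simp
qed simp

lemma sum_ln_le: "(\<Sum>m=1..n. ln (real m)) \<le> real n * ln (real n)"
  using sum_bounded_above[of "{1..n}" "\<lambda>m. ln (real m)" "ln (real n)"] by simp

text \<open>The scale of the jump at the prime \<open>p\<close>: both nonzero values of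
  \<open>ln p * X p / (p - X p)\<close> have modulus between \<open>2/3\<close> and \<open>2\<close>
  times this.\<close>

definition xp :: "nat \<Rightarrow> real" where "xp p = ln (real p) / real p"

lemma xp_nonneg: "xp p \<ge> 0"
  by (cases "p = 0") (auto simp: xp_def)

lemma xp_pos: "prime p \<Longrightarrow> xp p > 0"
  using prime_gt_1_nat[of p] by (auto simp: xp_def)

text \<open>In the von Mangoldt identity for the sum of \<open>ln m\<close> only the primes are kept
  and \<open>n div p\<close> is replaced by \<open>n / p - 1\<close>. The total loss from the
  \<open>- 1\<close> is \<open>primes_theta n <= 4 * n\<close>, whence the constant 4.\<close>

lemma mertens_upper: "(\<Sum>p\<in>primes_upto n. xp p) \<le> ln (real n) + 4"
proof (cases "n = 0")
  case False
  have "real n * (\<Sum>p\<in>primes_upto n. xp p) - primes_theta n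
      = (\<Sum>p\<in>primes_upto n. ln (real p) * (real n / real p - 1))"
    by (simp add: primes_theta_def sum_distrib_left xp_def algebra_simps sum_subtractf)
  also have "\<dots> \<le> (\<Sum>p\<in>primes_upto n. mangoldt p * real (n div p))"
  proof (rule sum_mono)
    fix p assume "p \<in> primes_upto n"
    hence p: "prime p" by (simp add: primes_upto_def)
    hence m: "mangoldt p = ln (real p)" by (simp add: mangoldt_def aprimedivisor_of_prime primepow_prime)
    have "real n / real p - 1 \<le> real (n div p)"
    proof -
      have "n < p * (n div p + 1)" using p
        by (metis Suc_eq_plus1 dividend_less_times_div mult_Suc_right prime_gt_0_nat add.commute)
      hence "real n < real p * (real (n div p) + 1)"
        by (metis of_nat_less_iff of_nat_mult of_nat_1 of_nat_add)
      thus ?thesis using prime_gt_0_nat[OF p] by (simp add: field_simps)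
    qed
    thus "ln (real p) * (real n / real p - 1) \<le> mangoldt p * real (n div p)"
      unfolding m using prime_gt_0_nat[OF p] by (intro mult_left_mono) (auto intro!: ln_ge_zero)
  qed
  also have "\<dots> \<le> (\<Sum>p=1..n. mangoldt p * real (n div p))"
    by (intro sum_mono2) (auto simp: primes_upto_def mangoldt_nonneg dest: prime_gt_0_nat)
  also have "\<dots> \<le> real n * ln (real n)" using sum_ln_le[of n] unfolding sum_ln_eq_mangoldt .
  finally have "real n * (\<Sum>p\<in>primes_upto n. xp p) \<le> real n * (ln (real n) + 4)"
    using primes_theta_le[of n] by (simp add: algebra_simps)
  thus ?thesis using False by simp
next
  case True
  hence "primes_upto n = {}" by (auto simp: primes_upto_def)
  thus ?thesis using True by simp
qed

lemma sum_geometric_inverse_le: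
  fixes p :: real
  assumes "p \<ge> 2"
  shows "(\<Sum>k\<in>{2..n}. 1 / p ^ k) \<le> 2 / p\<^sup>2"
proof -
  \<comment> \<open>The subtracted \<open>1 / p ^ n\<close> makes the induction close, because
    \<open>2 / p ^ (n + 1) <= 1 / p ^ n\<close> for \<open>p >= 2\<close>.\<close>
  have "(\<Sum>k\<in>{2..n}. 1 / p ^ k) \<le> 2 / p\<^sup>2 - 1 / p ^ n" if "n \<ge> 2"
    using that
  proof (induction n rule: dec_induct)
    case (step n)
    have "(\<Sum>k\<in>{2..Suc n}. 1 / p ^ k) = (\<Sum>k\<in>{2..n}. 1 / p ^ k) + 1 / p ^ Suc n"
      using step by simp
    also have "\<dots> \<le> 2 / p\<^sup>2 - 1 / p ^ n + 1 / p ^ Suc n" using step by simp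
    also have "2 / p ^ Suc n \<le> 1 / p ^ n" using assms by (simp add: field_simps)
    hence "2 / p\<^sup>2 - 1 / p ^ n + 1 / p ^ Suc n \<le> 2 / p\<^sup>2 - 1 / p ^ Suc n" by simp
    finally show ?case .
  qed (use assms in \<open>simp add: field_simps power2_eq_square\<close>)
  moreover have "1 / p ^ n \<ge> 0" "2 / p\<^sup>2 \<ge> 0" using assms by simp_all
  ultimately show ?thesis by (cases "n \<ge> 2") (linarith, simp)
qed

lemma ln_le_2_sqrt: "x > 0 \<Longrightarrow> ln x \<le> 2 * (sqrt x - 1)"
  using ln_le_minus_one[of "sqrt x"] by (simp add: ln_sqrt)

lemma summable_ln_over_square: "summable (\<lambda>n. ln (real n) / real n ^ 2)"
proof (rule summable_comparison_test')
  show "summable (\<lambda>n. 2 * real n powr (-3/2))"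
    by (intro summable_mult) (simp add: summable_real_powr_iff)
  fix n :: nat assume n: "n \<ge> 1"
  have "ln (real n) \<le> 2 * sqrt (real n)" using ln_le_2_sqrt[of "real n"] n by simp
  hence "ln (real n) / real n ^ 2 \<le> 2 * sqrt (real n) / real n ^ 2" by (intro divide_right_mono) auto
  also have "\<dots> = 2 * (real n powr (1/2) / real n powr 2)" using n by (simp add: powr_half_sqrt)
  also have "\<dots> = 2 * real n powr (-3/2)" by (subst powr_diff[symmetric]) simp
  finally show "norm (ln (real n) / real n ^ 2) \<le> 2 * real n powr (-3/2)" using n by simp
qed

text \<open>Needed to pass from von Mangoldt's function to primes. For fixed \<open>p\<close> the
  powers \<open>p ^ k\<close> with \<open>k >= 2\<close> contribute at most
  \<open>2 * ln p / p^2\<close>, the terms of a convergent series. When \<open>p ^ k <= n\<close>,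
  both \<open>p\<close> and \<open>k\<close> are at most \<open>n\<close>, so a finite rectangle
  covers all pairs.\<close>

lemma mangoldt_prime_powers_bounded:
  "\<exists>C\<ge>0. \<forall>n. (\<Sum>d | d \<in> {1..n} \<and> \<not> prime d. mangoldt d / real d) \<le> (C :: real)"
proof (intro exI[of _ "2 * (\<Sum>n. ln (real n) / real n ^ 2)"] conjI allI)
  have nn: "ln (real n) / real n ^ 2 \<ge> 0" for n by (cases "n = 0") auto
  show "2 * (\<Sum>n. ln (real n) / real n ^ 2) \<ge> 0"
    using suminf_nonneg[OF summable_ln_over_square] nn by simp
  fix n :: nat
  let ?A = "{d. d \<in> {1..n} \<and> \<not> prime d \<and> primepow d}"
  let ?B = "primes_upto n \<times> {2..n}"
  have fin: "finite ?B" by auto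
  have sub: "?A \<subseteq> (\<lambda>(p, k). p ^ k) ` ?B"
  proof
    fix d assume d: "d \<in> ?A"
    then obtain p k where pk: "prime p" "k > 0" "d = p ^ k" by (auto simp: primepow_def)
    have k: "k \<ge> 2" using pk d by (cases "k = 1") auto
    have "k < p ^ k" using prime_gt_1_nat[OF pk(1)] by (intro power_gt_expt) simp
    moreover have "p \<le> p ^ k" using pk by (intro self_le_power) (auto dest: prime_gt_0_nat)
    ultimately have "(p, k) \<in> ?B" using d pk k by (auto simp: primes_upto_def)
    thus "d \<in> (\<lambda>(p, k). p ^ k) ` ?B" using pk by force
  qed
  have "(\<Sum>d | d \<in> {1..n} \<and> \<not> prime d. mangoldt d / real d :: real) = (\<Sum>d\<in>?A. mangoldt d / real d)"
    by (rule sum.mono_neutral_right) (auto simp: mangoldt_def)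
  also have "\<dots> \<le> (\<Sum>d\<in>(\<lambda>(p, k). p ^ k) ` ?B. mangoldt d / real d)"
    using fin sub by (intro sum_mono2) (auto simp: mangoldt_nonneg)
  also have "\<dots> \<le> (\<Sum>x\<in>?B. ((\<lambda>d. mangoldt d / real d) \<circ> (\<lambda>(p, k). p ^ k)) x)"
    by (rule sum_image_le[OF fin]) (auto simp: mangoldt_nonneg)
  also have "\<dots> = (\<Sum>x\<in>?B. case x of (p, k) \<Rightarrow> ln (real p) * (1 / real p ^ k))"
  proof (rule sum.cong[OF refl])
    fix x assume x: "x \<in> ?B"
    obtain p k where [simp]: "x = (p, k)" by (cases x)
    have "prime p" "k > 0" using x by (auto simp: primes_upto_def)
    thus "((\<lambda>d. mangoldt d / real d) \<circ> (\<lambda>(p, k). p ^ k)) x = (case x of (p, k) \<Rightarrow> ln (real p) * (1 / real p ^ k))"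
      by (simp add: mangoldt_def aprimedivisor_prime_power primepow_power_iff_nat)
  qed
  also have "\<dots> = (\<Sum>p\<in>primes_upto n. ln (real p) * (\<Sum>k\<in>{2..n}. 1 / real p ^ k))"
    by (simp add: sum.cartesian_product sum_distrib_left)
  also have "\<dots> \<le> (\<Sum>p\<in>primes_upto n. ln (real p) * (2 / real p ^ 2))"
    by (intro sum_mono mult_left_mono sum_geometric_inverse_le)
       (auto simp: primes_upto_def intro!: ln_ge_zero dest: prime_ge_2_nat prime_gt_0_nat)
  also have "\<dots> = 2 * (\<Sum>p\<in>primes_upto n. ln (real p) / real p ^ 2)"
    by (simp add: sum_distrib_left mult_ac)
  also have "\<dots> \<le> 2 * (\<Sum>n. ln (real n) / real n ^ 2)"
    using sum_le_suminf[OF summable_ln_over_square, of "primes_upto n"] nn by auto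
  finally show "(\<Sum>d | d \<in> {1..n} \<and> \<not> prime d. mangoldt d / real d) \<le> 2 * (\<Sum>n. ln (real n) / real n ^ 2)" .
qed

text \<open>Here \<open>n div d <= n / d\<close> goes the right way, so no remainder arises. The
  \<open>- n\<close> in \<open>sum_ln_ge\<close> costs 1, and the proper prime powers cost the
  constant of \<open>mangoldt_prime_powers_bounded\<close>.\<close>

lemma mertens_lower: "\<exists>C. \<forall>n\<ge>1. (\<Sum>p\<in>primes_upto n. xp p) \<ge> ln (real n) - C"
proof -
  obtain C where C: "C \<ge> 0" "\<And>n. (\<Sum>d | d \<in> {1..n} \<and> \<not> prime d. mangoldt d / real d) \<le> (C :: real)"
    using mangoldt_prime_powers_bounded by blast
  have "(\<Sum>p\<in>primes_upto n. xp p) \<ge> ln (real n) - (C + 1)" if n: "n \<ge> 1" for n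
  proof -
    have "real n * ln (real n) - real n \<le> (\<Sum>d=1..n. mangoldt d * real (n div d))"
      using sum_ln_ge[of n] unfolding sum_ln_eq_mangoldt .
    also have "\<dots> \<le> (\<Sum>d=1..n. mangoldt d * (real n / real d))"
      by (intro sum_mono mult_left_mono mangoldt_nonneg of_nat_div_le_of_nat)
    also have "\<dots> = real n * (\<Sum>d=1..n. mangoldt d / real d)"
      by (simp add: sum_distrib_left mult_ac)
    also have "(\<Sum>d=1..n. mangoldt d / real d) =
       (\<Sum>d\<in>primes_upto n. mangoldt d / real d) + (\<Sum>d | d \<in> {1..n} \<and> \<not> prime d. mangoldt d / real d)"
    proof -
      have "{1..n} = primes_upto n \<union> {d. d \<in> {1..n} \<and> \<not> prime d}"
        by (auto simp: primes_upto_def Suc_le_eq dest: prime_gt_0_nat)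
      moreover have "primes_upto n \<inter> {d. d \<in> {1..n} \<and> \<not> prime d} = {}"
        by (auto simp: primes_upto_def)
      moreover have "finite {d. d \<in> {1..n} \<and> \<not> prime d}" by simp
      ultimately show ?thesis
        by (metis (no_types, lifting) sum.union_disjoint finite_primes_upto)
    qed
    also have "(\<Sum>d\<in>primes_upto n. mangoldt d / real d) = (\<Sum>p\<in>primes_upto n. xp p)"
      by (intro sum.cong) (auto simp: primes_upto_def xp_def mangoldt_def aprimedivisor_of_prime primepow_prime)
    finally have "real n * (ln (real n) - 1) \<le> real n *
       ((\<Sum>p\<in>primes_upto n. xp p) + (\<Sum>d | d \<in> {1..n} \<and> \<not> prime d. mangoldt d / real d))"
      by (simp add: algebra_simps)
    hence "ln (real n) - 1 \<le> (\<Sum>p\<in>primes_upto n. xp p) + (\<Sum>d | d \<in> {1..n} \<and> \<not> prime d. mangoldt d / real d)"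
      using n by (simp del: mult_le_cancel_left)
    thus ?thesis using C(2)[of n] by linarith
  qed
  thus ?thesis by blast
qed

section \<open>Sums of \<open>xp p ^ 2\<close> at a given scale\<close>

text \<open>3 is the first integer beyond e, where \<open>ln x / x\<close> begins to decrease; given
  \<open>ln n >= 1\<close>, it is enough that \<open>ln (m / n) <= m / n - 1\<close>.\<close>

lemma ln_over_self_antimono:
  assumes "3 \<le> n" "n \<le> m"
  shows "xp m \<le> xp n"
proof -
  have n: "real n \<ge> exp 1" using exp_le assms by (metis of_nat_le_iff of_nat_numeral order_trans)
  hence l: "ln (real n) \<ge> 1" using assms by (subst ln_ge_iff) auto
  have "ln (real m) = ln (real n) + ln (real m / real n)" using assms by (simp add: ln_div)
  also have "\<dots> \<le> ln (real n) + (real m / real n - 1) * 1"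
    using assms ln_le_minus_one[of "real m / real n"] by simp
  also have "\<dots> \<le> ln (real n) + (real m / real n - 1) * ln (real n)"
    using l assms by (intro add_left_mono mult_left_mono) auto
  finally show ?thesis using assms by (simp add: xp_def field_simps)
qed

text \<open>Dyadic blocks: by Chebyshev the primes in \<open>(n, 2n]\<close> contribute at most
  \<open>8 * ln (2 * n) / n\<close>, and the rest is the same sum started at \<open>2 * n\<close>.
  The constant 32 closes the induction because \<open>n >= 8 = 2 ^ 3\<close> gives
  \<open>3 * ln (2 * n) <= 4 * ln n\<close>.\<close>

lemma sum_xp_square_tail:
  assumes "n \<ge> 8"
  shows "(\<Sum>p | prime p \<and> p \<in> {n<..N}. xp p ^ 2) \<le> 32 * xp n"
  using assms
proof (induction "N - n" arbitrary: n rule: less_induct)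
  case (less n)
  let ?T = "\<lambda>n N. (\<Sum>p | prime p \<and> p \<in> {n<..N}. xp p ^ 2)"
  show ?case
  proof (cases "n < N")
    case False
    hence e: "{p. prime p \<and> p \<in> {n<..N}} = {}" by auto
    show ?thesis unfolding e using xp_nonneg[of n] by simp
  next
    case True
    have ln2n: "3 * ln (2 * real n) \<le> 4 * ln (real n)"
    proof -
      have "ln (2 ^ 3 :: real) \<le> ln (real n)" using less.prems by (subst ln_le_cancel_iff) auto
      hence "3 * ln 2 \<le> ln (real n)" by (subst (asm) ln_realpow) auto
      thus ?thesis using less.prems by (simp add: ln_mult)
    qed
    have "?T n (2 * n) \<le> (\<Sum>p | prime p \<and> p \<in> {n<..2*n}. ln (real p) * (ln (2 * real n) / real n ^ 2))"
    proof (rule sum_mono)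
      fix p assume "p \<in> {p. prime p \<and> p \<in> {n<..2*n}}"
      hence p: "prime p" "n < p" "p \<le> 2 * n" by auto
      have lp: "0 \<le> ln (real p)" "ln (real p) \<le> ln (2 * real n)" using p less.prems by auto
      have "xp p ^ 2 = ln (real p) * (ln (real p) / real p ^ 2)" by (simp add: xp_def power2_eq_square)
      also have "\<dots> \<le> ln (real p) * (ln (2 * real n) / real n ^ 2)"
        using lp p less.prems by (intro mult_left_mono frac_le power_mono) auto
      finally show "xp p ^ 2 \<le> ln (real p) * (ln (2 * real n) / real n ^ 2)" .
    qed
    also have "\<dots> = (\<Sum>p | prime p \<and> p \<in> {n<..2*n}. ln (real p)) * (ln (2 * real n) / real n ^ 2)"
      by (rule sum_distrib_right[symmetric])
    also have "\<dots> \<le> primes_theta (2 * n) * (ln (2 * real n) / real n ^ 2)"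
      using less.prems unfolding primes_theta_def
      by (intro mult_right_mono sum_mono2)
         (auto simp: primes_upto_def intro!: divide_nonneg_nonneg ln_ge_zero dest: prime_gt_0_nat)
    also have "\<dots> \<le> (4 * real (2 * n)) * (ln (2 * real n) / real n ^ 2)"
      using less.prems by (intro mult_right_mono primes_theta_le) auto
    also have "\<dots> = 8 * ln (2 * real n) / real n" using less.prems by (simp add: power2_eq_square)
    finally have 1: "?T n (2 * n) \<le> 8 * ln (2 * real n) / real n" .
    have "?T (2 * n) N \<le> 32 * xp (2 * n)" using less True by (intro less(1)) auto
    hence 2: "?T (2 * n) N \<le> 16 * ln (2 * real n) / real n" by (simp add: xp_def)
    have "?T n N \<le> (\<Sum>p\<in>{p. prime p \<and> p \<in> {n<..2*n}} \<union> {p. prime p \<and> p \<in> {2*n<..N}}. xp p ^ 2)"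
      by (intro sum_mono2) auto
    also have "\<dots> = ?T n (2 * n) + ?T (2 * n) N" by (intro sum.union_disjoint) auto
    also have "\<dots> \<le> 8 * (3 * ln (2 * real n)) / real n" using 1 2 by (simp add: field_simps)
    also have "\<dots> \<le> 8 * (4 * ln (real n)) / real n" using ln2n by (intro divide_right_mono) auto
    finally show ?thesis by (simp add: xp_def)
  qed
qed

text \<open>Inverts \<open>n / ln n\<close> up to a constant: for \<open>n\<close> about
  \<open>2 * L * ln L\<close>, \<open>ln n\<close> lies between \<open>ln L\<close> and
  \<open>2 * ln L\<close>. The threshold 100 gives \<open>sqrt L >= 10\<close>, enough for
  \<open>2 * ln L + 1 <= L\<close>.\<close>

lemma ex_nat_over_ln_between:
  fixes L :: real
  assumes "L \<ge> 100"
  shows "\<exists>n\<ge>8. L \<le> real n / ln (real n) \<and> real n / ln (real n) \<le> 3 * L"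
proof -
  define n where "n = nat \<lceil>2 * L * ln L\<rceil>"
  have lnL: "ln L \<ge> 1" using assms exp_le by (subst ln_ge_iff) auto
  have n1: "2 * L * ln L \<le> real n" unfolding n_def by linarith
  have "2 * L * ln L \<ge> 0" using lnL assms by simp
  hence n2: "real n \<le> 2 * L * ln L + 1" unfolding n_def by linarith
  have LlnL: "L * 1 \<le> L * ln L" using lnL assms by (intro mult_left_mono) auto
  have nL: "real n \<ge> 2 * L" using n1 LlnL by linarith
  have "sqrt 100 \<le> sqrt L" using assms by (subst real_sqrt_le_iff)
  hence s: "sqrt L \<ge> 10" using real_sqrt_unique[of 10 100] by simp
  have "10 * sqrt L \<le> sqrt L * sqrt L" using s assms by (intro mult_right_mono) auto
  hence "10 * sqrt L \<le> L" using assms by simp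
  moreover have "ln L \<le> 2 * (sqrt L - 1)" using assms by (intro ln_le_2_sqrt) auto
  ultimately have "2 * ln L \<le> 2 * (2 * (sqrt L - 1))" "4 * sqrt L \<le> L" using s by linarith+
  hence "2 * ln L + 1 \<le> L" by argo
  hence "L * (2 * ln L + 1) \<le> L * L" using assms by (intro mult_left_mono) auto
  hence "real n \<le> L ^ 2" using n2 assms by (simp add: power2_eq_square algebra_simps)
  hence "ln (real n) \<le> ln (L ^ 2)" using nL assms by (subst ln_le_cancel_iff) auto
  hence u: "ln (real n) \<le> 2 * ln L" using assms by (simp add: ln_realpow)
  have l: "ln (real n) \<ge> ln L" using nL assms by (subst ln_le_cancel_iff) auto
  have pos: "ln (real n) > 0" using l lnL by linarith
  have "L * ln (real n) \<le> L * (2 * ln L)" using u assms by (intro mult_left_mono) auto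
  hence A: "L \<le> real n / ln (real n)" using pos n1 by (simp add: field_simps)
  have "real n \<le> 3 * L * ln L" using n2 LlnL assms by linarith
  also have "\<dots> \<le> 3 * L * ln (real n)" using l assms by (intro mult_left_mono) auto
  finally have B: "real n / ln (real n) \<le> 3 * L" using pos by (simp add: field_simps)
  have "n \<ge> 8" using nL assms by linarith
  with A B show ?thesis by blast
qed

text \<open>Split at \<open>n\<close> with \<open>n / ln n\<close> between \<open>L\<close> and
  \<open>3 * L\<close>. Beyond \<open>n\<close> the exponential is dropped and the tail bound gives
  \<open>32 * xp n <= 32 / L\<close>. Up to \<open>n\<close> it is replaced by
  \<open>6 / (a * L * xp p)^3\<close>, which leaves a sum of \<open>p / ln p\<close>; comparing
  \<open>p / (ln p)^2\<close> with its value at \<open>n\<close> reduces this to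
  \<open>primes_theta n\<close>.\<close>

lemma sum_xp_square_exp_le:
  fixes a :: real
  assumes a: "a > 0"
  shows "\<exists>C>0. \<forall>L\<ge>100. \<forall>A. finite A \<longrightarrow> (\<forall>p\<in>A. prime p) \<longrightarrow>
           (\<Sum>p\<in>A. xp p ^ 2 * exp (- a * L * xp p)) \<le> C / L"
\<comment> \<open>1944 is \<open>6 * 9 * 4 * 9\<close>: from \<open>t^3 / 6 <= exp t\<close>, from
  the comparison of \<open>p / (ln p)^2\<close>, from Chebyshev's bound, and from
  \<open>(3 * L)^2\<close>. The tail contributes 32.\<close>
proof (intro exI[of _ "1944 / a ^ 3 + 32"] conjI allI impI)
  show "1944 / a ^ 3 + 32 > 0" using a by (simp add: add_pos_pos)
  fix L :: real and A :: "nat set" assume L: "L \<ge> 100" and A: "finite A" "\<forall>p\<in>A. prime p"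
  obtain n where n: "n \<ge> 8" "L \<le> real n / ln (real n)" "real n / ln (real n) \<le> 3 * L"
    using ex_nat_over_ln_between[OF L] by blast
  let ?f = "\<lambda>p. xp p ^ 2 * exp (- a * L * xp p)"
  let ?A1 = "primes_upto n" and ?A2 = "{p. prime p \<and> p \<in> {n<..Max A}}"
  have lnn: "ln (real n) > 0" using n by simp
  have "(\<Sum>p\<in>A. ?f p) \<le> (\<Sum>p\<in>?A1 \<union> ?A2. ?f p)"
    using A by (intro sum_mono2) (auto simp: primes_upto_def)
  also have "\<dots> = (\<Sum>p\<in>?A1. ?f p) + (\<Sum>p\<in>?A2. ?f p)"
    by (intro sum.union_disjoint) (auto simp: primes_upto_def)
  also have "(\<Sum>p\<in>?A2. ?f p) \<le> (\<Sum>p\<in>?A2. xp p ^ 2)"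
    using a L by (intro sum_mono mult_left_le) (auto intro!: mult_nonneg_nonneg xp_nonneg)
  also have "\<dots> \<le> 32 * xp n" by (rule sum_xp_square_tail[OF n(1)])
  also have "xp n \<le> 1 / L" using n L lnn by (simp add: xp_def field_simps)
  also have "(\<Sum>p\<in>?A1. ?f p) \<le> (\<Sum>p\<in>?A1. ln (real p) * (54 * real n / (ln (real n) ^ 2 * a ^ 3 * L ^ 3)))"
  proof (rule sum_mono)
    fix p assume "p \<in> ?A1"
    hence p: "prime p" "p \<le> n" by (auto simp: primes_upto_def)
    \<comment> \<open>The aim is \<open>ln n <= 3 * ln p * sqrt y\<close>, that is,
      \<open>p / (ln p)^2\<close> increases up to a factor 9. The 3 comes from
      \<open>2 <= 3 * ln p\<close>, which holds because \<open>ln 2 >= 2/3\<close>.\<close>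
    define y where "y = real n / real p"
    have p2: "p \<ge> 2" using p by (simp add: prime_ge_2_nat)
    have lp: "ln (real p) \<ge> ln 2" using p2 by simp
    have l2: "ln (2::real) \<ge> 2/3" by (rule ln2_ge_two_thirds)
    have y: "y \<ge> 1" using p p2 by (simp add: y_def)
    have xpp: "xp p > 0" by (rule xp_pos[OF p(1)])
    have "ln (real n) = ln (real p) + ln y" using p2 n by (simp add: y_def ln_div)
    also have "ln y \<le> 2 * (sqrt y - 1)" using y by (intro ln_le_2_sqrt) auto
    also have "ln (real p) + 2 * (sqrt y - 1) \<le> ln (real p) * (1 + 3 * (sqrt y - 1))"
    proof -
      have "2 * (sqrt y - 1) \<le> (3 * ln (real p)) * (sqrt y - 1)"
        using lp l2 y by (intro mult_right_mono) auto
      thus ?thesis by (simp add: algebra_simps)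
    qed
    also have "\<dots> \<le> ln (real p) * (3 * sqrt y)" using lp l2 by (intro mult_left_mono) auto
    finally have "ln (real n) ^ 2 \<le> (ln (real p) * (3 * sqrt y)) ^ 2" using lnn by (intro power_mono) auto
    also have "\<dots> = 9 * ln (real p) ^ 2 * real n / real p" using y by (simp add: power_mult_distrib y_def)
    finally have key: "ln (real n) ^ 2 * real p \<le> 9 * ln (real p) ^ 2 * real n" using p2 by (simp add: field_simps)
    define t where "t = a * L * xp p"
    have t: "t > 0" using a L xpp by (simp add: t_def)
    have "t ^ 3 / 6 \<le> exp t"
    proof -
      have "(\<Sum>k\<in>{3}. t ^ k /\<^sub>R fact k) \<le> exp t"
        unfolding exp_def using t by (intro sum_le_suminf summable_exp_generic) auto
      thus ?thesis by (simp add: fact_numeral scaleR_conv_of_real field_simps)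
    qed
    hence "exp (- t) \<le> 6 / t ^ 3" using t by (simp add: exp_minus field_simps)
    hence "?f p \<le> xp p ^ 2 * (6 / t ^ 3)" unfolding t_def by (intro mult_left_mono) (auto simp: algebra_simps)
    also have "\<dots> = 6 / (a ^ 3 * L ^ 3 * xp p)"
      using xpp a L by (simp add: t_def field_simps power_mult_distrib power3_eq_cube power2_eq_square)
    also have "\<dots> = 6 / (a ^ 3 * L ^ 3) * (real p / ln (real p))" by (simp add: xp_def)
    also have "real p / ln (real p) \<le> ln (real p) * (9 * real n / ln (real n) ^ 2)"
      using key lp l2 lnn by (simp add: field_simps power2_eq_square)
    hence "6 / (a ^ 3 * L ^ 3) * (real p / ln (real p)) \<le> 6 / (a ^ 3 * L ^ 3) * \<dots>"
      using a L by (intro mult_left_mono) auto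
    also have "\<dots> = ln (real p) * (54 * real n / (ln (real n) ^ 2 * a ^ 3 * L ^ 3))" by (simp add: mult_ac)
    finally show "?f p \<le> ln (real p) * (54 * real n / (ln (real n) ^ 2 * a ^ 3 * L ^ 3))" .
  qed
  also have "\<dots> = primes_theta n * (54 * real n / (ln (real n) ^ 2 * a ^ 3 * L ^ 3))"
    unfolding primes_theta_def by (rule sum_distrib_right[symmetric])
  also have "\<dots> \<le> (4 * real n) * (54 * real n / (ln (real n) ^ 2 * a ^ 3 * L ^ 3))"
    using a L by (intro mult_right_mono primes_theta_le) auto
  also have "\<dots> = 216 * (real n / ln (real n)) ^ 2 / (a ^ 3 * L ^ 3)"
    by (simp add: power2_eq_square)
  also have "\<dots> \<le> 216 * (3 * L) ^ 2 / (a ^ 3 * L ^ 3)"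
    using n a L lnn by (intro divide_right_mono mult_left_mono power_mono) auto
  also have "\<dots> = 1944 / a ^ 3 / L" using L by (simp add: power2_eq_square power3_eq_cube)
  finally show "(\<Sum>p\<in>A. ?f p) \<le> (1944 / a ^ 3 + 32) / L" by (simp add: add_divide_distrib)
qed

text \<open>On the block \<open>n < p <= K * n\<close>, where \<open>n / ln n\<close> lies between
  \<open>L / \<epsilon>\<close> and three times that, \<open>xp p\<close> is between fixed multiples
  of \<open>1 / L\<close>. By Mertens these \<open>xp p\<close> sum to at least 1 once
  \<open>K\<close> is a large constant.\<close>

lemma ex_primes_xp_square_sum_ge:
  fixes \<epsilon> :: real
  assumes e: "\<epsilon> > 0"
  shows "\<exists>c>0. \<exists>L0>0. \<forall>L\<ge>L0. \<exists>B. finite B \<and> (\<forall>p\<in>B. prime p \<and> L * xp p \<le> \<epsilon>) \<and>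
           (\<Sum>p\<in>B. xp p ^ 2) \<ge> c / L"
proof -
  obtain C where C: "\<And>n. n \<ge> 1 \<Longrightarrow> (\<Sum>p\<in>primes_upto n. xp p) \<ge> ln (real n) - C"
    using mertens_lower by blast
  \<comment> \<open>\<open>ln K\<close> must exceed the errors \<open>C\<close> and 4 of the lower
    and upper Mertens bounds by at least 1.\<close>
  define K where "K = nat \<lceil>exp (C + 5)\<rceil> + 1"
  have K: "K \<ge> 1" "real K \<ge> exp (C + 5)" unfolding K_def by linarith+
  have lnK: "ln (real K) \<ge> C + 5" using K by (subst ln_ge_iff) auto
  have pos: "\<epsilon> / (3 * real K) > 0" "100 * \<epsilon> > 0" using e K by auto
  have main: "\<exists>B. finite B \<and> (\<forall>p\<in>B. prime p \<and> L * xp p \<le> \<epsilon>) \<and> (\<Sum>p\<in>B. xp p ^ 2) \<ge> \<epsilon> / (3 * real K) / L"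
    if L: "L \<ge> 100 * \<epsilon>" for L
  proof -
    have Lpos: "L > 0" using e L by linarith
    have "L / \<epsilon> \<ge> 100" using e L by (simp add: field_simps)
    then obtain n where n: "n \<ge> 8" "L / \<epsilon> \<le> real n / ln (real n)" "real n / ln (real n) \<le> 3 * (L / \<epsilon>)"
      using ex_nat_over_ln_between by blast
    have lnn: "ln (real n) > 0" using n by simp
    define B where "B = {p. prime p \<and> p \<in> {n<..K*n}}"
    have fin: "finite B" unfolding B_def by (rule finite_subset[of _ "{n<..K*n}"]) auto
    have x1: "xp p \<le> \<epsilon> / L" if "p \<in> B" for p
    proof -
      have "xp p \<le> xp n" using that n by (intro ln_over_self_antimono) (auto simp: B_def)
      also have "\<dots> \<le> \<epsilon> / L" using n(2) e Lpos lnn n(1) by (simp add: xp_def field_simps)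
      finally show ?thesis .
    qed
    have x2: "xp p \<ge> \<epsilon> / (3 * real K * L)" if "p \<in> B" for p
    proof -
      have p: "n < p" "p \<le> K * n" using that by (auto simp: B_def)
      have "\<epsilon> / (3 * real K * L) \<le> ln (real n) / (real K * real n)"
        using n e Lpos lnn K by (simp add: field_simps)
      also have "\<dots> \<le> ln (real p) / real p"
      proof (rule frac_le)
        show "real p \<le> real K * real n" using p(2) by (metis of_nat_le_iff of_nat_mult)
      qed (use p n in auto)
      finally show ?thesis by (simp add: xp_def)
    qed
    have "(\<Sum>p\<in>B. xp p) = (\<Sum>p\<in>primes_upto (K * n). xp p) - (\<Sum>p\<in>primes_upto n. xp p)"
    proof -
      have "B = primes_upto (K * n) - primes_upto n" by (auto simp: B_def primes_upto_def)
      moreover have "primes_upto n \<subseteq> primes_upto (K * n)" using K by (intro primes_upto_mono) auto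
      ultimately show ?thesis by (simp add: sum_diff)
    qed
    moreover have "(\<Sum>p\<in>primes_upto (K * n). xp p) \<ge> ln (real (K * n)) - C"
      using K n by (intro C) (simp add: Suc_le_eq)
    moreover have "ln (real (K * n)) = ln (real K) + ln (real n)"
      using K n by (simp add: ln_mult)
    ultimately have 1: "(\<Sum>p\<in>B. xp p) \<ge> 1" using lnK mertens_upper[of n] by linarith
    have "\<epsilon> / (3 * real K) / L = \<epsilon> / (3 * real K * L) * 1" by simp
    also have "\<dots> \<le> \<epsilon> / (3 * real K * L) * (\<Sum>p\<in>B. xp p)" using 1 e Lpos by (intro mult_left_mono) auto
    also have "\<dots> = (\<Sum>p\<in>B. \<epsilon> / (3 * real K * L) * xp p)" by (simp add: sum_distrib_left)
    also have "\<dots> \<le> (\<Sum>p\<in>B. xp p ^ 2)"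
      unfolding power2_eq_square using x2 xp_nonneg by (intro sum_mono mult_right_mono) auto
    finally have 2: "\<epsilon> / (3 * real K) / L \<le> (\<Sum>p\<in>B. xp p ^ 2)" .
    show "\<exists>B. finite B \<and> (\<forall>p\<in>B. prime p \<and> L * xp p \<le> \<epsilon>) \<and> \<epsilon> / (3 * real K) / L \<le> (\<Sum>p\<in>B. xp p ^ 2)"
      using fin x1 2 Lpos by (intro exI[of _ B]) (auto simp: field_simps B_def)
  qed
  show ?thesis
    by (rule exI[of _ "\<epsilon> / (3 * real K)"], rule conjI, fact,
        rule exI[of _ "100 * \<epsilon>"], rule conjI, fact) (use main in blast)
qed

section \<open>Three-point laws\<close>

text \<open>Taylor's formula with remainder \<open>t^4 / 24\<close> leaves the coefficient
  \<open>1/2 - 1/24\<close>, which is above \<open>1/3\<close>.\<close>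

lemma one_minus_cos_ge:
  fixes t :: real
  assumes "\<bar>t\<bar> \<le> 1"
  shows "1 - cos t \<ge> t\<^sup>2 / 3"
proof -
  define Z where "Z = iexp t - (\<Sum>k\<le>3. (\<i> * t)^k / fact k)"
  have "cmod Z \<le> \<bar>t\<bar> ^ Suc 3 / fact (Suc 3)"
    unfolding Z_def by (rule iexp_approx1)
  moreover have "Re Z = cos t - 1 + t\<^sup>2 / 2"
    unfolding Z_def by (simp add: eval_nat_numeral Re_divide_of_real cis_conv_exp[symmetric] flip: of_real_power)
  ultimately have "\<bar>cos t - 1 + t\<^sup>2 / 2\<bar> \<le> \<bar>t\<bar> ^ Suc 3 / fact (Suc 3)"
    using abs_Re_le_cmod[of Z] by simp
  also have "\<dots> = t\<^sup>2 * t\<^sup>2 / 24" by (simp add: eval_nat_numeral abs_mult_self_eq)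
  also have "\<dots> \<le> t\<^sup>2 * 1 / 24"
    using assms by (intro divide_right_mono mult_left_mono) (auto simp: abs_square_le_1)
  finally show ?thesis by linarith
qed

text \<open>If \<open>|y| * D <= 1\<close>, both terms are compared with
  \<open>1 - V * y^2 / 2\<close>: the third absolute moment is at most \<open>D * V\<close>, and the
  Gaussian error \<open>(V * y^2 / 2)^2\<close> has the right size because \<open>V <= D^2\<close>.
  Otherwise both are compared with 1, at a cost of \<open>V * y^2 <= D * V * |y|^3\<close>.\<close>

lemma finite_charfn_approx:
  fixes w z :: "'i \<Rightarrow> real" and y :: real
  assumes "finite I" and w: "\<And>i. i \<in> I \<Longrightarrow> w i \<ge> 0" "sum w I = 1"
    and mean: "(\<Sum>i\<in>I. w i * z i) = 0" and D: "\<And>i. i \<in> I \<Longrightarrow> \<bar>z i\<bar> \<le> D" "D \<ge> 0"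
    and V: "V = (\<Sum>i\<in>I. w i * (z i)\<^sup>2)"
  shows "cmod ((\<Sum>i\<in>I. of_real (w i) * iexp (y * z i)) - of_real (exp (- V * y\<^sup>2 / 2))) \<le> D * V * \<bar>y\<bar> ^ 3"
proof -
  define \<phi> where "\<phi> = (\<Sum>i\<in>I. of_real (w i) * iexp (y * z i))"
  have V0: "V \<ge> 0" unfolding V using w by (intro sum_nonneg) auto
  have VD: "V \<le> D\<^sup>2"
  proof -
    have "V \<le> (\<Sum>i\<in>I. w i * D\<^sup>2)" unfolding V
    proof (intro sum_mono mult_left_mono)
      fix i assume "i \<in> I"
      thus "(z i)\<^sup>2 \<le> D\<^sup>2" using D by (metis abs_le_square_iff abs_of_nonneg)
    qed (use w in auto)
    thus ?thesis using w by (simp flip: sum_distrib_right)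
  qed
  have D3: "w i * \<bar>y * z i\<bar> ^ 3 \<le> \<bar>y\<bar> ^ 3 * D * (w i * (z i)\<^sup>2)" if "i \<in> I" for i
  proof -
    have "\<bar>z i\<bar> ^ 3 = (z i)\<^sup>2 * \<bar>z i\<bar>" by (simp add: power3_eq_cube power2_eq_square)
    hence "w i * \<bar>y * z i\<bar> ^ 3 = \<bar>y\<bar> ^ 3 * (w i * (z i)\<^sup>2) * \<bar>z i\<bar>"
      by (simp add: abs_mult power_mult_distrib)
    also have "\<dots> \<le> \<bar>y\<bar> ^ 3 * (w i * (z i)\<^sup>2) * D" using D that w by (intro mult_left_mono) auto
    finally show ?thesis by (simp add: mult_ac)
  qed
  have c1: "(\<Sum>i\<in>I. complex_of_real (w i)) = 1" using w(2) by (metis of_real_1 of_real_sum)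
  have c2: "(\<Sum>i\<in>I. complex_of_real (w i) * (\<i> * of_real (y * z i))) = 0"
  proof -
    have "(\<Sum>i\<in>I. complex_of_real (w i) * (\<i> * of_real (y * z i))) = \<i> * of_real y * of_real (\<Sum>i\<in>I. w i * z i)"
      by (simp add: sum_distrib_left mult_ac)
    thus ?thesis by (simp add: mean)
  qed
  have c3: "(\<Sum>i\<in>I. complex_of_real (w i) * (of_real (y * z i))\<^sup>2) = of_real (y\<^sup>2 * V)"
    by (simp add: V sum_distrib_left mult_ac power_mult_distrib)
  have y3: "\<bar>y\<bar> ^ 3 = y * y * \<bar>y\<bar>" by (simp add: power3_eq_cube)
  have exp_bound: "\<bar>exp (- V * y\<^sup>2 / 2) - 1\<bar> \<le> V * y\<^sup>2 / 2"
  proof -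
    have "V * y\<^sup>2 \<ge> 0" using V0 by simp
    hence "exp (- V * y\<^sup>2 / 2) \<le> 1" by simp
    thus ?thesis using exp_ge_add_one_self[of "- V * y\<^sup>2 / 2"] by linarith
  qed
  have "cmod (\<phi> - of_real (exp (- V * y\<^sup>2 / 2))) \<le> D * V * \<bar>y\<bar> ^ 3"
  proof (cases "\<bar>y\<bar> * D \<le> 1")
    case False
    have "\<phi> - 1 = (\<Sum>i\<in>I. of_real (w i) * (iexp (y * z i) - (\<Sum>k\<le>1. (\<i> * (y * z i)) ^ k / fact k)))"
      using c1 c2 by (simp add: \<phi>_def algebra_simps sum.distrib sum_subtractf)
    also have "cmod \<dots> \<le> (\<Sum>i\<in>I. w i * (\<bar>y * z i\<bar> ^ Suc 1 / fact (Suc 1)))"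
    proof (intro sum_norm_le)
      fix i assume i: "i \<in> I"
      show "cmod (of_real (w i) * (iexp (y * z i) - (\<Sum>k\<le>1. (\<i> * (y * z i)) ^ k / fact k)))
        \<le> w i * (\<bar>y * z i\<bar> ^ Suc 1 / fact (Suc 1))"
        unfolding norm_mult norm_of_real abs_of_nonneg[OF w(1)[OF i]]
        by (rule mult_left_mono[OF iexp_approx1[of "y * z i" 1] w(1)[OF i]])
    qed
    also have "\<dots> = V * y\<^sup>2 / 2"
      by (simp add: V sum_distrib_left sum_distrib_right sum_divide_distrib power2_eq_square algebra_simps)
    finally have "cmod (\<phi> - 1) \<le> V * y\<^sup>2 / 2" .
    moreover have "cmod (1 - of_real (exp (- V * y\<^sup>2 / 2))) \<le> V * y\<^sup>2 / 2"
      using exp_bound by (metis norm_of_real of_real_1 of_real_diff abs_minus_commute)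
    moreover have "cmod (\<phi> - of_real (exp (- V * y\<^sup>2 / 2))) \<le> cmod (\<phi> - 1) + cmod (1 - of_real (exp (- V * y\<^sup>2 / 2)))"
      using norm_triangle_ineq[of "\<phi> - 1" "1 - of_real (exp (- V * y\<^sup>2 / 2))"] by simp
    ultimately have "cmod (\<phi> - of_real (exp (- V * y\<^sup>2 / 2))) \<le> V * y\<^sup>2 * 1" by simp
    also have "\<dots> \<le> V * y\<^sup>2 * (\<bar>y\<bar> * D)" using False V0 by (intro mult_left_mono) auto
    also have "\<dots> = D * V * \<bar>y\<bar> ^ 3" by (simp add: y3 power2_eq_square)
    finally show ?thesis .
  next
    case True
    have "\<phi> - (1 - of_real (y\<^sup>2 * V) / 2)
       = (\<Sum>i\<in>I. of_real (w i) * (iexp (y * z i) - (\<Sum>k\<le>2. (\<i> * (y * z i)) ^ k / fact k)))"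
    proof -
      have "(\<Sum>i\<in>I. of_real (w i) * (iexp (y * z i) - (\<Sum>k\<le>2. (\<i> * (y * z i)) ^ k / fact k)))
        = (\<Sum>i\<in>I. of_real (w i) * iexp (y * z i) - of_real (w i) - of_real (w i) * (\<i> * of_real (y * z i))
             + of_real (w i) * (of_real (y * z i))\<^sup>2 / 2)"
        by (intro sum.cong refl) (simp add: eval_nat_numeral algebra_simps)
      also have "\<dots> = \<phi> - 1 - 0 + of_real (y\<^sup>2 * V) / 2"
        unfolding sum.distrib sum_subtractf c1 c2 sum_divide_distrib[symmetric] c3 \<phi>_def ..
      finally show ?thesis by simp
    qed
    also have "cmod \<dots> \<le> (\<Sum>i\<in>I. w i * (\<bar>y * z i\<bar> ^ Suc 2 / fact (Suc 2)))"
    proof (intro sum_norm_le)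
      fix i assume i: "i \<in> I"
      show "cmod (of_real (w i) * (iexp (y * z i) - (\<Sum>k\<le>2. (\<i> * (y * z i)) ^ k / fact k)))
        \<le> w i * (\<bar>y * z i\<bar> ^ Suc 2 / fact (Suc 2))"
        unfolding norm_mult norm_of_real abs_of_nonneg[OF w(1)[OF i]]
        by (rule mult_left_mono[OF iexp_approx1[of "y * z i" 2] w(1)[OF i]])
    qed
    also have "\<dots> \<le> (\<Sum>i\<in>I. \<bar>y\<bar> ^ 3 * D * (w i * (z i)\<^sup>2) / 6)"
      using D3 by (intro sum_mono) (simp add: eval_nat_numeral)
    also have "\<dots> = \<bar>y\<bar> ^ 3 * D * V / 6" by (simp add: V sum_distrib_left sum_divide_distrib)
    finally have 1: "cmod (\<phi> - (1 - of_real (y\<^sup>2 * V) / 2)) \<le> \<bar>y\<bar> ^ 3 * D * V / 6" .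
    define t where "t = V * y\<^sup>2 / 2"
    have t: "t \<ge> 0" using V0 by (simp add: t_def)
    have "\<bar>exp (- t) - (1 - t)\<bar> \<le> t\<^sup>2"
    proof -
      have "exp (-t) \<ge> 1 - t" using exp_ge_add_one_self[of "-t"] by simp
      moreover have "exp (-t) \<le> 1 - t + t\<^sup>2"
      proof (cases "t \<le> 1")
        case True
        have "exp (-t) = 1 / exp t" by (simp add: exp_minus field_simps)
        also have "\<dots> \<le> 1 / (1 + t)" using t exp_ge_add_one_self[of t] by (intro divide_left_mono) auto
        also have "\<dots> \<le> 1 - t + t\<^sup>2"
        proof -
          have "1 \<le> (1 - t + t\<^sup>2) * (1 + t)" using t by (simp add: algebra_simps power2_eq_square)
          thus ?thesis using t by (simp add: field_simps)
        qed
        finally show ?thesis .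
      next
        case False
        have "t * 1 \<le> t * t" using False by (intro mult_left_mono) auto
        moreover have "exp (-t) \<le> 1" using t by simp
        ultimately show ?thesis using False unfolding power2_eq_square by linarith
      qed
      ultimately show ?thesis by simp
    qed
    also have "t\<^sup>2 = V * \<bar>y\<bar> ^ 3 * (V * \<bar>y\<bar>) / 4"
      by (simp add: t_def power2_eq_square y3)
    also have "\<dots> \<le> V * \<bar>y\<bar> ^ 3 * (D * 1) / 4"
    proof -
      have "V * \<bar>y\<bar> \<le> D\<^sup>2 * \<bar>y\<bar>" using VD by (intro mult_right_mono) auto
      also have "\<dots> = D * (\<bar>y\<bar> * D)" by (simp add: power2_eq_square)
      also have "\<dots> \<le> D * 1" using True D(2) by (intro mult_left_mono) auto
      finally show ?thesis using V0 by (intro divide_right_mono mult_left_mono) auto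
    qed
    finally have "\<bar>exp (- t) - (1 - t)\<bar> \<le> V * \<bar>y\<bar> ^ 3 * D / 4" by simp
    moreover have "cmod ((1 - of_real (y\<^sup>2 * V) / 2) - of_real (exp (- V * y\<^sup>2 / 2))) = \<bar>exp (- t) - (1 - t)\<bar>"
    proof -
      have "(1 - of_real (y\<^sup>2 * V) / 2) - of_real (exp (- V * y\<^sup>2 / 2)) = complex_of_real (- (exp (- t) - (1 - t)))"
        by (simp add: t_def mult_ac)
      thus ?thesis by (metis norm_of_real abs_minus_cancel)
    qed
    ultimately have 2: "cmod ((1 - of_real (y\<^sup>2 * V) / 2) - of_real (exp (- V * y\<^sup>2 / 2))) \<le> V * \<bar>y\<bar> ^ 3 * D / 4"
      by simp
    have "cmod (\<phi> - of_real (exp (- V * y\<^sup>2 / 2))) \<le> \<bar>y\<bar> ^ 3 * D * V / 6 + V * \<bar>y\<bar> ^ 3 * D / 4"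
      by (rule norm_diff_triangle_le[OF 1 2])
    also have "\<dots> = (D * V * \<bar>y\<bar> ^ 3) * (5/12)" by simp
    also have "\<dots> \<le> D * V * \<bar>y\<bar> ^ 3" using V0 D by (intro mult_left_le) auto
    finally show ?thesis .
  qed
  thus ?thesis by (simp add: \<phi>_def)
qed

text \<open>The moment generating function of the law with mass \<open>q\<close> at \<open>u\<close>, mass \<open>q\<close> at \<open>- v\<close> and the rest at \<open>0\<close>.\<close>

definition tp :: "real \<Rightarrow> real \<Rightarrow> real \<Rightarrow> 'a::{banach,real_normed_field} \<Rightarrow> 'a" where
  "tp q u v s = of_real q * exp (s * of_real u) + of_real q * exp (- s * of_real v) + of_real (1 - 2 * q)"

lemma tp_of_real: "tp q u v (complex_of_real r) = of_real (tp q u v r)"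
  by (simp add: tp_def exp_of_real[symmetric])

text \<open>The range of \<open>q\<close> is that of \<open>p / (2 * (p + 1))\<close>, which is 1/3
  at \<open>p = 2\<close> and increases to 1/2.\<close>

locale three_point =
  fixes q u v :: real
  assumes q: "1 / 3 \<le> q" "q \<le> 1 / 2" and u: "u \<ge> 0" and v: "v \<ge> 0"
begin

text \<open>These are the masses, mean, variance and centred characteristic function of the
  three-point law reweighted by \<open>exp (r * x)\<close>. Mean and variance turn out to be the
  first two derivatives of \<open>ln (tp q u v r)\<close>, which is their link to the saddle
  point.\<close>

definition wu where "wu r = q * exp (r * u) / tp q u v r"
definition wv where "wv r = q * exp (- r * v) / tp q u v r"
definition w0 where "w0 r = (1 - 2 * q) / tp q u v r"
definition mean where "mean r = wu r * u - wv r * v"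
definition var where "var r = wu r * (u - mean r)\<^sup>2 + wv r * (v + mean r)\<^sup>2 + w0 r * (mean r)\<^sup>2"
definition ch where "ch r y = tp q u v (Complex r y) / of_real (tp q u v r) * iexp (- y * mean r)"

lemma tp_pos: "tp q u v (r :: real) > 0"
  using q by (auto simp: tp_def intro!: add_pos_nonneg)

lemma weights_nonneg: "wu r \<ge> 0" "wv r \<ge> 0" "w0 r \<ge> 0"
  using tp_pos[of r] q by (auto simp: wu_def wv_def w0_def)

lemma weights_pos: "wu r > 0" "wv r > 0"
  using tp_pos[of r] q by (auto simp: wu_def wv_def)

lemma weights_sum: "wu r + wv r + w0 r = 1"
proof -
  have "q * exp (r * u) + q * exp (- r * v) + (1 - 2 * q) = tp q u v r" by (simp add: tp_def)
  hence "wu r + wv r + w0 r = tp q u v r / tp q u v r"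
    by (simp only: wu_def wv_def w0_def add_divide_distrib[symmetric])
  thus ?thesis using tp_pos[of r] by simp
qed

lemma mean_bounds: "mean r \<le> u" "mean r \<ge> - v"
proof -
  have "wu r \<le> 1" "wv r \<le> 1" using weights_sum[of r] weights_nonneg[of r] by linarith+
  hence "wu r * u \<le> u" "wv r * v \<le> v" using u v by (auto intro: mult_left_le_one_le weights_nonneg)
  moreover have "wu r * u \<ge> 0" "wv r * v \<ge> 0" using u v weights_nonneg by auto
  ultimately show "mean r \<le> u" "mean r \<ge> - v" unfolding mean_def by linarith+
qed

lemma var_nonneg: "var r \<ge> 0"
  using weights_nonneg by (auto simp: var_def)

lemma var_alt: "var r = wu r * u\<^sup>2 + wv r * v\<^sup>2 - (mean r)\<^sup>2"
proof -
  have "var r = wu r * u\<^sup>2 + wv r * v\<^sup>2 - 2 * mean r * (wu r * u - wv r * v) + (wu r + wv r + w0 r) * (mean r)\<^sup>2"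
    by (simp add: var_def power2_eq_square algebra_simps)
  also have "\<dots> = wu r * u\<^sup>2 + wv r * v\<^sup>2 - (mean r)\<^sup>2"
    unfolding weights_sum mean_def[symmetric] by (simp add: power2_eq_square)
  finally show ?thesis .
qed

text \<open>The variance is bounded by the second moment about \<open>u\<close>, to which the atom
  at \<open>u\<close> contributes nothing. For large \<open>r * u\<close> that atom has nearly all
  the mass.\<close>

lemma var_le_shift: "var r \<le> (u + v)\<^sup>2 * (wv r + w0 r)"
proof -
  have "var r = wv r * (u + v)\<^sup>2 + w0 r * u\<^sup>2 - (u - mean r)\<^sup>2"
  proof -
    have w: "w0 r = 1 - wu r - wv r" using weights_sum[of r] by linarith
    show ?thesis unfolding var_alt w mean_def by (simp add: power2_eq_square algebra_simps)
  qed
  also have "\<dots> \<le> wv r * (u + v)\<^sup>2 + w0 r * u\<^sup>2" by simp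
  also have "\<dots> \<le> wv r * (u + v)\<^sup>2 + w0 r * (u + v)\<^sup>2"
    using u v weights_nonneg by (intro add_left_mono mult_left_mono power_mono) auto
  finally show ?thesis by (simp add: algebra_simps)
qed

lemma var_le: "var r \<le> (u + v)\<^sup>2"
proof -
  have "(u + v)\<^sup>2 * (wv r + w0 r) \<le> (u + v)\<^sup>2 * 1"
    using weights_sum[of r] weights_nonneg[of r] by (intro mult_left_mono) auto
  thus ?thesis using var_le_shift[of r] by simp
qed

text \<open>After tilting, the atoms other than \<open>u\<close> keep a mass of at most
  \<open>2 * exp (- r * u)\<close>. Primes with \<open>r * ln p / p\<close> large therefore hardly
  count in the total variance.\<close>

lemma var_le_exp:
  assumes r: "r \<ge> 0"
  shows "var r \<le> 2 * (u + v)\<^sup>2 * exp (- r * u)"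
proof -
  have F: "tp q u v r \<ge> q * exp (r * u)" using q by (simp add: tp_def)
  have "wv r + w0 r = (q * exp (- r * v) + (1 - 2 * q)) / tp q u v r"
    by (simp add: wv_def w0_def add_divide_distrib)
  also have "\<dots> \<le> (2 * q) / (q * exp (r * u))"
  proof (rule frac_le)
    have "q * exp (- r * v) \<le> q * 1" using r v q by (intro mult_left_mono) auto
    thus "q * exp (- r * v) + (1 - 2 * q) \<le> 2 * q" using q by linarith
  qed (use q F in auto)
  also have "\<dots> = 2 * exp (- r * u)" using q by (simp add: exp_minus field_simps)
  finally have "(u + v)\<^sup>2 * (wv r + w0 r) \<le> (u + v)\<^sup>2 * (2 * exp (- r * u))" by (intro mult_left_mono) auto
  thus ?thesis using var_le_shift[of r] by simp
qed

text \<open>Lagrange's identity: \<open>(wu r * a - wv r * b)^2\<close> is the defect in a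
  Cauchy-Schwarz inequality, where \<open>a\<close> and \<open>b\<close> are the distances of
  \<open>u\<close> and \<open>- v\<close> from the mean.\<close>

lemma var_ge_weights: "var r \<ge> wu r * wv r * (u + v)\<^sup>2"
proof -
  define a b where "a = u - mean r" and "b = v + mean r"
  have "wu r * wv r * (a + b)\<^sup>2 + (wu r * a - wv r * b)\<^sup>2 = (wu r + wv r) * (wu r * a\<^sup>2 + wv r * b\<^sup>2)"
    by (simp add: power2_eq_square algebra_simps)
  moreover have "(wu r * a - wv r * b)\<^sup>2 \<ge> 0" by simp
  ultimately have "wu r * wv r * (a + b)\<^sup>2 \<le> (wu r + wv r) * (wu r * a\<^sup>2 + wv r * b\<^sup>2)"
    by linarith
  also have "\<dots> \<le> 1 * (wu r * a\<^sup>2 + wv r * b\<^sup>2)"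
    using weights_nonneg[of r] weights_sum[of r] by (intro mult_right_mono) auto
  also have "\<dots> \<le> var r" using weights_nonneg[of r] by (simp add: var_def a_def b_def)
  finally show ?thesis by (simp add: a_def b_def)
qed

text \<open>While \<open>r * (u + v) <= 1\<close>, tilting changes the masses by bounded factors
  only. The constant is \<open>(1/3)^2 * exp (-1)\<close> over \<open>(exp 1)^2\<close>: original
  masses at least 1/3, \<open>r * u - r * v >= -1\<close>, and normalisation at most
  \<open>exp 1\<close>.\<close>

lemma weights_ge:
  assumes "r \<ge> 0" "r * (u + v) \<le> 1"
  shows "wu r * wv r \<ge> exp (-3) / 9"
proof -
  have ru: "r * u \<ge> 0" "r * v \<ge> 0" using assms u v by auto
  have le: "r * u + r * v \<le> 1" using assms by (simp add: algebra_simps)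
  have "tp q u v r \<le> q * exp 1 + q * 1 + (1 - 2 * q)"
  proof -
    have "exp (r * u) \<le> exp 1" "exp (- r * v) \<le> 1" using ru le by auto
    hence "q * exp (r * u) \<le> q * exp 1" "q * exp (- r * v) \<le> q * 1" using q by (auto intro!: mult_left_mono)
    thus ?thesis by (simp add: tp_def)
  qed
  also have "\<dots> \<le> exp 1"
  proof -
    have "(1 - q) * 1 \<le> (1 - q) * exp (1::real)" using q by (intro mult_left_mono) auto
    thus ?thesis by (simp add: algebra_simps)
  qed
  finally have F: "tp q u v r \<le> exp 1" .
  have "exp (-3) / 9 = (1/3) * (1/3) * exp (-1) / (exp 1 * exp (1::real))"
    by (simp add: exp_minus field_simps flip: exp_add)
  also have "\<dots> \<le> q * q * exp (r * u - r * v) / (tp q u v r * tp q u v r)"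
  proof (rule frac_le)
    show "(1/3) * (1/3) * exp (-1) \<le> q * q * exp (r * u - r * v)"
      using q ru le by (intro mult_mono) auto
    show "tp q u v r * tp q u v r \<le> exp 1 * exp 1" using F tp_pos[of r] by (intro mult_mono) auto
  qed (use tp_pos[of r] q in auto)
  also have "\<dots> = wu r * wv r" by (simp add: wu_def wv_def exp_diff exp_minus field_simps)
  finally show ?thesis .
qed

lemma var_ge:
  assumes "r \<ge> 0" "r * (u + v) \<le> 1"
  shows "var r \<ge> exp (-3) / 9 * (u + v)\<^sup>2"
proof -
  have "exp (-3) / 9 * (u + v)\<^sup>2 \<le> wu r * wv r * (u + v)\<^sup>2"
    using weights_ge[OF assms] by (intro mult_right_mono) auto
  thus ?thesis using var_ge_weights[of r] by linarith
qed

lemma ch_eq: "ch r y = of_real (wu r) * iexp (y * (u - mean r)) + of_real (wv r) * iexp (y * (- v - mean r))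
    + of_real (w0 r) * iexp (y * (- mean r))"
proof -
  have F: "complex_of_real (tp q u v r) \<noteq> 0" using tp_pos[of r] by simp
  have C: "Complex r y = of_real r + \<i> * of_real y" by (simp add: complex_eq_iff)
  have "tp q u v (Complex r y) * iexp (- y * mean r) = of_real (q * exp (r * u)) * iexp (y * (u - mean r))
    + of_real (q * exp (- r * v)) * iexp (y * (- v - mean r)) + of_real (1 - 2 * q) * iexp (y * (- mean r))"
    unfolding tp_def C
    by (simp add: algebra_simps exp_of_real[symmetric] flip: exp_add)
  thus ?thesis using F
    unfolding ch_def wu_def wv_def w0_def
    by (simp only: of_real_divide times_divide_eq_left add_divide_distrib[symmetric])
qed

lemma ch_le_1: "cmod (ch r y) \<le> 1"
proof -
  have "cmod (ch r y) \<le> cmod (of_real (wu r) * iexp (y * (u - mean r))) + cmod (of_real (wv r) * iexp (y * (- v - mean r)))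
    + cmod (of_real (w0 r) * iexp (y * (- mean r)))"
    unfolding ch_eq by (intro norm_triangle_le add_mono order_refl norm_triangle_ineq)
  also have "\<dots> = wu r + wv r + w0 r"
    using weights_nonneg[of r] by (simp only: norm_mult norm_exp_i_times norm_of_real abs_of_nonneg mult_1_right)
  finally show ?thesis by (simp only: weights_sum)
qed

lemma ch_approx: "cmod (ch r y - of_real (exp (- var r * y\<^sup>2 / 2))) \<le> (u + v) * var r * \<bar>y\<bar> ^ 3"
proof -
  let ?I = "{0, 1, 2 :: nat}"
  define w where "w = (\<lambda>i::nat. if i = 0 then wu r else if i = 1 then wv r else w0 r)"
  define z where "z = (\<lambda>i::nat. if i = 0 then u - mean r else if i = 1 then - v - mean r else - mean r)"
  have "cmod ((\<Sum>i\<in>?I. of_real (w i) * iexp (y * z i)) - of_real (exp (- var r * y\<^sup>2 / 2))) \<le> (u + v) * var r * \<bar>y\<bar> ^ 3"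
  proof (rule finite_charfn_approx)
    show "sum w ?I = 1" using weights_sum[of r] by (simp add: w_def)
    have "(\<Sum>i\<in>?I. w i * z i) = wu r * u - wv r * v - (wu r + wv r + w0 r) * mean r"
      by (simp add: w_def z_def algebra_simps)
    thus "(\<Sum>i\<in>?I. w i * z i) = 0" unfolding weights_sum mean_def by simp
    show "var r = (\<Sum>i\<in>?I. w i * (z i)\<^sup>2)"
      by (simp add: w_def z_def var_def power2_eq_square algebra_simps)
  qed (use weights_nonneg[of r] mean_bounds[of r] u v in \<open>auto simp: w_def z_def\<close>)
  thus ?thesis unfolding ch_eq by (simp add: w_def z_def algebra_simps)
qed

text \<open>The atoms at \<open>u\<close> and \<open>- v\<close> partly cancel: the squared modulus
  of their sum is \<open>s^2 - 2 * k\<close>, at most \<open>(s - k)^2\<close> because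
  \<open>s <= 1\<close>. The atom at 0 is added by the triangle inequality, so the total is at most
  \<open>1 - k <= exp (- k)\<close>. The constant 27 is 9 from \<open>weights_ge\<close> times 3
  from \<open>one_minus_cos_ge\<close>.\<close>

lemma ch_le_exp:
  assumes r: "r \<ge> 0" "r * (u + v) \<le> 1" and y: "\<bar>y\<bar> * (u + v) \<le> 1"
  shows "cmod (ch r y) \<le> exp (- (exp (-3) / 27) * (u + v)\<^sup>2 * y\<^sup>2)"
proof -
  define s where "s = wu r + wv r"
  define k where "k = wu r * wv r * (1 - cos (y * (u + v)))"
  have w: "wu r \<ge> 0" "wv r \<ge> 0" "w0 r \<ge> 0" "w0 r = 1 - s"
    using weights_nonneg[of r] weights_sum[of r] by (auto simp: s_def)
  have s: "s \<ge> 0" "s \<le> 1" using w by (auto simp: s_def)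
  have k0: "k \<ge> 0" unfolding k_def using w by (intro mult_nonneg_nonneg) auto
  have ks: "k \<le> s"
  proof -
    have "k \<le> wu r * wv r * 2" unfolding k_def using w
      by (intro mult_left_mono mult_nonneg_nonneg) (auto simp: cos_ge_minus_one intro: order_trans[OF diff_left_mono[OF cos_ge_minus_one]])
    also have "\<dots> \<le> s * s"
      using sum_squares_ge_zero[of "wu r" "wv r"] by (simp add: s_def algebra_simps)
    also have "\<dots> \<le> s * 1" using s by (intro mult_left_mono) auto
    finally show ?thesis by simp
  qed
  define a b where "a = y * (u - mean r)" and "b = y * (- v - mean r)"
  define g where "g = of_real (wu r) * iexp a + of_real (wv r) * iexp b"
  have g2: "(cmod g)\<^sup>2 = s\<^sup>2 - 2 * k"
  proof -
    have "(cmod g)\<^sup>2 = (wu r * cos a + wv r * cos b)\<^sup>2 + (wu r * sin a + wv r * sin b)\<^sup>2"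
      by (simp add: cmod_power2 g_def Re_exp Im_exp)
    also have "\<dots> = (wu r)\<^sup>2 * ((cos a)\<^sup>2 + (sin a)\<^sup>2) + (wv r)\<^sup>2 * ((cos b)\<^sup>2 + (sin b)\<^sup>2)
         + 2 * wu r * wv r * (cos a * cos b + sin a * sin b)"
      by algebra
    also have "\<dots> = (wu r)\<^sup>2 * 1 + (wv r)\<^sup>2 * 1 + 2 * wu r * wv r * cos (a - b)"
      unfolding cos_diff sin_cos_squared_add2 ..
    also have "a - b = y * (u + v)" by (simp add: a_def b_def algebra_simps)
    finally have "(cmod g)\<^sup>2 = (wu r)\<^sup>2 * 1 + (wv r)\<^sup>2 * 1 + 2 * wu r * wv r * cos (y * (u + v))" .
    thus ?thesis by (simp add: s_def k_def power2_eq_square algebra_simps)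
  qed
  have "s\<^sup>2 - 2 * k \<le> (s - k)\<^sup>2"
  proof -
    have "s * k \<le> 1 * k" using s k0 by (intro mult_right_mono) auto
    moreover have "k * k \<ge> 0" by simp
    moreover have "(s - k)\<^sup>2 = s\<^sup>2 - 2 * (s * k) + k * k" by (simp add: power2_eq_square algebra_simps)
    ultimately show ?thesis by linarith
  qed
  hence "(cmod g)\<^sup>2 \<le> (s - k)\<^sup>2" by (simp only: g2)
  hence "cmod g \<le> s - k" by (rule power2_le_imp_le) (use ks in simp)
  moreover have "cmod (ch r y) \<le> cmod g + w0 r"
    unfolding ch_eq a_def[symmetric] b_def[symmetric] g_def[symmetric]
    using norm_triangle_ineq[of g "of_real (w0 r) * iexp (y * - mean r)"] w(3) by (simp add: norm_mult)
  ultimately have "cmod (ch r y) \<le> 1 - k" using w by linarith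
  also have "\<dots> \<le> exp (- k)" using exp_ge_add_one_self[of "- k"] by simp
  also have "k \<ge> exp (-3) / 9 * ((y * (u + v))\<^sup>2 / 3)"
    unfolding k_def using weights_ge[OF r] y u v w
    by (intro mult_mono one_minus_cos_ge) (auto simp: abs_mult)
  hence "exp (- k) \<le> exp (- (exp (-3) / 27) * (u + v)\<^sup>2 * y\<^sup>2)"
    by (simp add: power_mult_distrib mult_ac)
  finally show ?thesis .
qed

lemma ln_tp_deriv: "((\<lambda>r. ln (tp q u v r)) has_real_derivative mean r) (at r)"
proof -
  have "((\<lambda>r. ln (tp q u v r)) has_real_derivative (q * (exp (r * u) * u) + q * (exp (- r * v) * (- v))) / tp q u v r) (at r)"
    unfolding tp_def using tp_pos[of r] by (auto intro!: derivative_eq_intros simp: tp_def)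
  also have "(q * (exp (r * u) * u) + q * (exp (- r * v) * (- v))) / tp q u v r = mean r"
    by (simp add: mean_def wu_def wv_def diff_divide_distrib)
  finally show ?thesis .
qed

lemma mean_deriv: "(mean has_real_derivative var r) (at r)"
proof -
  define F where "F = tp q u v r"
  define N where "N = q * exp (r * u) * u - q * exp (- r * v) * v"
  have F: "F \<noteq> 0" using tp_pos[of r] by (simp add: F_def)
  have d1: "((\<lambda>r. q * exp (r * u) * u - q * exp (- r * v) * v) has_real_derivative
      q * exp (r * u) * u\<^sup>2 + q * exp (- r * v) * v\<^sup>2) (at r)"
    by (auto intro!: derivative_eq_intros simp: power2_eq_square)
  have d2: "((\<lambda>r. tp q u v r) has_real_derivative N) (at r)"
    unfolding tp_def by (auto intro!: derivative_eq_intros simp: N_def)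
  have e: "mean = (\<lambda>r. (q * exp (r * u) * u - q * exp (- r * v) * v) / tp q u v r)"
    by (rule ext) (simp add: mean_def wu_def wv_def diff_divide_distrib)
  have "(mean has_real_derivative
     ((q * exp (r * u) * u\<^sup>2 + q * exp (- r * v) * v\<^sup>2) * F - N * N) / (F * F)) (at r)"
    unfolding e using DERIV_divide[OF d1 d2] F by (simp add: N_def F_def)
  also have "((q * exp (r * u) * u\<^sup>2 + q * exp (- r * v) * v\<^sup>2) * F - N * N) / (F * F) = var r"
  proof -
    have "mean r = N / F" by (simp add: e N_def F_def)
    hence "var r = q * exp (r * u) / F * u\<^sup>2 + q * exp (- r * v) / F * v\<^sup>2 - (N / F)\<^sup>2"
      by (simp only: var_alt wu_def wv_def F_def[symmetric])
    also have "\<dots> = ((q * exp (r * u) * u\<^sup>2 + q * exp (- r * v) * v\<^sup>2) * F - N * N) / (F * F)"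
      using F by (simp add: field_simps power2_eq_square)
    finally show ?thesis by simp
  qed
  finally show ?thesis .
qed

lemma mean_0: "mean 0 = q * (u - v)"
  by (simp add: mean_def wu_def wv_def tp_def algebra_simps)

lemma var_pos: "u > 0 \<Longrightarrow> var r > 0"
proof -
  assume "u > 0"
  hence "wu r * wv r * (u + v)\<^sup>2 > 0" using weights_pos[of r] v by simp
  thus ?thesis using var_ge_weights[of r] by linarith
qed

end

section \<open>Laplace tails from characteristic functions\<close>

text \<open>The two Levy inversion formulas are subtracted before anything is estimated. What
  remains is an integral over \<open>[-T, T]\<close> with a kernel of modulus at most
  \<open>b - a\<close>, bounded uniformly in \<open>T\<close> by the \<open>L^1\<close> norm of the
  difference of characteristic functions. The inversion formula asks for endpoints without
  mass.\<close>

lemma measure_interval_diff_le: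
  fixes a b :: real
  assumes \<mu>: "real_distribution \<mu>" and \<nu>: "real_distribution \<nu>" and ab: "a \<le> b"
    and atoms: "measure \<mu> {a} = 0" "measure \<mu> {b} = 0" "measure \<nu> {a} = 0" "measure \<nu> {b} = 0"
    and int: "integrable lborel (\<lambda>t. char \<mu> t - char \<nu> t)"
  shows "\<bar>measure \<mu> {a<..b} - measure \<nu> {a<..b}\<bar>
           \<le> (b - a) * ((\<integral>t. cmod (char \<mu> t - char \<nu> t) \<partial>lborel) / (2 * pi))"
proof -
  interpret \<mu>: real_distribution \<mu> by fact
  interpret \<nu>: real_distribution \<nu> by fact
  \<comment> \<open>At \<open>t = 0\<close> division by zero makes the kernel 0 instead of its limit
    \<open>b - a\<close>; this changes nothing in the integrals.\<close>
  define K where "K t = (iexp (-(t * a)) - iexp (-(t * b))) / (\<i> * complex_of_real t)" for t :: real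
  define I where "I = (\<integral>t. cmod (char \<mu> t - char \<nu> t) \<partial>lborel)"
  have K_meas [measurable]: "K \<in> borel_measurable borel" unfolding K_def by measurable
  have K: "cmod (K t) \<le> b - a" if "t \<noteq> 0" for t
    using Levy_Inversion_aux2[of "- b" "- a" t] ab that by (simp add: K_def norm_minus_commute)
  have [measurable]: "char \<mu> \<in> borel_measurable borel" "char \<nu> \<in> borel_measurable borel"
    by (auto intro: \<mu>.char_measurable \<nu>.char_measurable)
  have ae: "AE t in lborel. t \<noteq> (0::real)" by (intro AE_lborel_singleton)
  have Iint: "complex_interval_lebesgue_integrable lborel (ereal (-T)) (ereal T) (\<lambda>t. K t * char M t)"
    if M: "real_distribution M" and T: "T \<ge> 0" for M and T :: real
  proof -
    interpret M: real_distribution M by fact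
    have [measurable]: "char M \<in> borel_measurable borel" by (rule M.char_measurable)
    have "set_integrable lborel (einterval (-T) T) (\<lambda>t. K t * char M t)"
      unfolding set_integrable_def
    proof (intro integrableI_bounded_set_indicator[where B = "b - a"])
      show "AE t\<in>einterval (-T) T in lborel. cmod (K t * char M t) \<le> b - a"
      proof (use ae in eventually_elim, intro impI)
        fix t :: real assume "t \<noteq> 0"
        thus "cmod (K t * char M t) \<le> b - a"
          using mult_mono[OF K M.cmod_char_le_1, of t t] ab by (simp add: norm_mult)
      qed
      show "emeasure lborel (einterval (ereal (-T)) (ereal T)) < \<infinity>"
        using T by simp
    qed auto
    thus ?thesis using T by (simp add: interval_lebesgue_integrable_def)
  qed
  define J where "J T = 1 / (2 * pi) * (CLBINT t=ereal (-T)..ereal T. K t * char \<mu> t)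
                      - 1 / (2 * pi) * (CLBINT t=ereal (-T)..ereal T. K t * char \<nu> t)" for T
  have "(\<lambda>n. J (real n)) \<longlonglongrightarrow> complex_of_real (measure \<mu> {a<..b}) - complex_of_real (measure \<nu> {a<..b})"
    unfolding J_def using \<mu>.Levy_Inversion[OF ab atoms(1,2)] \<nu>.Levy_Inversion[OF ab atoms(3,4)]
    by (intro tendsto_diff) (simp_all add: K_def)
  hence lim: "(\<lambda>n. cmod (J (real n))) \<longlonglongrightarrow> \<bar>measure \<mu> {a<..b} - measure \<nu> {a<..b}\<bar>"
    using tendsto_norm by (metis norm_of_real of_real_diff)
  have "cmod (J T) \<le> (b - a) * (I / (2 * pi))" if T: "T \<ge> 0" for T
  proof -
    have "J T = 1 / (2 * pi) * (CLBINT t=ereal (-T)..ereal T. K t * char \<mu> t - K t * char \<nu> t)"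
      unfolding J_def using Iint[OF \<mu> T] Iint[OF \<nu> T]
      by (subst interval_lebesgue_integral_diff) (auto simp: right_diff_distrib)
    also have "\<dots> = 1 / (2 * pi) * (CLBINT t=ereal (-T)..ereal T. K t * (char \<mu> t - char \<nu> t))"
      by (simp add: right_diff_distrib)
    also have "(CLBINT t=ereal (-T)..ereal T. K t * (char \<mu> t - char \<nu> t)) =
        (CLBINT t. indicator {-T<..<T} t *\<^sub>R (K t * (char \<mu> t - char \<nu> t)))"
      using T by (simp add: interval_lebesgue_integral_def set_lebesgue_integral_def)
    finally have "cmod (J T) = 1 / (2 * pi) * cmod (CLBINT t. indicator {-T<..<T} t *\<^sub>R (K t * (char \<mu> t - char \<nu> t)))"
      by (simp add: norm_mult norm_divide)
    also have "\<dots> \<le> 1 / (2 * pi) * (LBINT t. (b - a) * cmod (char \<mu> t - char \<nu> t))"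
    proof (intro mult_left_mono Bochner_Integration.integral_norm_bound_integral)
      have bnd: "AE t in lborel. cmod (indicator {-T<..<T} t *\<^sub>R (K t * (char \<mu> t - char \<nu> t)))
             \<le> (b - a) * cmod (char \<mu> t - char \<nu> t)"
        using ae
      proof eventually_elim
        case (elim t)
        have "cmod (K t) * cmod (char \<mu> t - char \<nu> t) \<le> (b - a) * cmod (char \<mu> t - char \<nu> t)"
          using K[OF elim] by (intro mult_right_mono) auto
        thus ?case using ab by (auto simp: norm_mult split: split_indicator)
      qed
      show i1: "integrable lborel (\<lambda>t. (b - a) * cmod (char \<mu> t - char \<nu> t))"
        using int by (intro integrable_mult_right integrable_norm)
      show "integrable lborel (\<lambda>t. indicator {-T<..<T} t *\<^sub>R (K t * (char \<mu> t - char \<nu> t)))"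
        using bnd ab by (intro Bochner_Integration.integrable_bound[OF i1]) (auto simp: abs_mult)
      show "cmod (indicator {-T<..<T} t *\<^sub>R (K t * (char \<mu> t - char \<nu> t)))
             \<le> (b - a) * cmod (char \<mu> t - char \<nu> t)" for t
      proof (cases "t = 0")
        case True
        thus ?thesis using ab by (simp add: K_def)
      next
        case False
        have "cmod (K t) * cmod (char \<mu> t - char \<nu> t) \<le> (b - a) * cmod (char \<mu> t - char \<nu> t)"
          using K[OF False] by (intro mult_right_mono) auto
        thus ?thesis using ab by (auto simp: norm_mult split: split_indicator)
      qed
    qed auto
    also have "\<dots> = (b - a) * (I / (2 * pi))" by (simp add: I_def)
    finally show ?thesis .
  qed
  hence "\<bar>measure \<mu> {a<..b} - measure \<nu> {a<..b}\<bar> \<le> (b - a) * (I / (2 * pi))"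
    by (intro LIMSEQ_le_const2[OF lim]) auto
  thus ?thesis by (simp add: I_def)
qed

lemma (in real_distribution) measure_Ioc_tendsto_left:
  assumes "\<And>n. a < s n" "s \<longlonglongrightarrow> a"
  shows "(\<lambda>n. measure M {s n<..b}) \<longlonglongrightarrow> measure M {a<..b}"
proof -
  have "(\<lambda>n. LINT x|M. indicat_real {s n<..b} x) \<longlonglongrightarrow> (LINT x|M. indicat_real {a<..b} x)"
  proof (rule integral_dominated_convergence[where w = "\<lambda>_. 1"])
    show "AE x in M. (\<lambda>n. indicat_real {s n<..b} x) \<longlonglongrightarrow> indicat_real {a<..b} x"
    proof (intro AE_I2)
      fix x
      show "(\<lambda>n. indicat_real {s n<..b} x) \<longlonglongrightarrow> indicat_real {a<..b} x"
      proof (cases "a < x")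
        case True
        hence "eventually (\<lambda>n. s n < x) sequentially" using assms(2) by (auto dest: order_tendstoD)
        hence "eventually (\<lambda>n. indicat_real {s n<..b} x = indicat_real {a<..b} x) sequentially"
          by eventually_elim (use True in \<open>auto simp: indicator_def\<close>)
        thus ?thesis by (rule tendsto_eventually)
      next
        case False
        hence "indicat_real {s n<..b} x = indicat_real {a<..b} x" for n
          using assms(1)[of n] by (auto simp: indicator_def)
        thus ?thesis by simp
      qed
    qed
  qed (auto simp: indicator_def)
  thus ?thesis by simp
qed

text \<open>Both laws have only countably many atoms. Hence almost every \<open>x\<close> is an
  admissible right endpoint, and the left endpoint 0, which may carry mass, is approached from the
  right along points without mass.\<close>

lemma AE_measure_interval_diff_le:
  assumes \<mu>: "real_distribution \<mu>" and \<nu>: "real_distribution \<nu>"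
    and int: "integrable lborel (\<lambda>t. char \<mu> t - char \<nu> t)"
  shows "AE x in lborel. x > 0 \<longrightarrow> \<bar>measure \<mu> {0<..x} - measure \<nu> {0<..x}\<bar>
           \<le> x * ((\<integral>t. cmod (char \<mu> t - char \<nu> t) \<partial>lborel) / (2 * pi))"
proof -
  interpret \<mu>: real_distribution \<mu> by fact
  interpret \<nu>: real_distribution \<nu> by fact
  define A where "A = {x. measure \<mu> {x} \<noteq> 0} \<union> {x. measure \<nu> {x} \<noteq> 0}"
  have A: "countable A" unfolding A_def by (intro countable_Un \<mu>.countable_support \<nu>.countable_support)
  have "\<exists>s. \<forall>n. 0 < s n \<and> s n < 1 / real (Suc n) \<and> s n \<notin> A"
  proof (intro choice allI)
    fix n
    have "uncountable ({0<..<1 / real (Suc n)} - A)"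
      using A by (intro uncountable_minus_countable) (auto simp: uncountable_open_interval)
    then obtain x where "x \<in> {0<..<1 / real (Suc n)} - A" by (metis countable_empty ex_in_conv)
    thus "\<exists>s. 0 < s \<and> s < 1 / real (Suc n) \<and> s \<notin> A" by auto
  qed
  then obtain s where s: "\<And>n. 0 < s n" "\<And>n. s n < 1 / real (Suc n)" "\<And>n. s n \<notin> A" by blast
  have s0: "s \<longlonglongrightarrow> 0"
  proof (rule tendsto_sandwich[of "\<lambda>_. 0" _ _ "\<lambda>n. 1 / real (Suc n)"])
    show "(\<lambda>n. 1 / real (Suc n)) \<longlonglongrightarrow> 0" using LIMSEQ_inverse_real_of_nat by (simp add: inverse_eq_divide)
  qed (use s in \<open>auto intro!: always_eventually less_imp_le\<close>)
  define C where "C = (\<integral>t. cmod (char \<mu> t - char \<nu> t) \<partial>lborel) / (2 * pi)"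
  have "AE x in lborel. x \<notin> A"
    using A by (intro AE_not_in) (simp add: countable_imp_null_set_lborel)
  thus ?thesis
  proof eventually_elim
    case (elim x)
    show ?case
    proof
      assume x: "0 < x"
      have "(\<lambda>n. \<bar>measure \<mu> {s n<..x} - measure \<nu> {s n<..x}\<bar>) \<longlonglongrightarrow> \<bar>measure \<mu> {0<..x} - measure \<nu> {0<..x}\<bar>"
        using s s0 by (intro tendsto_intros \<mu>.measure_Ioc_tendsto_left \<nu>.measure_Ioc_tendsto_left) auto
      moreover have "eventually (\<lambda>n. \<bar>measure \<mu> {s n<..x} - measure \<nu> {s n<..x}\<bar> \<le> (x - s n) * C) sequentially"
        using order_tendstoD(2)[OF s0 x]
      proof eventually_elim
        case (elim n)
        show ?case unfolding C_def
          by (rule measure_interval_diff_le[OF \<mu> \<nu> _ _ _ _ _ int]) (use s(3)[of n] elim \<open>x \<notin> A\<close> in \<open>auto simp: A_def\<close>)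
      qed
      moreover have "(\<lambda>n. (x - s n) * C) \<longlonglongrightarrow> (x - 0) * C"
        by (intro tendsto_intros s0)
      ultimately have "\<bar>measure \<mu> {0<..x} - measure \<nu> {0<..x}\<bar> \<le> (x - 0) * C"
        by (intro tendsto_le[OF sequentially_bot]) auto
      thus "\<bar>measure \<mu> {0<..x} - measure \<nu> {0<..x}\<bar> \<le> x * ((\<integral>t. cmod (char \<mu> t - char \<nu> t) \<partial>lborel) / (2 * pi))"
        by (simp add: C_def)
    qed
  qed
qed

section \<open>Laplace integrals over the positive half-line\<close>

lemma nn_integral_exp_decay_atLeast:
  fixes k :: real
  assumes "k > 0"
  shows "(\<integral>\<^sup>+x. ennreal (k * exp (- k * x)) * indicator {w..} x \<partial>lborel) = ennreal (exp (- k * w))"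
proof -
  have "(\<integral>\<^sup>+x. ennreal (k * exp (- k * x)) * indicator {w..} x \<partial>lborel) = ennreal (0 - (- exp (- k * w)))"
  proof (rule nn_integral_FTC_atLeast)
    have "((\<lambda>x. exp (- (k * x))) \<longlongrightarrow> 0) at_top"
      using assms by real_asymp
    from tendsto_minus[OF this] show "((\<lambda>x. - exp (- k * x)) \<longlongrightarrow> 0) at_top" by simp
  qed (use assms in \<open>auto intro!: derivative_eq_intros\<close>)
  thus ?thesis by simp
qed

text \<open>Tonelli, after writing \<open>exp (- k * w)\<close> as the integral of
  \<open>k * exp (- k * x)\<close> over \<open>x >= w\<close>. This brings in the interval
  probabilities that Levy inversion controls.\<close>

lemma (in real_distribution) laplace_tail_eq:
  fixes k :: real
  assumes k: "k > 0"
  shows "(LINT x|M. exp (- k * x) * indicator {0<..} x) =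
         (LINT x|lborel. k * exp (- k * x) * indicator {0<..} x * measure M {0<..x})" (is ?A)
    and "integrable lborel (\<lambda>x. k * exp (- k * x) * indicator {0<..} x * measure M {0<..x})" (is ?B)
proof -
  interpret P: pair_sigma_finite lborel M ..
  let ?f = "\<lambda>x w. ennreal (k * exp (- k * x)) * (if 0 < w \<and> w \<le> x then 1 else 0 :: ennreal)"
  have [measurable]: "(\<lambda>(x, w). ?f x w) \<in> borel_measurable (lborel \<Otimes>\<^sub>M M)" by measurable
  have meas: "(\<lambda>x. measure M {0<..x}) \<in> borel_measurable borel"
  proof -
    have "(\<lambda>x. measure M {0<..x}) = (\<lambda>x. if 0 \<le> x then cdf M x - cdf M 0 else 0)"
      by (auto simp: cdf_def fun_eq_iff finite_measure_Diff[symmetric] intro!: arg_cong[where f = "measure M"])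
    also have "\<dots> \<in> borel_measurable borel"
      using borel_measurable_mono[OF monoI, of "cdf M"] cdf_nondecreasing by measurable
    finally show ?thesis .
  qed
  have "(\<integral>\<^sup>+w. ennreal (exp (- k * w) * indicator {0<..} w) \<partial>M) = (\<integral>\<^sup>+w. (\<integral>\<^sup>+x. ?f x w \<partial>lborel) \<partial>M)"
  proof (rule nn_integral_cong)
    fix w :: real
    have "(\<integral>\<^sup>+x. ?f x w \<partial>lborel) = (\<integral>\<^sup>+x. (ennreal (k * exp (- k * x)) * indicator {w..} x) * indicator {0<..} w \<partial>lborel)"
      by (intro nn_integral_cong) (auto simp: indicator_def)
    also have "\<dots> = ennreal (exp (- k * w)) * indicator {0<..} w"
      by (subst nn_integral_multc) (simp, simp only: nn_integral_exp_decay_atLeast[OF k])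
    finally show "ennreal (exp (- k * w) * indicator {0<..} w) = (\<integral>\<^sup>+x. ?f x w \<partial>lborel)"
      by (simp add: indicator_def)
  qed
  also have "\<dots> = (\<integral>\<^sup>+x. (\<integral>\<^sup>+w. ?f x w \<partial>M) \<partial>lborel)"
    by (rule P.Fubini') measurable
  also have "\<dots> = (\<integral>\<^sup>+x. ennreal (k * exp (- k * x) * indicator {0<..} x * measure M {0<..x}) \<partial>lborel)"
  proof (rule nn_integral_cong)
    fix x :: real
    have "(\<integral>\<^sup>+w. ?f x w \<partial>M) = ennreal (k * exp (- k * x)) * (\<integral>\<^sup>+w. indicator {0<..x} w \<partial>M)"
      by (subst nn_integral_cmult[symmetric]) (auto intro!: nn_integral_cong simp: indicator_def)
    also have "\<dots> = ennreal (k * exp (- k * x)) * ennreal (measure M {0<..x})"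
      by (simp add: emeasure_eq_measure)
    also have "\<dots> = ennreal (k * exp (- k * x) * indicator {0<..} x * measure M {0<..x})"
      using k by (cases "x > 0") (auto simp: ennreal_mult')
    finally show "(\<integral>\<^sup>+w. ?f x w \<partial>M) = ennreal (k * exp (- k * x) * indicator {0<..} x * measure M {0<..x})" .
  qed
  finally have eq: "(\<integral>\<^sup>+w. ennreal (exp (- k * w) * indicator {0<..} w) \<partial>M) =
      (\<integral>\<^sup>+x. ennreal (k * exp (- k * x) * indicator {0<..} x * measure M {0<..x}) \<partial>lborel)" .
  have [measurable]: "(\<lambda>x. measure M {0<..x}) \<in> borel_measurable borel" by fact
  have le: "(\<integral>\<^sup>+w. ennreal (exp (- k * w) * indicator {0<..} w) \<partial>M) \<le> 1"
  proof -
    have "(\<integral>\<^sup>+w. ennreal (exp (- k * w) * indicator {0<..} w) \<partial>M) \<le> (\<integral>\<^sup>+w. 1 \<partial>M)"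
      using k by (intro nn_integral_mono) (auto simp: indicator_def ennreal_le_1)
    thus ?thesis using emeasure_space_1 by simp
  qed
  have "(LINT x|M. exp (- k * x) * indicator {0<..} x) = enn2real (\<integral>\<^sup>+w. ennreal (exp (- k * w) * indicator {0<..} w) \<partial>M)"
    by (rule integral_eq_nn_integral) auto
  moreover have "(LINT x|lborel. k * exp (- k * x) * indicator {0<..} x * measure M {0<..x}) =
      enn2real (\<integral>\<^sup>+x. ennreal (k * exp (- k * x) * indicator {0<..} x * measure M {0<..x}) \<partial>lborel)"
    using k by (intro integral_eq_nn_integral) auto
  ultimately show ?A by (simp only: eq)
  show ?B
  proof (rule integrableI_nonneg)
    show "(\<integral>\<^sup>+x. ennreal (k * exp (- k * x) * indicator {0<..} x * measure M {0<..x}) \<partial>lborel) < \<infinity>"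
      using le unfolding eq by (rule le_less_trans) simp
  qed (use k in auto)
qed

text \<open>By \<open>laplace_tail_eq\<close> the bound \<open>C * x\<close> for the interval
  probabilities is integrated against the exponential density \<open>k * exp (- k * x)\<close>,
  whose mean is \<open>1 / k\<close>.\<close>

lemma laplace_tail_diff_le:
  fixes k :: real
  assumes \<mu>: "real_distribution \<mu>" and \<nu>: "real_distribution \<nu>" and k: "k > 0"
    and int: "integrable lborel (\<lambda>t. char \<mu> t - char \<nu> t)"
  shows "\<bar>(LINT x|\<mu>. exp (- k * x) * indicator {0<..} x) - (LINT x|\<nu>. exp (- k * x) * indicator {0<..} x)\<bar>
           \<le> (\<integral>t. cmod (char \<mu> t - char \<nu> t) \<partial>lborel) / (2 * pi) / k"
proof -
  define C where "C = (\<integral>t. cmod (char \<mu> t - char \<nu> t) \<partial>lborel) / (2 * pi)"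
  have C: "C \<ge> 0" unfolding C_def by simp
  define g where "g M x = k * exp (- k * x) * indicator {0<..} x * measure M {0<..x}" for M and x :: real
  define h where "h x = C * (x * (k * exp (- k * x)) * indicator {0..} x)" for x :: real
  have hb: "has_bochner_integral lborel (\<lambda>x. x * (k * exp (- k * x)) * indicator {0..} x) (1 / k)"
  proof -
    have "(\<integral>\<^sup>+x. ennreal (x * (k * exp (- k * x))) * indicator {0..} x \<partial>lborel) = ennreal (0 - (- exp (- k * 0) * (0 + 1 / k)))"
    proof (rule nn_integral_FTC_atLeast)
      show "((\<lambda>x. - exp (- k * x) * (x + 1 / k)) \<longlongrightarrow> 0) at_top"
        using k by real_asymp
    qed (use k in \<open>auto intro!: derivative_eq_intros simp: field_simps\<close>)
    also have "\<dots> = ennreal (1 / k)" by simp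
    finally show ?thesis using k
      by (intro has_bochner_integral_nn_integral) (auto simp: indicator_def ennreal_mult' intro!: nn_integral_cong elim!: trans[rotated])
  qed
  note g1 = real_distribution.laplace_tail_eq(2)[OF \<mu> k, folded g_def] and g2 = real_distribution.laplace_tail_eq(2)[OF \<nu> k, folded g_def]
  have "(LINT x|\<mu>. exp (- k * x) * indicator {0<..} x) - (LINT x|\<nu>. exp (- k * x) * indicator {0<..} x)
      = (LINT x|lborel. g \<mu> x - g \<nu> x)"
    unfolding real_distribution.laplace_tail_eq(1)[OF \<mu> k] real_distribution.laplace_tail_eq(1)[OF \<nu> k] g_def[symmetric]
    by (rule Bochner_Integration.integral_diff[OF g1 g2, symmetric])
  also have "\<bar>\<dots>\<bar> \<le> (LINT x|lborel. \<bar>g \<mu> x - g \<nu> x\<bar>)" by (rule integral_abs_bound)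
  also have "\<dots> \<le> (LINT x|lborel. h x)"
  proof -
    have i0: "integrable lborel (\<lambda>x. g \<mu> x - g \<nu> x)" by (intro Bochner_Integration.integrable_diff g1 g2)
    have i1: "integrable lborel (\<lambda>x. \<bar>g \<mu> x - g \<nu> x\<bar>)"
      using integrable_norm[OF i0] unfolding real_norm_def .
    have "integrable lborel (\<lambda>x. x * (k * exp (- k * x)) * indicator {0..} x)"
      using hb unfolding has_bochner_integral_iff by (rule conjunct1)
    hence i2: "integrable lborel h" unfolding h_def by (rule integrable_mult_right)
    have ae: "AE x in lborel. \<bar>g \<mu> x - g \<nu> x\<bar> \<le> h x"
      using AE_measure_interval_diff_le[OF \<mu> \<nu> int]
    proof eventually_elim
      case (elim x)
      show ?case
      proof (cases "x > 0")
        case True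
        have "\<bar>g \<mu> x - g \<nu> x\<bar> = k * exp (- k * x) * \<bar>measure \<mu> {0<..x} - measure \<nu> {0<..x}\<bar>"
        proof -
          have "g \<mu> x - g \<nu> x = k * exp (- k * x) * (measure \<mu> {0<..x} - measure \<nu> {0<..x})"
            using True by (simp add: g_def right_diff_distrib)
          thus ?thesis using k by (simp add: abs_mult)
        qed
        also have "\<dots> \<le> k * exp (- k * x) * (x * C)"
          using elim True k by (intro mult_left_mono) (auto simp: C_def)
        finally show ?thesis using True by (simp add: h_def mult_ac)
      next
        case False
        thus ?thesis using C k by (auto simp: g_def h_def indicator_def)
      qed
    qed
    show ?thesis by (rule integral_mono_AE[OF i1 i2 ae])
  qed
  also have "\<dots> = C * (1 / k)"
    using hb unfolding h_def by (subst integral_mult_right_zero) (simp add: has_bochner_integral_iff)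
  finally show ?thesis by (simp add: C_def)
qed

text \<open>As a scaled image of the standard normal law, with standard deviation \<open>s\<close>,
  it gets its characteristic function and its Laplace integral from the standard case by
  substitution.\<close>

definition centered_normal :: "real \<Rightarrow> real measure" where
  "centered_normal s = distr std_normal_distribution borel (\<lambda>x. s * x)"

lemma real_distribution_centered_normal: "real_distribution (centered_normal s)"
proof -
  interpret N: real_distribution std_normal_distribution by (rule real_dist_normal_dist)
  show ?thesis unfolding centered_normal_def by (rule N.real_distribution_distr) simp
qed

lemma char_centered_normal: "char (centered_normal s) t = complex_of_real (exp (- s\<^sup>2 * t\<^sup>2 / 2))"
proof -
  have "char (centered_normal s) t = char std_normal_distribution (s * t)"
    unfolding char_def centered_normal_def by (subst integral_distr) (auto simp: mult_ac)
  thus ?thesis by (simp add: char_std_normal_distribution power_mult_distrib)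
qed

text \<open>After scaling, the parameter is \<open>c = k * s\<close>. Up to the factor
  \<open>1 / sqrt (2 * pi)\<close>, the inequalities
  \<open>1 - x^2 / 2 <= exp (- x^2 / 2) <= 1\<close> enclose the integral between
  \<open>1 / c - 1 / c^3\<close> and \<open>1 / c\<close>.\<close>

lemma laplace_tail_centered_normal:
  fixes k s :: real
  assumes k: "k > 0" and s: "s > 0"
  shows "\<bar>(LINT x|centered_normal s. exp (- k * x) * indicator {0<..} x) - 1 / (k * s * sqrt (2 * pi))\<bar>
          \<le> 1 / (k * s * sqrt (2 * pi)) * (1 / (k * s)\<^sup>2)"
proof -
  define c where "c = k * s"
  have c: "c > 0" using k s by (simp add: c_def)
  let ?L = "LINT x|centered_normal s. exp (- k * x) * indicator {0<..} x"
  let ?f = "\<lambda>x. std_normal_density x * (exp (- c * x) * indicator {0<..} x)"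
  have "?L = (LINT x|std_normal_distribution. exp (- c * x) * indicator {0<..} x)"
    unfolding centered_normal_def using s
    by (subst integral_distr) (auto simp: c_def mult_ac zero_less_mult_iff indicator_def intro!: Bochner_Integration.integral_cong)
  also have "\<dots> = (LINT x|lborel. ?f x)"
    by (subst integral_density) (auto simp: normal_density_nonneg)
  finally have L: "?L = (LINT x|lborel. ?f x)" .
  have hb0: "has_bochner_integral lborel (\<lambda>x. exp (- c * x) * indicator {0..} x) (1 / c)"
  proof -
    have "(\<integral>\<^sup>+x. ennreal (exp (- c * x)) * indicator {0..} x \<partial>lborel) = ennreal (0 - (- exp (- c * 0) / c))"
    proof (rule nn_integral_FTC_atLeast)
      show "((\<lambda>x. - exp (- c * x) / c) \<longlongrightarrow> 0) at_top" using c by real_asymp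
    qed (use c in \<open>auto intro!: derivative_eq_intros\<close>)
    also have "\<dots> = ennreal (1 / c)" by simp
    finally show ?thesis using c
      by (intro has_bochner_integral_nn_integral) (auto simp: indicator_def ennreal_mult' intro!: nn_integral_cong elim!: trans[rotated])
  qed
  have hb2: "has_bochner_integral lborel (\<lambda>x. x\<^sup>2 * exp (- c * x) * indicator {0..} x) (2 / c ^ 3)"
  proof -
    have "(\<integral>\<^sup>+x. ennreal (x\<^sup>2 * exp (- c * x)) * indicator {0..} x \<partial>lborel)
        = ennreal (0 - (- exp (- c * 0) * (0\<^sup>2 / c + 2 * 0 / c\<^sup>2 + 2 / c ^ 3)))"
    proof (rule nn_integral_FTC_atLeast)
      show "((\<lambda>x. - exp (- c * x) * (x\<^sup>2 / c + 2 * x / c\<^sup>2 + 2 / c ^ 3)) \<longlongrightarrow> 0) at_top" using c by real_asymp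
    qed (use c in \<open>auto intro!: derivative_eq_intros simp: field_simps power2_eq_square power3_eq_cube\<close>)
    also have "\<dots> = ennreal (2 / c ^ 3)" by simp
    finally show ?thesis using c
      by (intro has_bochner_integral_nn_integral) (auto simp: indicator_def ennreal_mult' intro!: nn_integral_cong elim!: trans[rotated])
  qed
  let ?u = "\<lambda>x. 1 / sqrt (2 * pi) * (exp (- c * x) * indicator {0..} x)"
  let ?v = "\<lambda>x. 1 / sqrt (2 * pi) * (1 / 2 * (x\<^sup>2 * exp (- c * x) * indicator {0..} x))"
  have ae: "AE x in lborel. x \<noteq> (0::real)" by (intro AE_lborel_singleton)
  have iu: "integrable lborel ?u" by (rule integrable_mult_right) (use hb0 in \<open>simp add: has_bochner_integral_iff\<close>)
  have iv: "integrable lborel ?v" by (rule integrable_mult_right, rule integrable_mult_right) (use hb2 in \<open>simp add: has_bochner_integral_iff\<close>)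
  have up: "AE x in lborel. ?f x \<le> ?u x"
    using ae by eventually_elim (auto simp: std_normal_density_def indicator_def divide_simps)
  have lo: "AE x in lborel. ?u x - ?v x \<le> ?f x"
    using ae
  proof eventually_elim
    case (elim x)
    have "1 - x\<^sup>2 / 2 \<le> exp (- x\<^sup>2 / 2)" using exp_ge_add_one_self[of "- x\<^sup>2 / 2"] by simp
    hence "1 / sqrt (2 * pi) * exp (- c * x) * (1 - x\<^sup>2 / 2) \<le> 1 / sqrt (2 * pi) * exp (- c * x) * exp (- x\<^sup>2 / 2)"
      by (intro mult_left_mono) auto
    moreover have "?u x - ?v x = 1 / sqrt (2 * pi) * exp (- c * x) * (1 - x\<^sup>2 / 2)" if "x > 0"
      using that by (simp add: right_diff_distrib)
    ultimately show ?case using elim by (cases "x > 0") (auto simp: std_normal_density_def indicator_def mult_ac)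
  qed
  have if': "integrable lborel ?f"
    using up by (intro Bochner_Integration.integrable_bound[OF iu]) (auto simp: normal_density_nonneg indicator_def elim!: eventually_mono)
  have "(LINT x|lborel. ?f x) \<le> (LINT x|lborel. ?u x)" by (rule integral_mono_AE[OF if' iu up])
  also have Iu: "(LINT x|lborel. ?u x) = 1 / (c * sqrt (2 * pi))"
    using hb0 by (subst integral_mult_right_zero) (simp add: has_bochner_integral_iff)
  finally have 1: "?L \<le> 1 / (c * sqrt (2 * pi))" unfolding L .
  have "(LINT x|lborel. ?u x) - (LINT x|lborel. ?v x) = (LINT x|lborel. ?u x - ?v x)"
    using iu iv by simp
  also have "\<dots> \<le> (LINT x|lborel. ?f x)"
    by (rule integral_mono_AE[OF _ if' lo]) (use iu iv in auto)
  finally have "(LINT x|lborel. ?u x) - (LINT x|lborel. ?v x) \<le> ?L" unfolding L .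
  also have "(LINT x|lborel. ?v x) = 1 / (c * sqrt (2 * pi)) * (1 / c\<^sup>2)"
    using hb2 c by (subst integral_mult_right_zero, subst integral_mult_right_zero)
       (simp add: has_bochner_integral_iff power2_eq_square power3_eq_cube)
  finally have 2: "1 / (c * sqrt (2 * pi)) - 1 / (c * sqrt (2 * pi)) * (1 / c\<^sup>2) \<le> ?L" unfolding Iu .
  have "1 / (c * sqrt (2 * pi)) * (1 / c\<^sup>2) \<ge> 0" using c by simp
  with 1 2 show ?thesis unfolding c_def abs_le_iff by linarith
qed

section \<open>Random series over primes\<close>

text \<open>Bounded second moments imply uniform integrability. Fatou's lemma carries the bound over
  to \<open>g\<close>; then \<open>d = cmod (f n x - g x)\<close> satisfies
  \<open>d <= min d A + d^2 / A\<close>, where the first part tends to 0 in mean by dominated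
  convergence and the second has mean at most \<open>4 * K / A\<close>.\<close>

lemma tendsto_integral_of_bounded_second_moments:
  fixes f :: "nat \<Rightarrow> 'a \<Rightarrow> complex"
  assumes "prob_space M"
    and meas [measurable]: "\<And>n. f n \<in> borel_measurable M" "g \<in> borel_measurable M"
    and lim: "AE x in M. (\<lambda>n. f n x) \<longlonglongrightarrow> g x"
    and int: "\<And>n. integrable M (\<lambda>x. (cmod (f n x))\<^sup>2)"
    and bound: "\<And>n. (\<integral>x. (cmod (f n x))\<^sup>2 \<partial>M) \<le> K"
  shows "integrable M g" "(\<lambda>n. \<integral>x. f n x \<partial>M) \<longlonglongrightarrow> (\<integral>x. g x \<partial>M)"
proof -
  interpret prob_space M by fact
  have "(\<integral>x. (cmod (f 0 x))\<^sup>2 \<partial>M) \<ge> 0" by (rule Bochner_Integration.integral_nonneg) simp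
  hence K: "K \<ge> 0" using bound[of 0] by linarith
  have sq_le: "y \<le> 1 + y\<^sup>2" for y :: real using sum_power2_ge_zero[of "y - 1" y] by (simp add: power2_eq_square algebra_simps)
  have intf: "integrable M (f n)" for n
  proof (rule Bochner_Integration.integrable_bound[of _ "\<lambda>x. 1 + (cmod (f n x))\<^sup>2"])
    show "AE x in M. norm (f n x) \<le> norm (1 + (cmod (f n x))\<^sup>2)"
      using sq_le by (intro AE_I2) (simp add: abs_of_nonneg add_nonneg_nonneg)
  qed (use int in auto)
  have g2: "(\<integral>\<^sup>+x. ennreal ((cmod (g x))\<^sup>2) \<partial>M) \<le> ennreal K"
  proof -
    have "(\<integral>\<^sup>+x. ennreal ((cmod (g x))\<^sup>2) \<partial>M) = (\<integral>\<^sup>+x. liminf (\<lambda>n. ennreal ((cmod (f n x))\<^sup>2)) \<partial>M)"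
    proof (rule nn_integral_cong_AE)
      show "AE x in M. ennreal ((cmod (g x))\<^sup>2) = liminf (\<lambda>n. ennreal ((cmod (f n x))\<^sup>2))"
        using lim
      proof eventually_elim
        case (elim x)
        have "(\<lambda>n. ennreal ((cmod (f n x))\<^sup>2)) \<longlonglongrightarrow> ennreal ((cmod (g x))\<^sup>2)"
          by (intro tendsto_ennrealI tendsto_intros elim)
        from lim_imp_Liminf[OF sequentially_bot this] show ?case by simp
      qed
    qed
    also have "\<dots> \<le> liminf (\<lambda>n. \<integral>\<^sup>+x. ennreal ((cmod (f n x))\<^sup>2) \<partial>M)"
      by (rule nn_integral_liminf) simp
    also have "\<dots> \<le> liminf (\<lambda>n. ennreal K)"
      using bound by (intro Liminf_mono always_eventually allI) (subst nn_integral_eq_integral[OF int], auto intro: ennreal_leI)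
    finally show ?thesis by (simp add: Liminf_const)
  qed
  have intg2: "integrable M (\<lambda>x. (cmod (g x))\<^sup>2)"
    using g2 by (intro integrableI_nonneg) (auto intro: le_less_trans)
  have g2': "(\<integral>x. (cmod (g x))\<^sup>2 \<partial>M) \<le> K"
    using g2 K by (subst (asm) nn_integral_eq_integral[OF intg2]) auto
  show intg: "integrable M g"
  proof (rule Bochner_Integration.integrable_bound[of _ "\<lambda>x. 1 + (cmod (g x))\<^sup>2"])
    show "AE x in M. norm (g x) \<le> norm (1 + (cmod (g x))\<^sup>2)"
      using sq_le by (intro AE_I2) (simp add: abs_of_nonneg add_nonneg_nonneg)
  qed (use intg2 in auto)
  show "(\<lambda>n. \<integral>x. f n x \<partial>M) \<longlonglongrightarrow> (\<integral>x. g x \<partial>M)"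
  proof (rule tendstoI)
    fix e :: real assume e: "e > 0"
    \<comment> \<open>Makes \<open>4 * K / A\<close> smaller than \<open>e / 2\<close>; the
      \<open>K + 1\<close> keeps \<open>A\<close> positive when \<open>K = 0\<close>.\<close>
    define A where "A = 8 * (K + 1) / e"
    have A: "A > 0" using e K by (simp add: A_def)
    have trunc: "(\<lambda>n. \<integral>x. min (cmod (f n x - g x)) A \<partial>M) \<longlonglongrightarrow> (\<integral>x. 0 \<partial>M)"
    proof (rule integral_dominated_convergence[where w = "\<lambda>_. A"])
      show "AE x in M. (\<lambda>n. min (cmod (f n x - g x)) A) \<longlonglongrightarrow> 0"
        using lim
      proof eventually_elim
        case (elim x)
        have "(\<lambda>n. min (cmod (f n x - g x)) A) \<longlonglongrightarrow> min (cmod (g x - g x)) A"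
          by (intro tendsto_intros elim)
        thus ?case using A by (simp add: min_def)
      qed
    qed (use A in \<open>auto simp: min_def\<close>)
    have "eventually (\<lambda>n. (\<integral>x. min (cmod (f n x - g x)) A \<partial>M) < e / 2) sequentially"
      using order_tendstoD(2)[OF trunc, of "e / 2"] e by simp
    thus "eventually (\<lambda>n. dist (\<integral>x. f n x \<partial>M) (\<integral>x. g x \<partial>M) < e) sequentially"
    proof eventually_elim
      case (elim n)
      have imin: "integrable M (\<lambda>x. min (cmod (f n x - g x)) A)"
        using A by (intro integrable_const_bound[of _ A]) auto
      have isq: "integrable M (\<lambda>x. (2 * (cmod (f n x))\<^sup>2 + 2 * (cmod (g x))\<^sup>2) / A)"
        using int intg2 by auto
      have "dist (\<integral>x. f n x \<partial>M) (\<integral>x. g x \<partial>M) = cmod (\<integral>x. f n x - g x \<partial>M)"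
        using intf intg by (simp add: dist_norm)
      also have "\<dots> \<le> (\<integral>x. cmod (f n x - g x) \<partial>M)" by (rule integral_norm_bound)
      also have "\<dots> \<le> (\<integral>x. min (cmod (f n x - g x)) A + (2 * (cmod (f n x))\<^sup>2 + 2 * (cmod (g x))\<^sup>2) / A \<partial>M)"
      proof (rule integral_mono)
        fix x
        define d where "d = cmod (f n x - g x)"
        have d: "d \<le> cmod (f n x) + cmod (g x)" "d \<ge> 0" unfolding d_def by (auto intro: norm_triangle_ineq4)
        have "d \<le> min d A + d\<^sup>2 / A"
        proof (cases "d \<le> A")
          case False
          have "d * A \<le> d * d" using False d by (intro mult_left_mono) auto
          hence "d \<le> d\<^sup>2 / A" using A by (simp add: field_simps power2_eq_square)
          thus ?thesis using False A by simp
        qed (use A in auto)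
        also have "d\<^sup>2 / A \<le> (2 * (cmod (f n x))\<^sup>2 + 2 * (cmod (g x))\<^sup>2) / A"
        proof (rule divide_right_mono)
          have "d\<^sup>2 \<le> (cmod (f n x) + cmod (g x))\<^sup>2" using d by (intro power_mono) auto
          thus "d\<^sup>2 \<le> 2 * (cmod (f n x))\<^sup>2 + 2 * (cmod (g x))\<^sup>2"
            using sum_squares_bound[of "cmod (f n x)" "cmod (g x)"] by (simp add: power2_sum)
        qed (use A in simp)
        finally show "cmod (f n x - g x) \<le> min (cmod (f n x - g x)) A + (2 * (cmod (f n x))\<^sup>2 + 2 * (cmod (g x))\<^sup>2) / A"
          by (simp add: d_def)
      qed (use intf intg imin isq in auto)
      also have "\<dots> = (\<integral>x. min (cmod (f n x - g x)) A \<partial>M) + (2 * (\<integral>x. (cmod (f n x))\<^sup>2 \<partial>M) + 2 * (\<integral>x. (cmod (g x))\<^sup>2 \<partial>M)) / A"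
        using imin isq int intg2 by simp
      also have "\<dots> \<le> (\<integral>x. min (cmod (f n x - g x)) A \<partial>M) + (2 * K + 2 * K) / A"
        using bound g2' A by (intro add_left_mono divide_right_mono add_mono mult_left_mono) auto
      also have "(2 * K + 2 * K) / A < e / 2" using e K by (simp add: A_def field_simps add_pos_nonneg)
      finally show ?case using elim by linarith
    qed
  qed
qed

text \<open>From \<open>ln n <= 4 * n powr (1/4)\<close>. The exponent -3/2 is summable and still
  saves \<open>m powr (-1/2)\<close> over a dyadic block starting at \<open>m\<close>, as needed for
  almost sure convergence.\<close>

lemma xp_square_le: "xp n ^ 2 \<le> 16 * real n powr (-3/2)"
proof (cases "n = 0")
  case False
  have "ln (real n) = 4 * ln (real n powr (1/4))" using False by (simp add: ln_powr)
  also have "\<dots> \<le> 4 * real n powr (1/4)"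
    using ln_le_minus_one[of "real n powr (1/4)"] False by simp
  finally have "ln (real n) ^ 2 \<le> (4 * real n powr (1/4)) ^ 2" using False by (intro power_mono) auto
  also have "\<dots> = 16 * real n powr (1/2)"
    using False by (simp add: power_mult_distrib powr_power)
  finally have "xp n ^ 2 \<le> 16 * real n powr (1/2) / real n ^ 2"
    unfolding xp_def power_divide by (intro divide_right_mono) auto
  also have "real n ^ 2 = real n powr 2" using False by simp
  also have "16 * real n powr (1/2) / real n powr 2 = 16 * (real n powr (1/2) / real n powr 2)" by simp
  also have "real n powr (1/2) / real n powr 2 = real n powr (-3/2)"
    by (subst powr_diff[symmetric]) simp
  finally show ?thesis .
qed (simp add: xp_def)

text \<open>The increments over the blocks \<open>{2^k m..2^(k+1) m}\<close> are dominated by a geometric series.\<close>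

lemma Cauchy_of_dyadic_increments:
  fixes s :: "nat \<Rightarrow> real"
  assumes "eventually (\<lambda>m. \<forall>n\<in>{m..2*m}. \<bar>s n - s m\<bar> \<le> real m powr (-1/8)) sequentially"
  shows "Cauchy s"
proof -
  obtain N0 where N0: "N0 \<ge> 1" "\<And>m n. m \<ge> N0 \<Longrightarrow> n \<in> {m..2*m} \<Longrightarrow> \<bar>s n - s m\<bar> \<le> real m powr (-1/8)"
  proof -
    from assms obtain N where "\<And>m. m \<ge> N \<Longrightarrow> \<forall>n\<in>{m..2*m}. \<bar>s n - s m\<bar> \<le> real m powr (-1/8)"
      by (auto simp: eventually_sequentially)
    thus ?thesis by (intro that[of "max 1 N"]) auto
  qed
  define \<rho> where "\<rho> = (2::real) powr (-1/8)"
  \<comment> \<open>Sum of the geometric series with ratio \<open>\<rho>\<close>, the solution of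
    \<open>1 + \<rho> * C = C\<close> that closes the induction.\<close>
  define C where "C = 1 / (1 - \<rho>)"
  have "\<rho> < 2 powr 0" unfolding \<rho>_def by (intro powr_less_mono) auto
  hence \<rho>: "\<rho> > 0" "\<rho> < 1" by (auto simp: \<rho>_def)
  have C: "C \<ge> 1" "1 + \<rho> * C = C" using \<rho> by (auto simp: C_def field_simps)
  have main: "\<bar>s n - s m\<bar> \<le> C * real m powr (-1/8)" if "N0 \<le> m" "m \<le> n" for m n
    using that
  proof (induction "n - m" arbitrary: m rule: less_induct)
    case (less m)
    show ?case
    proof (cases "n \<le> 2 * m")
      case True
      have "\<bar>s n - s m\<bar> \<le> 1 * real m powr (-1/8)" using N0(2)[of m n] less.prems True by simp
      also have "\<dots> \<le> C * real m powr (-1/8)" using C by (intro mult_right_mono) auto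
      finally show ?thesis .
    next
      case False
      have "\<bar>s n - s (2 * m)\<bar> \<le> C * real (2 * m) powr (-1/8)"
        using less.prems False N0(1) by (intro less.hyps) auto
      also have "real (2 * m) powr (-1/8) = \<rho> * real m powr (-1/8)"
        by (simp add: \<rho>_def powr_mult)
      finally have "\<bar>s n - s (2 * m)\<bar> \<le> (\<rho> * C) * real m powr (-1/8)" by (simp add: mult_ac)
      moreover have "\<bar>s (2 * m) - s m\<bar> \<le> real m powr (-1/8)" using N0(2)[of m "2 * m"] less.prems by simp
      ultimately have "\<bar>s n - s m\<bar> \<le> (1 + \<rho> * C) * real m powr (-1/8)"
        by (simp add: algebra_simps)
      thus ?thesis by (simp only: C)
    qed
  qed
  show ?thesis
  proof (rule CauchyI')
    fix e :: real assume e: "e > 0"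
    have "(\<lambda>m. C * real m powr (-1/8)) \<longlonglongrightarrow> 0" by real_asymp
    hence "eventually (\<lambda>m. C * real m powr (-1/8) < e) sequentially" using e by (intro order_tendstoD) auto
    then obtain N where N: "\<And>m. m \<ge> N \<Longrightarrow> C * real m powr (-1/8) < e" by (auto simp: eventually_sequentially)
    show "\<exists>M. \<forall>m\<ge>M. \<forall>n>m. dist (s m) (s n) < e"
    proof (intro exI[of _ "max N N0"] allI impI)
      fix m n assume "m \<ge> max N N0" "n > m"
      thus "dist (s m) (s n) < e" using main[of m n] N[of m] by (simp add: dist_real_def abs_minus_commute)
    qed
  qed
qed

section \<open>The random series and its almost sure convergence\<close>

text \<open>Both tails are instances, with \<open>u\<close> and \<open>v\<close> interchanged. Each
  \<open>Y p\<close> has mean \<open>q p * (u p - v p)\<close>, so \<open>uv_summable\<close> makes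
  the means absolutely summable although the jumps, of size \<open>xp p\<close>, are not; the rest
  of the convergence is due to independence.\<close>

locale prime_series = prob_space +
  fixes u v q :: "nat \<Rightarrow> real" and Y :: "nat \<Rightarrow> 'a \<Rightarrow> real" and c0 :: real
  assumes q: "1 / 3 \<le> q p" "q p \<le> 1 / 2"
    and not_prime: "\<not> prime p \<Longrightarrow> u p = 0" "\<not> prime p \<Longrightarrow> v p = 0"
    and u_bounds: "prime p \<Longrightarrow> 2 / 3 * xp p \<le> u p" "prime p \<Longrightarrow> u p \<le> 2 * xp p"
    and v_bounds: "prime p \<Longrightarrow> 2 / 3 * xp p \<le> v p" "prime p \<Longrightarrow> v p \<le> 2 * xp p"
    and uv_summable: "summable (\<lambda>p. \<bar>u p - v p\<bar>)"
    and indep: "indep_vars (\<lambda>_. borel) Y {p. prime p}"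
    and law: "prime p \<Longrightarrow> AE \<omega> in M. Y p \<omega> \<in> {u p, - v p, 0}"
      "prime p \<Longrightarrow> prob {\<omega> \<in> space M. Y p \<omega> = u p} = q p"
      "prime p \<Longrightarrow> prob {\<omega> \<in> space M. Y p \<omega> = - v p} = q p"
begin

lemma uv_nonneg: "u p \<ge> 0" "v p \<ge> 0"
  using u_bounds[of p] v_bounds[of p] not_prime[of p] xp_nonneg[of p] by (cases "prime p"; force)+

sublocale tp: three_point "q p" "u p" "v p" for p
  by unfold_locales (use q uv_nonneg in auto)

lemma mean_not_prime: "\<not> prime p \<Longrightarrow> tp.mean p r = 0"
  unfolding tp.mean_def by (simp add: not_prime)

lemma var_not_prime: "\<not> prime p \<Longrightarrow> tp.var p r = 0"
  by (subst tp.var_alt, subst mean_not_prime) (simp_all add: not_prime)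

lemma tp_not_prime: "\<not> prime p \<Longrightarrow> tp (q p) (u p) (v p) s = 1"
  by (simp add: tp_def not_prime)

lemma spread_le: "u p + v p \<le> 4 * xp p"
  using u_bounds[of p] v_bounds[of p] not_prime[of p] xp_nonneg[of p] by (cases "prime p") auto

lemma spread_ge: "prime p \<Longrightarrow> u p + v p \<ge> 4 / 3 * xp p"
  using u_bounds[of p] v_bounds[of p] by auto

lemma spread_square_le: "(u p + v p)\<^sup>2 \<le> 256 * real p powr (-3/2)"
proof -
  have "(u p + v p)\<^sup>2 \<le> (4 * xp p)\<^sup>2" using spread_le uv_nonneg by (intro power_mono) auto
  thus ?thesis using xp_square_le[of p] by (simp add: power_mult_distrib)
qed

lemma spread_square_summable: "summable (\<lambda>p. (u p + v p)\<^sup>2)"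
proof (rule summable_comparison_test')
  show "summable (\<lambda>p. 256 * real p powr (-3/2))"
    by (intro summable_mult) (simp add: summable_real_powr_iff)
qed (use spread_square_le in auto)

lemma mean_0_summable: "summable (\<lambda>p. \<bar>tp.mean p 0\<bar>)"
proof (rule summable_comparison_test'[OF uv_summable])
  fix p
  have "q p * \<bar>u p - v p\<bar> \<le> 1 * \<bar>u p - v p\<bar>" using q[of p] by (intro mult_right_mono) auto
  thus "norm \<bar>tp.mean p 0\<bar> \<le> \<bar>u p - v p\<bar>" using q[of p] by (simp add: tp.mean_0 abs_mult)
qed

lemma Y_measurable: "prime p \<Longrightarrow> random_variable borel (Y p)"
  using indep by (auto simp: indep_vars_def)

text \<open>Extension by 0 to all indices turns the sum over primes into an ordinary series, with
  the primes in increasing order as in \<open>gamma_rand\<close>.\<close>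

definition Z where "Z p \<omega> = (if prime p then Y p \<omega> else 0)"
definition S where "S n \<omega> = (\<Sum>p<n. Z p \<omega>)"
definition G where "G \<omega> = c0 + (\<Sum>p. Z p \<omega>)"

lemma Z_measurable [measurable]: "random_variable borel (Z p)"
  using Y_measurable[of p] by (cases "prime p") (auto simp: Z_def[abs_def])

lemma S_measurable [measurable]: "random_variable borel (S n)"
  unfolding S_def by measurable

lemma G_measurable [measurable]: "random_variable borel G"
  unfolding G_def by (intro borel_measurable_add borel_measurable_suminf) auto

lemma expectation_comp:
  fixes h :: "real \<Rightarrow> complex"
  assumes p: "prime p" and h [measurable]: "h \<in> borel_measurable borel"
  shows "integrable M (\<lambda>\<omega>. h (Y p \<omega>))"
    and "(\<integral>\<omega>. h (Y p \<omega>) \<partial>M) = of_real (q p) * h (u p) + of_real (q p) * h (- v p) + of_real (1 - 2 * q p) * h 0"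
proof -
  note [measurable] = Y_measurable[OF p]
  have uv: "u p > 0" "v p > 0" using u_bounds(1)[OF p] v_bounds(1)[OF p] xp_pos[OF p] by auto
  define A B where "A = {\<omega> \<in> space M. Y p \<omega> = u p}" and "B = {\<omega> \<in> space M. Y p \<omega> = - v p}"
  have [measurable]: "A \<in> events" "B \<in> events" unfolding A_def B_def by measurable
  let ?f = "\<lambda>\<omega>. h 0 + indicator A \<omega> *\<^sub>R (h (u p) - h 0) + indicator B \<omega> *\<^sub>R (h (- v p) - h 0)"
  have ae: "AE \<omega> in M. h (Y p \<omega>) = ?f \<omega>"
    using law(1)[OF p] AE_space by eventually_elim (use uv in \<open>auto simp: A_def B_def\<close>)
  have i: "integrable M ?f" by (auto simp: emeasure_eq_measure)
  show "integrable M (\<lambda>\<omega>. h (Y p \<omega>))"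
    using i by (subst integrable_cong_AE[OF _ _ ae]) auto
  have "(\<integral>\<omega>. h (Y p \<omega>) \<partial>M) = (\<integral>\<omega>. ?f \<omega> \<partial>M)"
    by (rule integral_cong_AE[OF _ _ ae]) auto
  also have "\<dots> = h 0 + prob A *\<^sub>R (h (u p) - h 0) + prob B *\<^sub>R (h (- v p) - h 0)"
    by (simp add: emeasure_eq_measure prob_space)
  finally have "(\<integral>\<omega>. h (Y p \<omega>) \<partial>M) = h 0 + prob A *\<^sub>R (h (u p) - h 0) + prob B *\<^sub>R (h (- v p) - h 0)" .
  moreover have "prob A = q p" "prob B = q p" using law[OF p] by (auto simp: A_def B_def)
  ultimately show "(\<integral>\<omega>. h (Y p \<omega>) \<partial>M) = of_real (q p) * h (u p) + of_real (q p) * h (- v p) + of_real (1 - 2 * q p) * h 0"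
    by (simp add: scaleR_conv_of_real algebra_simps)
qed

lemma expectation_Y:
  assumes p: "prime p"
  shows "expectation (Y p) = tp.mean p 0"
proof -
  have "complex_of_real (expectation (Y p)) = (\<integral>\<omega>. complex_of_real (Y p \<omega>) \<partial>M)" by simp
  also have "\<dots> = of_real (q p * u p - q p * v p)"
    by (subst expectation_comp(2)[OF p]) auto
  finally show ?thesis unfolding of_real_eq_iff by (simp add: tp.mean_0 algebra_simps)
qed

lemma expectation_exp_S:
  fixes s :: complex
  shows "integrable M (\<lambda>\<omega>. exp (s * of_real (S n \<omega>)))"
    and "(\<integral>\<omega>. exp (s * of_real (S n \<omega>)) \<partial>M) = (\<Prod>p<n. tp (q p) (u p) (v p) s)"
proof -
  define P where "P = {p. prime p \<and> p < n}"
  have fin: "finite P" unfolding P_def by auto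
  have eq: "exp (s * of_real (S n \<omega>)) = (\<Prod>p\<in>P. exp (s * of_real (Y p \<omega>)))" for \<omega>
  proof -
    have "S n \<omega> = (\<Sum>p\<in>P. Y p \<omega>)"
      unfolding S_def P_def Z_def by (subst sum.inter_filter[symmetric]) (auto intro!: sum.cong)
    thus ?thesis by (simp add: exp_sum fin sum_distrib_left)
  qed
  have ind: "indep_vars (\<lambda>_. borel) (\<lambda>p \<omega>. exp (s * complex_of_real (Y p \<omega>))) P"
    by (rule indep_vars_compose2[OF indep_vars_subset[OF indep]]) (auto simp: P_def)
  have i: "integrable M (\<lambda>\<omega>. exp (s * complex_of_real (Y p \<omega>)))" if "p \<in> P" for p
    using that by (intro expectation_comp(1)) (auto simp: P_def)
  show "integrable M (\<lambda>\<omega>. exp (s * of_real (S n \<omega>)))"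
    unfolding eq by (rule indep_vars_integrable[OF fin ind i])
  have "(\<integral>\<omega>. exp (s * of_real (S n \<omega>)) \<partial>M) = (\<Prod>p\<in>P. \<integral>\<omega>. exp (s * complex_of_real (Y p \<omega>)) \<partial>M)"
    unfolding eq by (rule indep_vars_lebesgue_integral[OF fin ind i])
  also have "\<dots> = (\<Prod>p\<in>P. tp (q p) (u p) (v p) s)"
    by (intro prod.cong refl, subst expectation_comp(2)) (auto simp: P_def tp_def)
  also have "\<dots> = (\<Prod>p<n. tp (q p) (u p) (v p) s)"
    by (rule prod.mono_neutral_left) (use tp_not_prime in \<open>auto simp: P_def\<close>)
  finally show "(\<integral>\<omega>. exp (s * of_real (S n \<omega>)) \<partial>M) = (\<Prod>p<n. tp (q p) (u p) (v p) s)" .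
qed

text \<open>Hoeffding's inequality. The squared ranges over the block add up to at most
  \<open>256 * m powr (-1/2)\<close>, so the deviation \<open>m powr (-1/8)\<close> produces an
  exponent below a negative multiple of \<open>m powr (1/4)\<close>. Any deviation exponent strictly
  between -1/4 and 0 would give a positive power of \<open>m\<close> here and a geometric series
  over dyadic blocks.\<close>

lemma block_deviation:
  assumes m: "m \<ge> 1" and n: "n \<in> {m..2*m}"
  defines "W \<equiv> (\<lambda>n \<omega>. \<Sum>p<n. Z p \<omega> - tp.mean p 0)"
  shows "prob {\<omega> \<in> space M. \<bar>W n \<omega> - W m \<omega>\<bar> \<ge> real m powr (-1/8)} \<le> 2 * exp (- (real m powr (1/4) / 256))"
proof -
  define I where "I = {p. prime p \<and> p \<in> {m..<n}}"
  have fin: "finite I" unfolding I_def by (rule finite_subset[of _ "{m..<n}"]) auto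
  interpret H: indep_interval_bounded_random_variables M I Y "\<lambda>p. - v p" u
  proof
    show "indep_vars (\<lambda>_. borel) Y I" by (rule indep_vars_subset[OF indep]) (auto simp: I_def)
    fix p assume "p \<in> I"
    hence "prime p" by (simp add: I_def)
    from law(1)[OF this] show "AE \<omega> in M. Y p \<omega> \<in> {- v p..u p}"
      by eventually_elim (use uv_nonneg[of p] in auto)
  qed (fact fin)
  interpret H: Hoeffding_ineq M I Y "\<lambda>p. - v p" u "\<Sum>p\<in>I. expectation (Y p)"
    by unfold_locales auto
  have W: "W n \<omega> - W m \<omega> = (\<Sum>p\<in>I. Y p \<omega>) - (\<Sum>p\<in>I. expectation (Y p))" for \<omega>
  proof -
    have "W n \<omega> - W m \<omega> = (\<Sum>p\<in>{m..<n}. Z p \<omega> - tp.mean p 0)"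
      unfolding W_def using n by (simp add: sum_diff_nat_ivl lessThan_atLeast0)
    also have "\<dots> = (\<Sum>p\<in>I. Y p \<omega> - expectation (Y p))"
      by (rule sum.mono_neutral_cong_right) (auto simp: I_def Z_def mean_not_prime expectation_Y)
    finally show ?thesis by (simp add: sum_subtractf)
  qed
  define D where "D = (\<Sum>p\<in>I. (u p - - v p)\<^sup>2)"
  have D: "D \<le> 256 * real m powr (-1/2)"
  proof -
    have "D \<le> (\<Sum>p\<in>{m..<n}. (u p + v p)\<^sup>2)" unfolding D_def by (simp add: I_def) (intro sum_mono2, auto)
    also have "\<dots> \<le> (\<Sum>p\<in>{m..<n}. 256 * real m powr (-3/2))"
    proof (rule sum_mono)
      fix p assume p: "p \<in> {m..<n}"
      have "real p powr (-3/2) \<le> real m powr (-3/2)" using p m by (intro powr_mono2') auto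
      thus "(u p + v p)\<^sup>2 \<le> 256 * real m powr (-3/2)" using spread_square_le[of p] by linarith
    qed
    also have "\<dots> \<le> real m * (256 * real m powr (-3/2))"
      using n by (simp add: mult_right_mono)
    also have "\<dots> = 256 * (real m powr 1 * real m powr (-3/2))" using m by simp
    also have "\<dots> = 256 * real m powr (-1/2)" by (subst powr_add[symmetric]) simp
    finally show ?thesis .
  qed
  show ?thesis
  proof (cases "D > 0")
    case True
    have "prob {\<omega> \<in> space M. \<bar>W n \<omega> - W m \<omega>\<bar> \<ge> real m powr (-1/8)} \<le> 2 * exp (-2 * (real m powr (-1/8))\<^sup>2 / D)"
      unfolding W D_def using True by (intro H.Hoeffding_ineq_abs_ge) (auto simp: D_def)
    also have "-2 * (real m powr (-1/8))\<^sup>2 / D \<le> - (real m powr (1/4) / 256)"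
    proof -
      have "real m powr (1/4) / 256 \<ge> 0" by simp
      moreover have "real m powr (1/4) / 256 = real m powr (-1/4) / (256 * real m powr (-1/2))"
      proof -
        have "real m powr (-1/4) / real m powr (-1/2) = real m powr (1/4)" by (subst powr_diff[symmetric]) simp
        thus ?thesis using m by (simp add: field_simps)
      qed
      moreover have "\<dots> \<le> real m powr (-1/4) / D" using True D m by (intro divide_left_mono) auto
      moreover have "real m powr (-1/4) / D = (real m powr (-1/8))\<^sup>2 / D" using m by (simp add: powr_power)
      ultimately have "real m powr (1/4) / 256 \<le> 2 * ((real m powr (-1/8))\<^sup>2 / D)" by linarith
      thus ?thesis by simp
    qed
    finally show ?thesis by simp
  next
    case False
    \<comment> \<open>Hoeffding's inequality needs a positive total range. A total of 0 means that
      the block contains no prime, and then the increment vanishes while the threshold is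
      positive.\<close>
    have "I = {}"
    proof (rule ccontr)
      assume "I \<noteq> {}"
      then obtain p where p: "p \<in> I" by blast
      have "(u p + v p)\<^sup>2 > 0" using p spread_ge[of p] xp_pos[of p] by (auto simp: I_def)
      hence "D > 0" unfolding D_def using p fin by (intro sum_pos2[of _ p]) auto
      thus False using False by simp
    qed
    hence "{\<omega> \<in> space M. \<bar>W n \<omega> - W m \<omega>\<bar> \<ge> real m powr (-1/8)} = {}" unfolding W using m by auto
    thus ?thesis by (simp only: measure_empty) simp
  qed
qed

text \<open>The bound of \<open>block_deviation\<close> is so small that its union over all
  \<open>n\<close> in \<open>{m..2*m}\<close> is still summable in \<open>m\<close>. Borel-Cantelli
  then makes the centred partial sums Cauchy by \<open>Cauchy_of_dyadic_increments\<close>, and the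
  summable means are added back.\<close>

lemma AE_S_tendsto: "AE \<omega> in M. (\<lambda>n. c0 + S n \<omega>) \<longlonglongrightarrow> G \<omega>"
proof -
  define W where "W = (\<lambda>n \<omega>. \<Sum>p<n. Z p \<omega> - tp.mean p 0)"
  have W_meas [measurable]: "random_variable borel (W n)" for n unfolding W_def by measurable
  define B where "B m n = {\<omega> \<in> space M. \<bar>W n \<omega> - W m \<omega>\<bar> \<ge> real m powr (-1/8)}" for m n
  define E where "E m = (\<Union>n\<in>{m..2*m}. B m n)" for m
  have B_meas [measurable]: "B m n \<in> events" for m n unfolding B_def by measurable
  have E_meas: "E m \<in> events" for m unfolding E_def by auto
  have "summable (\<lambda>m. prob (E m))"
  proof (rule summable_comparison_test')
    show "summable (\<lambda>m. real (m + 1) * (2 * exp (- (real m powr (1/4) / 256))))"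
    proof (rule summable_comparison_test_bigo)
      show "summable (\<lambda>m. norm (1 / real m ^ 2))" using inverse_power_summable[of 2, where 'a = real] by (simp add: inverse_eq_divide)
      show "(\<lambda>m. real (m + 1) * (2 * exp (- (real m powr (1/4) / 256)))) \<in> O(\<lambda>m. 1 / real m ^ 2)"
        by real_asymp
    qed
    fix m :: nat assume m: "m \<ge> 1"
    have "prob (E m) \<le> (\<Sum>n\<in>{m..2*m}. prob (B m n))"
      unfolding E_def by (intro finite_measure_subadditive_finite) auto
    also have "\<dots> \<le> (\<Sum>n\<in>{m..2*m}. 2 * exp (- (real m powr (1/4) / 256)))"
      unfolding B_def W_def using m by (intro sum_mono block_deviation) auto
    finally show "norm (prob (E m)) \<le> real (m + 1) * (2 * exp (- (real m powr (1/4) / 256)))" by simp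
  qed
  hence "AE \<omega> in M. eventually (\<lambda>m. \<omega> \<in> space M - E m) sequentially"
    using E_meas by (intro borel_cantelli_AE1) (auto simp: emeasure_eq_measure)
  thus ?thesis
  proof eventually_elim
    case (elim \<omega>)
    have "Cauchy (\<lambda>n. W n \<omega>)"
    proof (rule Cauchy_of_dyadic_increments)
      show "eventually (\<lambda>m. \<forall>n\<in>{m..2*m}. \<bar>W n \<omega> - W m \<omega>\<bar> \<le> real m powr (-1/8)) sequentially"
        using elim by eventually_elim (auto simp: E_def B_def not_le intro: less_imp_le)
    qed
    then obtain L where "(\<lambda>n. W n \<omega>) \<longlonglongrightarrow> L" by (auto simp: Cauchy_convergent_iff convergent_def)
    hence "summable (\<lambda>p. Z p \<omega> - tp.mean p 0)" by (auto simp: W_def summable_def sums_def)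
    from summable_add[OF this summable_rabs_cancel[OF mean_0_summable]]
    have "summable (\<lambda>p. Z p \<omega>)" by simp
    hence "(\<lambda>n. S n \<omega>) \<longlonglongrightarrow> (\<Sum>p. Z p \<omega>)" unfolding S_def by (rule summable_LIMSEQ)
    thus ?case unfolding G_def by (intro tendsto_intros)
  qed
qed

end

section \<open>The tilted characteristic function\<close>

text \<open>Telescoping after division by the weights keeps the decay of the factors in \<open>B\<close>.\<close>

lemma norm_prod_diff_weighted:
  fixes g e :: "'i \<Rightarrow> complex" and w :: "'i \<Rightarrow> real"
  assumes I: "finite I" "B \<subseteq> I"
    and le1: "\<And>i. i \<in> I \<Longrightarrow> cmod (g i) \<le> 1" "\<And>i. i \<in> I \<Longrightarrow> cmod (e i) \<le> 1"
    and lew: "\<And>i. i \<in> B \<Longrightarrow> cmod (g i) \<le> w i" "\<And>i. i \<in> B \<Longrightarrow> cmod (e i) \<le> w i"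
    and w: "\<And>i. i \<in> B \<Longrightarrow> 1 / 2 \<le> w i"
  shows "cmod ((\<Prod>i\<in>I. g i) - (\<Prod>i\<in>I. e i)) \<le> 2 * (\<Prod>i\<in>B. w i) * (\<Sum>i\<in>I. cmod (g i - e i))"
proof -
  define W where "W i = (if i \<in> B then w i else 1)" for i
  have W: "1 / 2 \<le> W i" for i using w by (auto simp: W_def)
  hence W0: "W i > 0" for i using less_le_trans[of 0 "1/2" "W i"] by simp
  have prodW: "(\<Prod>i\<in>I. W i) = (\<Prod>i\<in>B. w i)"
    using I by (intro prod.mono_neutral_cong_right) (auto simp: W_def)
  have eq: "(\<Prod>i\<in>I. h i) = of_real (\<Prod>i\<in>I. W i) * (\<Prod>i\<in>I. h i / of_real (W i))" for h :: "'i \<Rightarrow> complex"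
  proof -
    have "of_real (\<Prod>i\<in>I. W i) * (\<Prod>i\<in>I. h i / of_real (W i)) = (\<Prod>i\<in>I. of_real (W i) * (h i / of_real (W i)))"
      by (simp only: of_real_prod prod.distrib)
    also have "\<dots> = (\<Prod>i\<in>I. h i)" using W0 by (intro prod.cong refl) (simp add: less_imp_neq[OF W0, symmetric])
    finally show ?thesis ..
  qed
  have le: "cmod (h i / of_real (W i)) \<le> 1" if "i \<in> I" "cmod (h i) \<le> 1" "i \<in> B \<Longrightarrow> cmod (h i) \<le> w i" for h i
    using that W0[of i] by (auto simp: norm_divide W_def divide_le_eq)
  have "cmod ((\<Prod>i\<in>I. g i) - (\<Prod>i\<in>I. e i)) =
      (\<Prod>i\<in>B. w i) * cmod ((\<Prod>i\<in>I. g i / of_real (W i)) - (\<Prod>i\<in>I. e i / of_real (W i)))"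
  proof -
    have "(\<Prod>i\<in>I. W i) \<ge> 0" using W0 by (intro prod_nonneg) (auto intro: less_imp_le)
    thus ?thesis unfolding eq[of g] eq[of e] right_diff_distrib[symmetric] norm_mult norm_of_real by (simp add: prodW)
  qed
  also have "\<dots> \<le> (\<Prod>i\<in>B. w i) * (\<Sum>i\<in>I. cmod (g i / of_real (W i) - e i / of_real (W i)))"
    by (intro mult_left_mono norm_prod_diff le prod_nonneg) (use le1 lew w in \<open>auto intro: order_trans[of 0 "1/2"]\<close>)
  also have "\<dots> \<le> (\<Prod>i\<in>B. w i) * (\<Sum>i\<in>I. 2 * cmod (g i - e i))"
  proof (intro mult_left_mono sum_mono)
    fix i assume "i \<in> I"
    have "cmod (g i / of_real (W i) - e i / of_real (W i)) = cmod (g i - e i) / W i"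
      using W0[of i] by (simp add: norm_divide flip: diff_divide_distrib)
    \<comment> \<open>Telescoping leaves one divided difference in each term, so undoing the
      division costs a factor 2 only once; this is the purpose of
      \<open>1 / 2 \<le> w i\<close>.\<close>
    also have "\<dots> \<le> cmod (g i - e i) / (1/2)" using W[of i] by (intro divide_left_mono) auto
    finally show "cmod (g i / of_real (W i) - e i / of_real (W i)) \<le> 2 * cmod (g i - e i)" by simp
  qed (use w in \<open>auto intro!: prod_nonneg intro: order_trans[of 0 "1/2"]\<close>)
  finally show ?thesis by (simp add: sum_distrib_left mult_ac)
qed

context prime_series
begin

section \<open>The logarithmic Laplace transform and its derivatives\<close>

text \<open>Mean value bound from \<open>var_le\<close>. With the summable means at 0 it dominates
  the series of \<open>mean\<close> and of \<open>ln tp\<close> on bounded sets.\<close>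

lemma mean_diff_le: "\<bar>tp.mean p r - tp.mean p 0\<bar> \<le> (u p + v p)\<^sup>2 * \<bar>r\<bar>"
proof -
  have "norm (tp.mean p r - tp.mean p 0) \<le> (u p + v p)\<^sup>2 * norm (r - 0)"
  proof (rule field_differentiable_bound[where S = UNIV and f' = "tp.var p"])
    show "(tp.mean p has_field_derivative tp.var p z) (at z within UNIV)" for z
      using tp.mean_deriv[of p z] by simp
    show "norm (tp.var p z) \<le> (u p + v p)\<^sup>2" for z using tp.var_le[of p z] tp.var_nonneg[of p z] by simp
  qed auto
  thus ?thesis by simp
qed

lemma ln_tp_le: "\<bar>ln (tp (q p) (u p) (v p) r)\<bar> \<le> (\<bar>tp.mean p 0\<bar> + (u p + v p)\<^sup>2 * \<bar>r\<bar>) * \<bar>r\<bar>" for r :: real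
proof -
  have "norm (ln (tp (q p) (u p) (v p) r) - ln (tp (q p) (u p) (v p) (0 :: real)))
     \<le> (\<bar>tp.mean p 0\<bar> + (u p + v p)\<^sup>2 * \<bar>r\<bar>) * norm (r - 0)"
  proof (rule field_differentiable_bound[where S = "{-\<bar>r\<bar>..\<bar>r\<bar>}" and f' = "tp.mean p"])
    show "((\<lambda>r. ln (tp (q p) (u p) (v p) r)) has_field_derivative tp.mean p z) (at z within {-\<bar>r\<bar>..\<bar>r\<bar>})" for z
      using tp.ln_tp_deriv[of p z] by (rule has_field_derivative_at_within)
    fix z assume "z \<in> {-\<bar>r\<bar>..\<bar>r\<bar>}"
    hence "(u p + v p)\<^sup>2 * \<bar>z\<bar> \<le> (u p + v p)\<^sup>2 * \<bar>r\<bar>" by (intro mult_left_mono) auto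
    thus "norm (tp.mean p z) \<le> \<bar>tp.mean p 0\<bar> + (u p + v p)\<^sup>2 * \<bar>r\<bar>" using mean_diff_le[of p z] by simp
  qed auto
  thus ?thesis by (simp add: tp_def[of _ _ _ 0])
qed

lemma mean_summable: "summable (\<lambda>p. tp.mean p r)"
proof (rule summable_comparison_test')
  show "summable (\<lambda>p. \<bar>tp.mean p 0\<bar> + (u p + v p)\<^sup>2 * \<bar>r\<bar>)"
    by (intro summable_add summable_mult2 mean_0_summable spread_square_summable)
  show "norm (tp.mean p r) \<le> \<bar>tp.mean p 0\<bar> + (u p + v p)\<^sup>2 * \<bar>r\<bar>" for p
    using mean_diff_le[of p r] by simp
qed

lemma ln_tp_abs_summable: "summable (\<lambda>p. \<bar>ln (tp (q p) (u p) (v p) r)\<bar>)" for r :: real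
proof (rule summable_comparison_test')
  show "summable (\<lambda>p. (\<bar>tp.mean p 0\<bar> + (u p + v p)\<^sup>2 * \<bar>r\<bar>) * \<bar>r\<bar>)"
    by (intro summable_add summable_mult2 mean_0_summable spread_square_summable)
qed (use ln_tp_le in auto)

lemma ln_tp_summable: "summable (\<lambda>p. ln (tp (q p) (u p) (v p) r))" for r :: real
  by (rule summable_rabs_cancel[OF ln_tp_abs_summable])

lemma var_summable: "summable (\<lambda>p. tp.var p r)"
  by (rule summable_comparison_test'[OF spread_square_summable]) (simp add: tp.var_le tp.var_nonneg)

definition LL where "LL r = c0 * r + (\<Sum>p. ln (tp (q p) (u p) (v p) r))" for r :: real
definition LL1 where "LL1 r = c0 + (\<Sum>p. tp.mean p r)"
definition LL2 where "LL2 r = (\<Sum>p. tp.var p r)"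

lemma LL_deriv: "(LL has_real_derivative LL1 r) (at r)"
proof -
  define R where "R = \<bar>r\<bar> + 1"
  have "((\<lambda>r. \<Sum>p. ln (tp (q p) (u p) (v p) r)) has_field_derivative (\<Sum>p. tp.mean p r)) (at r)"
  proof (rule has_field_derivative_series'(2)[of "{-R..R}"])
    show "uniformly_convergent_on {-R..R} (\<lambda>n x. \<Sum>i<n. tp.mean i x)"
    proof (rule Weierstrass_m_test')
      show "summable (\<lambda>p. \<bar>tp.mean p 0\<bar> + (u p + v p)\<^sup>2 * R)"
        by (intro summable_add summable_mult2 mean_0_summable spread_square_summable)
      fix p x assume x: "x \<in> {-R..R}"
      have "(u p + v p)\<^sup>2 * \<bar>x\<bar> \<le> (u p + v p)\<^sup>2 * R" using x by (intro mult_left_mono) auto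
      thus "norm (tp.mean p x) \<le> \<bar>tp.mean p 0\<bar> + (u p + v p)\<^sup>2 * R" using mean_diff_le[of p x] by simp
    qed
    show "r \<in> interior {-R..R}" unfolding interior_atLeastAtMost_real by (auto simp: R_def)
    show "(0::real) \<in> {-R..R}" by (auto simp: R_def)
    show "((\<lambda>r. ln (tp (q p) (u p) (v p) r)) has_field_derivative tp.mean p x) (at x within {-R..R})" for p x
      using tp.ln_tp_deriv[of p x] by (rule has_field_derivative_at_within)
  qed (auto intro: ln_tp_summable)
  thus ?thesis unfolding LL_def[abs_def] LL1_def by (auto intro!: derivative_eq_intros)
qed

lemma LL1_deriv: "(LL1 has_real_derivative LL2 r) (at r)"
proof -
  have "((\<lambda>r. \<Sum>p. tp.mean p r) has_field_derivative (\<Sum>p. tp.var p r)) (at r)"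
  proof (rule has_field_derivative_series'(2)[of UNIV])
    show "uniformly_convergent_on UNIV (\<lambda>n x. \<Sum>i<n. tp.var i x)"
      by (rule Weierstrass_m_test'[OF _ spread_square_summable]) (simp add: tp.var_le tp.var_nonneg)
    show "(tp.mean p has_field_derivative tp.var p x) (at x within UNIV)" for p x
      using tp.mean_deriv[of p x] by simp
  qed (auto intro: mean_summable)
  thus ?thesis unfolding LL1_def[abs_def] LL2_def by (auto intro!: derivative_eq_intros)
qed

lemma LL2_pos: "LL2 r > 0"
  unfolding LL2_def
proof (rule suminf_pos2[OF var_summable])
  show "tp.var 2 r > 0" using u_bounds(1)[of 2] xp_pos[of 2] by (intro tp.var_pos) auto
qed (rule tp.var_nonneg)

lemma prod_tp_eq: "(\<Prod>p<n. tp (q p) (u p) (v p) r) = exp (\<Sum>p<n. ln (tp (q p) (u p) (v p) r))" for r :: real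
  by (simp add: exp_sum tp.tp_pos)

text \<open>The exponentials of the partial sums converge almost surely. Their squared moduli are
  exponentials at the real argument \<open>2 * Re s\<close>, so the second moments are products of
  values of \<open>tp\<close> there, bounded because the logarithms form an absolutely convergent
  series. Hence limit and expectation may be exchanged.\<close>

lemma exp_moment:
  fixes s :: complex
  shows "integrable M (\<lambda>\<omega>. exp (s * of_real (G \<omega>)))"
    and "(\<lambda>n. exp (s * of_real c0) * (\<Prod>p<n. tp (q p) (u p) (v p) s)) \<longlonglongrightarrow> (\<integral>\<omega>. exp (s * of_real (G \<omega>)) \<partial>M)"
proof -
  define f where "f n \<omega> = exp (s * of_real (c0 + S n \<omega>))" for n \<omega>
  define K where "K = exp (2 * Re s * c0) * exp (\<Sum>p. \<bar>ln (tp (q p) (u p) (v p) (2 * Re s))\<bar>)"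
  have f_sq: "(cmod (f n \<omega>))\<^sup>2 = Re (of_real (exp (2 * Re s * c0)) * exp (of_real (2 * Re s) * of_real (S n \<omega>)))" for n \<omega>
  proof -
    have "(cmod (f n \<omega>))\<^sup>2 = exp (2 * Re s * c0 + 2 * Re s * S n \<omega>)"
      by (simp add: f_def power2_eq_square algebra_simps flip: exp_add)
    thus ?thesis by (simp add: exp_add Re_exp)
  qed
  have f_eq: "f n \<omega> = exp (s * of_real c0) * exp (s * of_real (S n \<omega>))" for n \<omega>
    by (simp add: f_def algebra_simps exp_add)
  have int: "integrable M (\<lambda>\<omega>. of_real (exp (2 * Re s * c0)) * exp (complex_of_real (2 * Re s) * of_real (S n \<omega>)))" for n
    by (intro integrable_mult_right expectation_exp_S)
  have bound: "(\<integral>\<omega>. (cmod (f n \<omega>))\<^sup>2 \<partial>M) \<le> K" for n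
  proof -
    have "(\<integral>\<omega>. (cmod (f n \<omega>))\<^sup>2 \<partial>M) = Re (\<integral>\<omega>. of_real (exp (2 * Re s * c0)) * exp (complex_of_real (2 * Re s) * of_real (S n \<omega>)) \<partial>M)"
      unfolding f_sq by (rule integral_Re[OF int])
    also have "\<dots> = Re (of_real (exp (2 * Re s * c0)) * (\<Prod>p<n. tp (q p) (u p) (v p) (complex_of_real (2 * Re s))))"
      by (simp only: integral_mult_right_zero expectation_exp_S)
    also have "\<dots> = exp (2 * Re s * c0) * (\<Prod>p<n. tp (q p) (u p) (v p) (2 * Re s))"
      unfolding tp_of_real of_real_prod[symmetric] of_real_mult[symmetric] by (rule Re_complex_of_real)
    also have "\<dots> \<le> K"
      unfolding prod_tp_eq K_def
    proof (intro mult_left_mono iffD2[OF exp_le_cancel_iff])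
      have "(\<Sum>p<n. ln (tp (q p) (u p) (v p) (2 * Re s))) \<le> (\<Sum>p<n. \<bar>ln (tp (q p) (u p) (v p) (2 * Re s))\<bar>)"
        by (intro sum_mono) auto
      also have "\<dots> \<le> (\<Sum>p. \<bar>ln (tp (q p) (u p) (v p) (2 * Re s))\<bar>)"
        by (intro sum_le_suminf ln_tp_abs_summable) auto
      finally show "(\<Sum>p<n. ln (tp (q p) (u p) (v p) (2 * Re s))) \<le> (\<Sum>p. \<bar>ln (tp (q p) (u p) (v p) (2 * Re s))\<bar>)" .
    qed auto
    finally show ?thesis .
  qed
  have lim: "AE \<omega> in M. (\<lambda>n. f n \<omega>) \<longlonglongrightarrow> exp (s * of_real (G \<omega>))"
    using AE_S_tendsto by eventually_elim (auto simp: f_def simp del: of_real_add intro!: tendsto_exp tendsto_mult tendsto_const tendsto_of_real)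
  have meas [measurable]: "f n \<in> borel_measurable M" "(\<lambda>\<omega>. exp (s * of_real (G \<omega>))) \<in> borel_measurable M" for n
    unfolding f_def by measurable
  have int2: "integrable M (\<lambda>\<omega>. (cmod (f n \<omega>))\<^sup>2)" for n
    unfolding f_sq by (rule integrable_Re[OF int])
  note * = tendsto_integral_of_bounded_second_moments[OF prob_space_axioms meas lim int2 bound]
  show "integrable M (\<lambda>\<omega>. exp (s * of_real (G \<omega>)))" by (rule *)
  have "(\<integral>\<omega>. f n \<omega> \<partial>M) = exp (s * of_real c0) * (\<Prod>p<n. tp (q p) (u p) (v p) s)" for n
    unfolding f_eq by (simp only: integral_mult_right_zero expectation_exp_S)
  with *(2) show "(\<lambda>n. exp (s * of_real c0) * (\<Prod>p<n. tp (q p) (u p) (v p) s)) \<longlonglongrightarrow> (\<integral>\<omega>. exp (s * of_real (G \<omega>)) \<partial>M)"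
    by simp
qed

lemma Laplace_eq: "(\<integral>\<omega>. exp (complex_of_real r * of_real (G \<omega>)) \<partial>M) = of_real (exp (LL r))"
proof (rule LIMSEQ_unique[OF exp_moment(2)])
  have "(\<lambda>n. exp (r * c0) * (\<Prod>p<n. tp (q p) (u p) (v p) r)) \<longlonglongrightarrow> exp (r * c0) * exp (\<Sum>p. ln (tp (q p) (u p) (v p) r))"
    unfolding prod_tp_eq by (intro tendsto_intros summable_LIMSEQ ln_tp_summable)
  also have "exp (r * c0) * exp (\<Sum>p. ln (tp (q p) (u p) (v p) r)) = exp (LL r)"
    by (simp add: LL_def exp_add mult_ac)
  finally have "(\<lambda>n. complex_of_real (exp (r * c0) * (\<Prod>p<n. tp (q p) (u p) (v p) r))) \<longlonglongrightarrow> of_real (exp (LL r))"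
    by (rule tendsto_of_real)
  thus "(\<lambda>n. exp (complex_of_real r * of_real c0) * (\<Prod>p<n. tp (q p) (u p) (v p) (complex_of_real r))) \<longlonglongrightarrow> of_real (exp (LL r))"
    by (simp add: tp_of_real exp_of_real[symmetric])
qed

text \<open>Characteristic function of \<open>G - LL1 r\<close> under the tilted law, identified as
  such in \<open>char_tilted\<close>. Written through a complex exponential moment, it is accessible
  as a limit of products of the centred factors \<open>ch\<close>.\<close>

definition tilted_char where
  "tilted_char r y = (\<integral>\<omega>. exp (Complex r y * of_real (G \<omega>)) \<partial>M) / of_real (exp (LL r)) * iexp (- y * LL1 r)"

lemma tilted_char_lim: "(\<lambda>n. \<Prod>p<n. tp.ch p r y) \<longlonglongrightarrow> tilted_char r y"
proof -
  define a where "a n = exp (Complex r y * of_real c0) * (\<Prod>p<n. tp (q p) (u p) (v p) (Complex r y))" for n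
  define b where "b n = exp (complex_of_real r * of_real c0) * (\<Prod>p<n. tp (q p) (u p) (v p) (complex_of_real r))" for n
  define m where "m n = c0 + (\<Sum>p<n. tp.mean p r)" for n
  have C: "Complex r y = of_real r + \<i> * of_real y" by (simp add: complex_eq_iff)
  have e: "exp (complex_of_real c0 * of_real r + of_real c0 * (\<i> * of_real y)) = exp (of_real c0 * of_real r) * iexp (y * c0)"
    by (simp add: exp_add mult_ac)
  have "(\<Prod>p<n. tp.ch p r y) = a n / b n * iexp (- y * m n)" for n
  proof -
    have prod_iexp: "(\<Prod>p<n. iexp (- y * tp.mean p r)) = iexp (- y * (\<Sum>p<n. tp.mean p r))"
      by (subst exp_sum[symmetric]) (simp_all add: sum_distrib_left sum_negf)
    have rearrange: "(A * P) / (B * Q) * (E0 * E1) = (A / B * E0) * (P / Q * E1)" for A P B Q E0 E1 :: complex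
      by (simp add: divide_simps)
    have "(\<Prod>p<n. tp.ch p r y) = (\<Prod>p<n. tp (q p) (u p) (v p) (Complex r y)) / (\<Prod>p<n. tp (q p) (u p) (v p) (complex_of_real r))
        * iexp (- y * (\<Sum>p<n. tp.mean p r))"
      unfolding tp.ch_def tp_of_real prod.distrib prod_dividef prod_iexp ..
    moreover have "exp (Complex r y * of_real c0) / exp (complex_of_real r * of_real c0) * iexp (- y * c0) = 1"
      unfolding C by (simp add: distrib_right exp_add exp_minus field_simps)
    moreover have "iexp (- y * m n) = iexp (- y * c0) * iexp (- y * (\<Sum>p<n. tp.mean p r))"
      by (simp add: m_def algebra_simps flip: exp_add)
    ultimately show ?thesis unfolding a_def b_def by (simp only: rearrange mult_1_left)
  qed
  moreover have "(\<lambda>n. a n / b n * iexp (- y * m n)) \<longlonglongrightarrow> tilted_char r y"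
    unfolding tilted_char_def
  proof (intro tendsto_intros)
    show "a \<longlonglongrightarrow> (\<integral>\<omega>. exp (Complex r y * of_real (G \<omega>)) \<partial>M)" unfolding a_def by (rule exp_moment)
    show "b \<longlonglongrightarrow> of_real (exp (LL r))"
      unfolding b_def using exp_moment(2)[of "complex_of_real r"] by (simp only: Laplace_eq)
    show "m \<longlonglongrightarrow> LL1 r" unfolding m_def LL1_def by (intro tendsto_intros summable_LIMSEQ mean_summable)
  qed auto
  ultimately show ?thesis by simp
qed

section \<open>Size of the variance and decay of the characteristic function\<close>

text \<open>\<open>var_le_exp\<close> gives at most
  \<open>32 * xp p ^ 2 * exp (- (2/3) * r * xp p)\<close> for each prime, so both sums reduce to
  \<open>sum_xp_square_exp_le\<close> with \<open>a = 1/3\<close>. In the second one the spare part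
  of the exponent absorbs the factor \<open>u p + v p <= 4 * xp p\<close>, through
  \<open>x * exp (- r * x / 3) <= 3 / r\<close>.\<close>

lemma sum_var_le:
  "\<exists>C>0. \<forall>r\<ge>100. LL2 r \<le> C / r \<and> (\<forall>n. (\<Sum>p<n. (u p + v p) * tp.var p r) \<le> C / r\<^sup>2)"
proof -
  obtain C1 where C1: "C1 > 0" "\<And>L A. L \<ge> 100 \<Longrightarrow> finite A \<Longrightarrow> \<forall>p\<in>A. prime p \<Longrightarrow>
      (\<Sum>p\<in>A. xp p ^ 2 * exp (- (1/3) * L * xp p)) \<le> C1 / L"
    using sum_xp_square_exp_le[of "1/3"] by auto
  have var: "tp.var p r \<le> 32 * (xp p ^ 2 * exp (- (2/3) * r * xp p))" if "prime p" "r \<ge> 0" for p r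
  proof -
    have "tp.var p r \<le> 2 * (u p + v p)\<^sup>2 * exp (- r * u p)" by (rule tp.var_le_exp[OF that(2)])
    also have "\<dots> \<le> 2 * (4 * xp p)\<^sup>2 * exp (- (2/3) * r * xp p)"
    proof (intro mult_mono power_mono)
      have "r * (2/3 * xp p) \<le> r * u p" using that u_bounds(1) by (intro mult_left_mono) auto
      thus "exp (- r * u p) \<le> exp (- (2/3) * r * xp p)" by simp
    qed (use spread_le uv_nonneg in auto)
    finally show ?thesis by (simp add: power_mult_distrib)
  qed
  have 1: "LL2 r \<le> 32 * C1 / r" if r: "r \<ge> 100" for r
    unfolding LL2_def
  proof (rule suminf_le_const[OF var_summable])
    fix n
    have "(\<Sum>p<n. tp.var p r) = (\<Sum>p | prime p \<and> p < n. tp.var p r)"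
      by (rule sum.mono_neutral_right) (use var_not_prime in auto)
    also have "\<dots> \<le> (\<Sum>p | prime p \<and> p < n. 32 * (xp p ^ 2 * exp (- (1/3) * r * xp p)))"
    proof (intro sum_mono)
      fix p assume "p \<in> {p. prime p \<and> p < n}"
      hence "tp.var p r \<le> 32 * (xp p ^ 2 * exp (- (2/3) * r * xp p))" using r by (intro var) auto
      also have "\<dots> \<le> 32 * (xp p ^ 2 * exp (- (1/3) * r * xp p))"
        using r xp_nonneg[of p] by (intro mult_left_mono) auto
      finally show "tp.var p r \<le> 32 * (xp p ^ 2 * exp (- (1/3) * r * xp p))" .
    qed
    also have "\<dots> = 32 * (\<Sum>p | prime p \<and> p < n. xp p ^ 2 * exp (- (1/3) * r * xp p))"
      by (simp add: sum_distrib_left)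
    also have "\<dots> \<le> 32 * (C1 / r)" using r by (intro mult_left_mono C1) auto
    finally show "(\<Sum>p<n. tp.var p r) \<le> 32 * C1 / r" by simp
  qed
  have 2: "(\<Sum>p<n. (u p + v p) * tp.var p r) \<le> 384 * C1 / r\<^sup>2" if r: "r \<ge> 100" for r n
  proof -
    have "(\<Sum>p<n. (u p + v p) * tp.var p r) = (\<Sum>p | prime p \<and> p < n. (u p + v p) * tp.var p r)"
      by (rule sum.mono_neutral_right) (use var_not_prime in auto)
    also have "\<dots> \<le> (\<Sum>p | prime p \<and> p < n. 384 / r * (xp p ^ 2 * exp (- (1/3) * r * xp p)))"
    proof (intro sum_mono)
      fix p assume p: "p \<in> {p. prime p \<and> p < n}"
      define x where "x = xp p"
      have x: "x \<ge> 0" by (simp add: x_def xp_nonneg)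
      have "1/3 * r * x \<le> exp (1/3 * r * x)" using exp_ge_add_one_self[of "1/3 * r * x"] by linarith
      hence "x * exp (- (1/3) * r * x) \<le> 3 / r" using r by (simp add: exp_minus field_simps)
      hence le: "(x * exp (- (1/3) * r * x)) * (x ^ 2 * exp (- (1/3) * r * x)) \<le> 3 / r * (x ^ 2 * exp (- (1/3) * r * x))"
        by (intro mult_right_mono) auto
      have "(u p + v p) * tp.var p r \<le> (4 * x) * (32 * (x ^ 2 * exp (- (2/3) * r * x)))"
        unfolding x_def using p r xp_nonneg[of p] by (intro mult_mono var spread_le tp.var_nonneg) auto
      also have "exp (- (2/3) * r * x) = exp (- (1/3) * r * x) * exp (- (1/3) * r * x)"
        by (simp flip: exp_add)
      also have "4 * x * (32 * (x ^ 2 * (exp (- (1/3) * r * x) * exp (- (1/3) * r * x))))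
          = 128 * ((x * exp (- (1/3) * r * x)) * (x ^ 2 * exp (- (1/3) * r * x)))" by (simp add: mult_ac)
      also have "\<dots> \<le> 128 * (3 / r * (x ^ 2 * exp (- (1/3) * r * x)))" using le by (intro mult_left_mono) auto
      finally show "(u p + v p) * tp.var p r \<le> 384 / r * (xp p ^ 2 * exp (- (1/3) * r * xp p))"
        by (simp add: x_def)
    qed
    also have "\<dots> = 384 / r * (\<Sum>p | prime p \<and> p < n. xp p ^ 2 * exp (- (1/3) * r * xp p))"
      by (simp only: sum_distrib_left)
    also have "\<dots> \<le> 384 / r * (C1 / r)" using r by (intro mult_left_mono C1) auto
    finally show ?thesis by (simp add: power2_eq_square)
  qed
  show ?thesis
  proof (intro exI[of _ "384 * C1"] conjI allI impI)
    fix r :: real assume r: "r \<ge> 100"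
    have "32 * C1 / r \<le> 384 * C1 / r" using r C1 by (intro divide_right_mono) auto
    thus "LL2 r \<le> 384 * C1 / r" using 1[OF r] by linarith
    show "(\<Sum>p<n. (u p + v p) * tp.var p r) \<le> 384 * C1 / r\<^sup>2" for n using 2[OF r] .
  qed (use C1 in auto)
qed

text \<open>Primes with \<open>(r + |y|) ln p / p\<close> small carry the Gaussian decay of the tilted characteristic function.\<close>

lemma ex_decay_primes:
  "\<exists>c>0. \<exists>R>0. \<forall>r\<ge>R. \<forall>y. \<exists>B. finite B \<and> (\<forall>p\<in>B. prime p \<and> (r + \<bar>y\<bar>) * (u p + v p) \<le> 1) \<and>
     (\<Sum>p\<in>B. (u p + v p)\<^sup>2) \<ge> c / (r + \<bar>y\<bar>)"
proof -
  \<comment> \<open>The scale 1/4 compensates \<open>u p + v p <= 4 * xp p\<close>.\<close>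
  obtain c L0 where c: "c > 0" and L0: "L0 > 0" and B: "\<And>L. L \<ge> L0 \<Longrightarrow>
      \<exists>B. finite B \<and> (\<forall>p\<in>B. prime p \<and> L * xp p \<le> 1/4) \<and> (\<Sum>p\<in>B. xp p ^ 2) \<ge> c / L"
    using ex_primes_xp_square_sum_ge[of "1/4"] by auto
  have "\<exists>B. finite B \<and> (\<forall>p\<in>B. prime p \<and> (r + \<bar>y\<bar>) * (u p + v p) \<le> 1) \<and>
     (\<Sum>p\<in>B. (u p + v p)\<^sup>2) \<ge> c / (r + \<bar>y\<bar>)" if r: "r \<ge> L0" for r y
  proof -
    obtain B where B: "finite B" "\<forall>p\<in>B. prime p \<and> (r + \<bar>y\<bar>) * xp p \<le> 1/4" "(\<Sum>p\<in>B. xp p ^ 2) \<ge> c / (r + \<bar>y\<bar>)"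
      using B[of "r + \<bar>y\<bar>"] r by force
    have "(r + \<bar>y\<bar>) * (u p + v p) \<le> 1" if "p \<in> B" for p
    proof -
      have "(r + \<bar>y\<bar>) * (u p + v p) \<le> (r + \<bar>y\<bar>) * (4 * xp p)" using r L0 by (intro mult_left_mono spread_le) auto
      also have "\<dots> = 4 * ((r + \<bar>y\<bar>) * xp p)" by simp
      also have "\<dots> \<le> 4 * (1/4)" using B(2) that by (intro mult_left_mono) auto
      finally show ?thesis by simp
    qed
    moreover have "(\<Sum>p\<in>B. xp p ^ 2) \<le> (\<Sum>p\<in>B. (u p + v p)\<^sup>2)"
    proof (intro sum_mono power_mono)
      fix p assume "p \<in> B"
      thus "xp p \<le> u p + v p" using spread_ge[of p] xp_nonneg[of p] B(2) by force
    qed (rule xp_nonneg)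
    ultimately show ?thesis using B by (intro exI[of _ B]) auto
  qed
  thus ?thesis using c L0 by blast
qed

text \<open>The case \<open>y = 0\<close> of \<open>ex_decay_primes\<close>: on those primes the
  tilt is bounded, and \<open>var_ge\<close> makes the variance comparable with the squared
  spread.\<close>

lemma LL2_ge: "\<exists>c>0. \<exists>R>0. \<forall>r\<ge>R. LL2 r \<ge> c / r"
proof -
  obtain c R where c: "c > 0" and R: "R > 0" and decay: "\<forall>r\<ge>R. \<forall>y. \<exists>B. finite B \<and>
      (\<forall>p\<in>B. prime p \<and> (r + \<bar>y\<bar>) * (u p + v p) \<le> 1) \<and> (\<Sum>p\<in>B. (u p + v p)\<^sup>2) \<ge> c / (r + \<bar>y\<bar>)"
    using ex_decay_primes by (elim exE conjE) (rule that)
  note B = decay[rule_format]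
  have "LL2 r \<ge> exp (-3) / 9 * c / r" if r: "r \<ge> R" for r
  proof -
    obtain B where B: "finite B" "\<forall>p\<in>B. prime p \<and> r * (u p + v p) \<le> 1" "(\<Sum>p\<in>B. (u p + v p)\<^sup>2) \<ge> c / r"
      using B[OF r, of 0] by auto
    have "exp (-3) / 9 * c / r = exp (-3) / 9 * (c / r)" by simp
    also have "\<dots> \<le> exp (-3) / 9 * (\<Sum>p\<in>B. (u p + v p)\<^sup>2)" by (intro mult_left_mono B) auto
    also have "\<dots> = (\<Sum>p\<in>B. exp (-3) / 9 * (u p + v p)\<^sup>2)" by (simp only: sum_distrib_left)
    also have "\<dots> \<le> (\<Sum>p\<in>B. tp.var p r)" using B r R by (intro sum_mono tp.var_ge) auto
    also have "\<dots> \<le> LL2 r" unfolding LL2_def using B by (intro sum_le_suminf var_summable) (auto intro: tp.var_nonneg)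
    finally show ?thesis .
  qed
  thus ?thesis using c R by (intro exI[of _ "exp (-3) / 9 * c"] conjI exI[of _ R]) auto
qed

text \<open>Partial products are compared by \<open>norm_prod_diff_weighted\<close>, with the primes
  of \<open>ex_decay_primes\<close> as \<open>B\<close>. There \<open>w p\<close> dominates both
  \<open>ch\<close> and its Gaussian counterpart, the product of the weights carries the
  exponential, and the sum of single differences is bounded through \<open>ch_approx\<close> and
  \<open>sum_var_le\<close>. \<open>B\<close> depends on \<open>r\<close> and \<open>y\<close> but
  not on \<open>n\<close>, so the bound survives the limit.\<close>

lemma tilted_char_bound:
  "\<exists>C>0. \<exists>c>0. \<exists>R>0. \<forall>r\<ge>R. \<forall>y. cmod (tilted_char r y - of_real (exp (- LL2 r * y\<^sup>2 / 2)))
     \<le> C * \<bar>y\<bar> ^ 3 / r\<^sup>2 * exp (- (c * y\<^sup>2 / (r + \<bar>y\<bar>)))"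
proof -
  obtain c R where c: "c > 0" and R: "R > 0" and decay: "\<forall>r\<ge>R. \<forall>y. \<exists>B. finite B \<and>
      (\<forall>p\<in>B. prime p \<and> (r + \<bar>y\<bar>) * (u p + v p) \<le> 1) \<and> (\<Sum>p\<in>B. (u p + v p)\<^sup>2) \<ge> c / (r + \<bar>y\<bar>)"
    using ex_decay_primes by (elim exE conjE) (rule that)
  note Bex = decay[rule_format]
  obtain C where C: "C > 0" "\<And>r n. r \<ge> 100 \<Longrightarrow> (\<Sum>p<n. (u p + v p) * tp.var p r) \<le> C / r\<^sup>2"
    using sum_var_le by blast
  \<comment> \<open>The constant of \<open>ch_le_exp\<close>. It is below half of the
    \<open>exp (-3) / 9\<close> in \<open>var_ge\<close>, so the Gaussian factors obey the same
    weight; \<open>k <= 1/2\<close> together with \<open>|y| * (u p + v p) <= 1\<close> keeps the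
    weights at least 1/2.\<close>
  define k where "k = exp (-3 :: real) / 27"
  have "exp (-3 :: real) \<le> 1" by simp
  hence k: "k > 0" "k \<le> 1/2" unfolding k_def by (simp, linarith)
  have "cmod (tilted_char r y - of_real (exp (- LL2 r * y\<^sup>2 / 2)))
     \<le> 2 * C * \<bar>y\<bar> ^ 3 / r\<^sup>2 * exp (- (k * c * y\<^sup>2 / (r + \<bar>y\<bar>)))" if r: "r \<ge> max R 100" for r y
  proof -
    have rR: "r \<ge> R" "r \<ge> 100" "r > 0" using r by auto
    obtain B where B: "finite B" "\<And>p. p \<in> B \<Longrightarrow> (r + \<bar>y\<bar>) * (u p + v p) \<le> 1"
        "(\<Sum>p\<in>B. (u p + v p)\<^sup>2) \<ge> c / (r + \<bar>y\<bar>)"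
      using Bex[OF rR(1), of y] by blast
    have ru: "r * (u p + v p) \<le> 1" "\<bar>y\<bar> * (u p + v p) \<le> 1" if "p \<in> B" for p
    proof -
      have "r * (u p + v p) \<ge> 0" "\<bar>y\<bar> * (u p + v p) \<ge> 0" using rR uv_nonneg[of p] by auto
      thus "r * (u p + v p) \<le> 1" "\<bar>y\<bar> * (u p + v p) \<le> 1" using B(2)[OF that] by (simp_all add: distrib_right)
    qed
    define w where "w p = exp (- k * (u p + v p)\<^sup>2 * y\<^sup>2)" for p
    define e where "e p = complex_of_real (exp (- tp.var p r * y\<^sup>2 / 2))" for p
    have w_half: "1 / 2 \<le> w p" if "p \<in> B" for p
    proof -
      have "(\<bar>y\<bar> * (u p + v p))\<^sup>2 \<le> 1\<^sup>2" using ru(2)[OF that] uv_nonneg[of p] by (intro power_mono) auto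
      hence "k * (\<bar>y\<bar> * (u p + v p))\<^sup>2 \<le> k * 1" using k by (intro mult_left_mono) auto
      moreover have "w p = exp (- (k * (\<bar>y\<bar> * (u p + v p))\<^sup>2))" by (simp add: w_def power_mult_distrib mult_ac)
      ultimately show ?thesis using exp_ge_add_one_self[of "- (k * (\<bar>y\<bar> * (u p + v p))\<^sup>2)"] k(2) by linarith
    qed
    have prodw: "(\<Prod>p\<in>B. w p) \<le> exp (- (k * c * y\<^sup>2 / (r + \<bar>y\<bar>)))"
    proof -
      have "(\<Prod>p\<in>B. w p) = exp (\<Sum>p\<in>B. - k * (u p + v p)\<^sup>2 * y\<^sup>2)"
        unfolding w_def using B by (simp add: exp_sum)
      also have "(\<Sum>p\<in>B. - k * (u p + v p)\<^sup>2 * y\<^sup>2) = - (k * y\<^sup>2 * (\<Sum>p\<in>B. (u p + v p)\<^sup>2))"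
        by (simp add: sum_distrib_left sum_negf mult_ac)
      also have "\<dots> \<le> - (k * y\<^sup>2 * (c / (r + \<bar>y\<bar>)))" using B k by (intro le_imp_neg_le mult_left_mono) auto
      finally show ?thesis by (simp add: mult_ac)
    qed
    have fin: "cmod ((\<Prod>p<n. tp.ch p r y) - (\<Prod>p<n. e p)) \<le> 2 * C * \<bar>y\<bar> ^ 3 / r\<^sup>2 * exp (- (k * c * y\<^sup>2 / (r + \<bar>y\<bar>)))"
      if n: "B \<subseteq> {..<n}" for n
    proof -
      have "cmod ((\<Prod>p<n. tp.ch p r y) - (\<Prod>p<n. e p)) \<le> 2 * (\<Prod>p\<in>B. w p) * (\<Sum>p<n. cmod (tp.ch p r y - e p))"
      proof (rule norm_prod_diff_weighted)
        show "cmod (e p) \<le> 1" for p using tp.var_nonneg[of p r] by (simp add: e_def)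
        show "cmod (tp.ch p r y) \<le> w p" if "p \<in> B" for p
          unfolding w_def k_def using ru[OF that] rR by (intro tp.ch_le_exp) auto
        show "cmod (e p) \<le> w p" if "p \<in> B" for p
        proof -
          have "k * (u p + v p)\<^sup>2 \<le> tp.var p r / 2"
          proof -
            have "exp (-3) / 9 * (u p + v p)\<^sup>2 \<le> tp.var p r" using ru[OF that] rR by (intro tp.var_ge) auto
            moreover have "exp (-3) * (u p + v p)\<^sup>2 \<ge> 0" by simp
            ultimately show ?thesis unfolding k_def by argo
          qed
          hence "k * (u p + v p)\<^sup>2 * y\<^sup>2 \<le> tp.var p r / 2 * y\<^sup>2" by (intro mult_right_mono) auto
          thus ?thesis by (simp add: e_def w_def)
        qed
      qed (use n w_half tp.ch_le_1 in auto)
      also have "\<dots> \<le> 2 * exp (- (k * c * y\<^sup>2 / (r + \<bar>y\<bar>))) * (\<bar>y\<bar> ^ 3 * (C / r\<^sup>2))"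
      proof (intro mult_mono prodw)
        have "(\<Sum>p<n. cmod (tp.ch p r y - e p)) \<le> (\<Sum>p<n. (u p + v p) * tp.var p r * \<bar>y\<bar> ^ 3)"
          unfolding e_def by (intro sum_mono tp.ch_approx)
        also have "\<dots> = \<bar>y\<bar> ^ 3 * (\<Sum>p<n. (u p + v p) * tp.var p r)" by (simp add: sum_distrib_left mult_ac)
        also have "\<dots> \<le> \<bar>y\<bar> ^ 3 * (C / r\<^sup>2)" using C rR by (intro mult_left_mono) auto
        finally show "(\<Sum>p<n. cmod (tp.ch p r y - e p)) \<le> \<bar>y\<bar> ^ 3 * (C / r\<^sup>2)" .
      qed (auto simp: w_def intro!: sum_nonneg prod_nonneg)
      finally show ?thesis by (simp add: mult_ac)
    qed
    have e_lim: "(\<lambda>n. \<Prod>p<n. e p) \<longlonglongrightarrow> of_real (exp (- LL2 r * y\<^sup>2 / 2))"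
    proof -
      have "(\<Prod>p<n. e p) = of_real (exp (- (\<Sum>p<n. tp.var p r) * y\<^sup>2 / 2))" for n
        unfolding e_def of_real_prod[symmetric]
        by (subst exp_sum[symmetric]) (simp_all add: sum_distrib_right sum_negf sum_divide_distrib)
      moreover have "(\<lambda>n. complex_of_real (exp (- (\<Sum>p<n. tp.var p r) * y\<^sup>2 / 2))) \<longlonglongrightarrow> of_real (exp (- LL2 r * y\<^sup>2 / 2))"
        unfolding LL2_def by (intro tendsto_intros summable_LIMSEQ var_summable) auto
      ultimately show ?thesis by simp
    qed
    show ?thesis
    proof (rule LIMSEQ_le_const2)
      show "(\<lambda>n. cmod ((\<Prod>p<n. tp.ch p r y) - (\<Prod>p<n. e p))) \<longlonglongrightarrow> cmod (tilted_char r y - of_real (exp (- LL2 r * y\<^sup>2 / 2)))"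
        by (intro tendsto_intros tilted_char_lim e_lim)
      obtain N where "B \<subseteq> {..<N}" using finite_nat_iff_bounded[THEN iffD1, OF B(1)] by blast
      thus "\<exists>N. \<forall>n\<ge>N. cmod ((\<Prod>p<n. tp.ch p r y) - (\<Prod>p<n. e p)) \<le> 2 * C * \<bar>y\<bar> ^ 3 / r\<^sup>2 * exp (- (k * c * y\<^sup>2 / (r + \<bar>y\<bar>)))"
        by (intro exI[of _ N] allI impI fin) auto
    qed
  qed
  thus ?thesis using C c k R
    by (intro exI[of _ "2 * C"] conjI exI[of _ "k * c"] exI[of _ "max R 100"]) auto
qed

end

section \<open>Tail asymptotics\<close>

lemma nn_integral_abs_le:
  fixes f :: "real \<Rightarrow> ennreal"
  assumes [measurable]: "f \<in> borel_measurable borel"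
  shows "(\<integral>\<^sup>+x. f \<bar>x\<bar> \<partial>lborel) \<le> 2 * (\<integral>\<^sup>+x. f x * indicator {0..} x \<partial>lborel)"
proof -
  let ?g = "\<lambda>x. f x * indicator {0..} x"
  have "(\<integral>\<^sup>+x. f \<bar>x\<bar> \<partial>lborel) \<le> (\<integral>\<^sup>+x. ?g x + ?g (- x) \<partial>lborel)"
    by (intro nn_integral_mono) (auto simp: indicator_def abs_if)
  also have "\<dots> = (\<integral>\<^sup>+x. ?g x \<partial>lborel) + (\<integral>\<^sup>+x. ?g (- x) \<partial>lborel)"
    by (intro nn_integral_add) auto
  also have "(\<integral>\<^sup>+x. ?g (- x) \<partial>lborel) = (\<integral>\<^sup>+x. ?g x \<partial>lborel)"
    using nn_integral_real_affine[of ?g "-1" 0] by simp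
  finally show ?thesis by (simp add: mult_2)
qed

text \<open>For \<open>|y| <= r\<close> the decay rate is at least \<open>c * y^2 / (2 * r)\<close>,
  beyond that at least \<open>c * |y| / 2\<close>. The corresponding moments on the half-line are
  \<open>1 / (2 * a^2)\<close>, of order \<open>r^2\<close>, and \<open>6 / b^4\<close>, independent
  of \<open>r\<close>; doubling them for negative \<open>y\<close> gives the 4 and the 192.\<close>

lemma abs_cube_decay_integral:
  fixes c r :: real
  assumes c: "c > 0" and r: "r \<ge> 1"
  defines "f \<equiv> (\<lambda>y. \<bar>y\<bar> ^ 3 * exp (- (c * y\<^sup>2 / (r + \<bar>y\<bar>))))"
  shows "integrable lborel f" and "(\<integral>y. f y \<partial>lborel) \<le> (4 / c\<^sup>2 + 192 / c ^ 4) * r\<^sup>2"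
proof -
  define a b where "a = c / (2 * r)" and "b = c / 2"
  have a: "a > 0" and b: "b > 0" using c r by (auto simp: a_def b_def)
  define f1 f2 where "f1 y = y ^ 3 * exp (- a * y\<^sup>2)" and "f2 y = y ^ 3 * exp (- b * y)" for y :: real
  have [measurable]: "f \<in> borel_measurable borel" "f1 \<in> borel_measurable borel" "f2 \<in> borel_measurable borel"
    unfolding f_def f1_def f2_def by measurable
  have le: "f y \<le> f1 \<bar>y\<bar> + f2 \<bar>y\<bar>" for y
  proof -
    have "exp (- (c * y\<^sup>2 / (r + \<bar>y\<bar>))) \<le> exp (- a * y\<^sup>2) + exp (- b * \<bar>y\<bar>)"
    proof (cases "\<bar>y\<bar> \<le> r")
      case True
      have "c * y\<^sup>2 / (2 * r) \<le> c * y\<^sup>2 / (r + \<bar>y\<bar>)" using True r c by (intro divide_left_mono) auto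
      hence "exp (- (c * y\<^sup>2 / (r + \<bar>y\<bar>))) \<le> exp (- a * y\<^sup>2)" by (simp add: a_def)
      thus ?thesis by (simp add: add_increasing2)
    next
      case False
      have "c * y\<^sup>2 / (2 * \<bar>y\<bar>) \<le> c * y\<^sup>2 / (r + \<bar>y\<bar>)" using False r c by (intro divide_left_mono) auto
      moreover have "c * y\<^sup>2 / (2 * \<bar>y\<bar>) = b * \<bar>y\<bar>" using False r by (auto simp: b_def power2_eq_square abs_if)
      ultimately have "exp (- (c * y\<^sup>2 / (r + \<bar>y\<bar>))) \<le> exp (- b * \<bar>y\<bar>)" by simp
      thus ?thesis by (simp add: add_increasing)
    qed
    hence "\<bar>y\<bar> ^ 3 * exp (- (c * y\<^sup>2 / (r + \<bar>y\<bar>))) \<le> \<bar>y\<bar> ^ 3 * (exp (- a * y\<^sup>2) + exp (- b * \<bar>y\<bar>))"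
      by (intro mult_left_mono) auto
    thus ?thesis by (simp add: f_def f1_def f2_def distrib_left)
  qed
  have I1: "(\<integral>\<^sup>+y. ennreal (f1 y) * indicator {0..} y \<partial>lborel) = ennreal (1 / (2 * a\<^sup>2))"
  proof -
    have "(\<integral>\<^sup>+y. ennreal (f1 y) * indicator {0..} y \<partial>lborel) = ennreal (0 - (- (0\<^sup>2 / (2 * a) + 1 / (2 * a\<^sup>2)) * exp (- a * 0\<^sup>2)))"
      unfolding f1_def
    proof (rule nn_integral_FTC_atLeast)
      show "((\<lambda>y. - (y\<^sup>2 / (2 * a) + 1 / (2 * a\<^sup>2)) * exp (- a * y\<^sup>2)) \<longlongrightarrow> 0) at_top" using a by real_asymp
    qed (use a in \<open>auto intro!: derivative_eq_intros simp: field_simps power2_eq_square power3_eq_cube\<close>)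
    thus ?thesis by simp
  qed
  have I2: "(\<integral>\<^sup>+y. ennreal (f2 y) * indicator {0..} y \<partial>lborel) = ennreal (6 / b ^ 4)"
  proof -
    have "(\<integral>\<^sup>+y. ennreal (f2 y) * indicator {0..} y \<partial>lborel)
        = ennreal (0 - (- (0 ^ 3 / b + 3 * 0\<^sup>2 / b\<^sup>2 + 6 * 0 / b ^ 3 + 6 / b ^ 4) * exp (- b * 0)))"
      unfolding f2_def
    proof (rule nn_integral_FTC_atLeast)
      show "((\<lambda>y. - (y ^ 3 / b + 3 * y\<^sup>2 / b\<^sup>2 + 6 * y / b ^ 3 + 6 / b ^ 4) * exp (- b * y)) \<longlongrightarrow> 0) at_top"
        using b by real_asymp
    qed (use b in \<open>auto intro!: derivative_eq_intros simp: field_simps power2_eq_square power3_eq_cube power4_eq_xxxx\<close>)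
    thus ?thesis by simp
  qed
  have "(\<integral>\<^sup>+y. ennreal (f y) \<partial>lborel) \<le> (\<integral>\<^sup>+y. ennreal (f1 \<bar>y\<bar>) + ennreal (f2 \<bar>y\<bar>) \<partial>lborel)"
  proof (intro nn_integral_mono)
    fix y
    have "f1 \<bar>y\<bar> \<ge> 0" "f2 \<bar>y\<bar> \<ge> 0" by (auto simp: f1_def f2_def)
    thus "ennreal (f y) \<le> ennreal (f1 \<bar>y\<bar>) + ennreal (f2 \<bar>y\<bar>)"
      using le[of y] by (simp add: ennreal_leI flip: ennreal_plus)
  qed
  also have "\<dots> = (\<integral>\<^sup>+y. ennreal (f1 \<bar>y\<bar>) \<partial>lborel) + (\<integral>\<^sup>+y. ennreal (f2 \<bar>y\<bar>) \<partial>lborel)"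
    by (intro nn_integral_add) auto
  also have "\<dots> \<le> 2 * ennreal (1 / (2 * a\<^sup>2)) + 2 * ennreal (6 / b ^ 4)"
    unfolding I1[symmetric] I2[symmetric]
    by (intro add_mono nn_integral_abs_le[of "\<lambda>y. ennreal (f1 y)"] nn_integral_abs_le[of "\<lambda>y. ennreal (f2 y)"]) auto
  also have "\<dots> = ennreal (2 * (1 / (2 * a\<^sup>2)) + 2 * (6 / b ^ 4))"
  proof -
    have double: "2 * ennreal x = ennreal (2 * x)" if "x \<ge> 0" for x
      unfolding mult_2 by (rule ennreal_plus[symmetric, OF that that])
    have nn: "1 / (2 * a\<^sup>2) \<ge> 0" "6 / b ^ 4 \<ge> 0" using b by simp_all
    show ?thesis unfolding double[OF nn(1)] double[OF nn(2)]
      by (rule ennreal_plus[symmetric]) (use nn in linarith)+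
  qed
  also have "2 * (1 / (2 * a\<^sup>2)) + 2 * (6 / b ^ 4) = 4 / c\<^sup>2 * r\<^sup>2 + 192 / c ^ 4 * 1"
    using c r by (simp add: a_def b_def power_divide power_mult_distrib)
  finally have nn: "(\<integral>\<^sup>+y. ennreal (f y) \<partial>lborel) \<le> ennreal (4 / c\<^sup>2 * r\<^sup>2 + 192 / c ^ 4 * 1)" .
  have f0: "f y \<ge> 0" for y by (simp add: f_def)
  show int: "integrable lborel f"
    using nn f0 by (intro integrableI_nonneg) (auto intro: le_less_trans)
  have "ennreal (\<integral>y. f y \<partial>lborel) \<le> ennreal (4 / c\<^sup>2 * r\<^sup>2 + 192 / c ^ 4 * 1)"
    using nn by (subst nn_integral_eq_integral[OF int, symmetric]) (simp_all only: f0 AE_I2)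
  moreover have "4 / c\<^sup>2 * r\<^sup>2 + 192 / c ^ 4 * 1 \<ge> 0" by simp
  ultimately have "(\<integral>y. f y \<partial>lborel) \<le> 4 / c\<^sup>2 * r\<^sup>2 + 192 / c ^ 4 * 1"
    by (simp only: ennreal_le_iff)
  also have "\<dots> \<le> 4 / c\<^sup>2 * r\<^sup>2 + 192 / c ^ 4 * r\<^sup>2"
    using r by (intro add_left_mono mult_left_mono) (auto simp: one_le_power)
  finally show "(\<integral>y. f y \<partial>lborel) \<le> (4 / c\<^sup>2 + 192 / c ^ 4) * r\<^sup>2" by (simp add: distrib_right)
qed

context prime_series
begin

section \<open>The tilted law and the saddle point estimate\<close>

lemma exp_G_integral: "integrable M (\<lambda>\<omega>. exp (r * G \<omega>))" "(\<integral>\<omega>. exp (r * G \<omega>) \<partial>M) = exp (LL r)"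
proof -
  have eq: "exp (complex_of_real r * of_real (G \<omega>)) = of_real (exp (r * G \<omega>))" for \<omega>
    by (simp add: exp_of_real[symmetric])
  show "integrable M (\<lambda>\<omega>. exp (r * G \<omega>))"
    using exp_moment(1)[of "complex_of_real r"] unfolding eq by (simp only: complex_of_real_integrable_eq)
  show "(\<integral>\<omega>. exp (r * G \<omega>) \<partial>M) = exp (LL r)"
    using Laplace_eq[of r] unfolding eq integral_complex_of_real of_real_eq_iff .
qed

definition tilted where
  "tilted r = distr (density M (\<lambda>\<omega>. ennreal (exp (r * G \<omega> - LL r)))) borel (\<lambda>\<omega>. G \<omega> - LL1 r)"

lemma real_distribution_tilted: "real_distribution (tilted r)"
proof -
  interpret D: prob_space "density M (\<lambda>\<omega>. ennreal (exp (r * G \<omega> - LL r)))"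
  proof
    have "emeasure (density M (\<lambda>\<omega>. ennreal (exp (r * G \<omega> - LL r)))) (space M)
        = (\<integral>\<^sup>+\<omega>. ennreal (exp (r * G \<omega> - LL r)) \<partial>M)"
      by (subst emeasure_density) (auto intro!: nn_integral_cong)
    also have "\<dots> = ennreal (\<integral>\<omega>. exp (r * G \<omega> - LL r) \<partial>M)"
      unfolding exp_diff using exp_G_integral(1)[of r] by (intro nn_integral_eq_integral) auto
    also have "(\<integral>\<omega>. exp (r * G \<omega> - LL r) \<partial>M) = 1"
      unfolding exp_diff using exp_G_integral(2)[of r] by simp
    finally show "emeasure (density M (\<lambda>\<omega>. ennreal (exp (r * G \<omega> - LL r))))
       (space (density M (\<lambda>\<omega>. ennreal (exp (r * G \<omega> - LL r))))) = 1" by simp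
  qed
  show ?thesis unfolding tilted_def by (rule D.real_distribution_distr) simp
qed

lemma integral_tilted:
  fixes h :: "real \<Rightarrow> 'b::{banach, second_countable_topology}"
  assumes [measurable]: "h \<in> borel_measurable borel"
  shows "(\<integral>x. h x \<partial>tilted r) = (\<integral>\<omega>. exp (r * G \<omega> - LL r) *\<^sub>R h (G \<omega> - LL1 r) \<partial>M)"
  unfolding tilted_def by (subst integral_distr, simp, simp, subst integral_density) auto

lemma char_tilted: "char (tilted r) y = tilted_char r y"
proof -
  have "char (tilted r) y = (\<integral>\<omega>. exp (r * G \<omega> - LL r) *\<^sub>R iexp (y * (G \<omega> - LL1 r)) \<partial>M)"
    unfolding char_def by (rule integral_tilted) measurable
  also have "\<dots> = (\<integral>\<omega>. exp (Complex r y * of_real (G \<omega>)) * (iexp (- y * LL1 r) / of_real (exp (LL r))) \<partial>M)"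
  proof (intro Bochner_Integration.integral_cong refl)
    fix \<omega>
    have C: "Complex r y = of_real r + \<i> * of_real y" by (simp add: complex_eq_iff)
    show "exp (r * G \<omega> - LL r) *\<^sub>R iexp (y * (G \<omega> - LL1 r)) = exp (Complex r y * of_real (G \<omega>)) * (iexp (- y * LL1 r) / of_real (exp (LL r)))"
      unfolding C scaleR_conv_of_real exp_of_real[symmetric] exp_diff[symmetric] exp_add[symmetric]
      by (simp add: algebra_simps)
  qed
  also have "\<dots> = tilted_char r y" by (simp add: tilted_char_def)
  finally show ?thesis .
qed

text \<open>The weight \<open>exp (- r * x)\<close> cancels the random part of the density
  \<open>exp (r * G \<omega> - LL r)\<close>, leaving a deterministic factor times an indicator.
  This turns the tail probability into a Laplace integral.\<close>

lemma laplace_tail_tilted: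
  "(\<integral>x. exp (- r * x) * indicator {0<..} x \<partial>tilted r) = exp (r * LL1 r - LL r) * prob {\<omega> \<in> space M. G \<omega> > LL1 r}"
proof -
  have "(\<integral>x. exp (- r * x) * indicator {0<..} x \<partial>tilted r)
      = (\<integral>\<omega>. exp (r * G \<omega> - LL r) *\<^sub>R (exp (- r * (G \<omega> - LL1 r)) * indicator {0<..} (G \<omega> - LL1 r)) \<partial>M)"
    by (rule integral_tilted) measurable
  also have "\<dots> = (\<integral>\<omega>. exp (r * LL1 r - LL r) * indicator {\<omega> \<in> space M. G \<omega> > LL1 r} \<omega> \<partial>M)"
  proof (intro Bochner_Integration.integral_cong refl)
    fix \<omega> assume "\<omega> \<in> space M"
    moreover have "exp (r * G \<omega> - LL r) * exp (- r * (G \<omega> - LL1 r)) = exp (r * LL1 r - LL r)"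
      by (simp add: algebra_simps flip: exp_add)
    ultimately show "exp (r * G \<omega> - LL r) *\<^sub>R (exp (- r * (G \<omega> - LL1 r)) * indicator {0<..} (G \<omega> - LL1 r))
        = exp (r * LL1 r - LL r) * indicator {\<omega> \<in> space M. G \<omega> > LL1 r} \<omega>"
      by (auto simp: indicator_def)
  qed
  also have "\<dots> = exp (r * LL1 r - LL r) * prob {\<omega> \<in> space M. G \<omega> > LL1 r}"
    by (subst integral_mult_right_zero) simp
  finally show ?thesis .
qed

text \<open>The integral of \<open>|y|^3\<close> against the decay is of order at most
  \<open>r^2\<close>, which cancels the \<open>r^2\<close> in the denominator of
  \<open>tilted_char_bound\<close>.\<close>

lemma char_difference_bounded:
  "\<exists>C>0. \<exists>R>0. \<forall>r\<ge>R.
     integrable lborel (\<lambda>y. char (tilted r) y - char (centered_normal (sqrt (LL2 r))) y) \<and>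
     (\<integral>y. cmod (char (tilted r) y - char (centered_normal (sqrt (LL2 r))) y) \<partial>lborel) / (2 * pi) \<le> C"
proof -
  obtain C c R where C: "C > 0" and c: "c > 0" and "R > 0" and
    bound: "\<forall>r\<ge>R. \<forall>y. cmod (tilted_char r y - of_real (exp (- LL2 r * y\<^sup>2 / 2)))
     \<le> C * \<bar>y\<bar> ^ 3 / r\<^sup>2 * exp (- (c * y\<^sup>2 / (r + \<bar>y\<bar>)))"
    using tilted_char_bound by (elim exE conjE) (rule that)
  define C' where "C' = C * (4 / c\<^sup>2 + 192 / c ^ 4) / (2 * pi)"
  have C': "C' > 0" unfolding C'_def using C c by (intro divide_pos_pos mult_pos_pos add_pos_pos) auto
  have main: "integrable lborel (\<lambda>y. char (tilted r) y - char (centered_normal (sqrt (LL2 r))) y) \<and>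
     (\<integral>y. cmod (char (tilted r) y - char (centered_normal (sqrt (LL2 r))) y) \<partial>lborel) / (2 * pi) \<le> C'"
    if r: "r \<ge> max R 1" for r
  proof -
    interpret T: real_distribution "tilted r" by (rule real_distribution_tilted)
    interpret N: real_distribution "centered_normal (sqrt (LL2 r))" by (rule real_distribution_centered_normal)
    define d where "d y = char (tilted r) y - char (centered_normal (sqrt (LL2 r))) y" for y
    have [measurable]: "d \<in> borel_measurable borel"
      unfolding d_def using T.char_measurable N.char_measurable by measurable
    define g where "g y = C / r\<^sup>2 * (\<bar>y\<bar> ^ 3 * exp (- (c * y\<^sup>2 / (r + \<bar>y\<bar>))))" for y
    have g: "integrable lborel g" "(\<integral>y. g y \<partial>lborel) \<le> C * (4 / c\<^sup>2 + 192 / c ^ 4)"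
    proof -
      have "r \<ge> 1" using r by simp
      note I = abs_cube_decay_integral[OF c this]
      show "integrable lborel g" unfolding g_def by (intro integrable_mult_right I)
      have "(\<integral>y. g y \<partial>lborel) = C / r\<^sup>2 * (\<integral>y. \<bar>y\<bar> ^ 3 * exp (- (c * y\<^sup>2 / (r + \<bar>y\<bar>))) \<partial>lborel)"
        unfolding g_def by (rule integral_mult_right_zero)
      also have "\<dots> \<le> C / r\<^sup>2 * ((4 / c\<^sup>2 + 192 / c ^ 4) * r\<^sup>2)" using C by (intro mult_left_mono I) auto
      also have "\<dots> = C * (4 / c\<^sup>2 + 192 / c ^ 4)" using r by simp
      finally show "(\<integral>y. g y \<partial>lborel) \<le> C * (4 / c\<^sup>2 + 192 / c ^ 4)" .
    qed
    have le: "cmod (d y) \<le> g y" for y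
    proof -
      have "cmod (d y) = cmod (tilted_char r y - of_real (exp (- LL2 r * y\<^sup>2 / 2)))"
        unfolding d_def char_tilted char_centered_normal using LL2_pos[of r] by simp
      also have "\<dots> \<le> C * \<bar>y\<bar> ^ 3 / r\<^sup>2 * exp (- (c * y\<^sup>2 / (r + \<bar>y\<bar>)))" using bound r by simp
      finally show ?thesis by (simp add: g_def)
    qed
    have d: "integrable lborel d"
      by (rule Bochner_Integration.integrable_bound[OF g(1)]) (use le in \<open>auto intro: order_trans[OF _ abs_ge_self]\<close>)
    have "(\<integral>y. cmod (d y) \<partial>lborel) \<le> (\<integral>y. g y \<partial>lborel)"
      by (rule integral_mono[OF integrable_norm[OF d] g(1)]) (rule le)
    hence "(\<integral>y. cmod (d y) \<partial>lborel) / (2 * pi) \<le> C'"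
      unfolding C'_def using g(2) by (intro divide_right_mono) auto
    thus ?thesis using d unfolding d_def by blast
  qed
  show ?thesis
    by (rule exI[of _ C'], rule conjI, fact, rule exI[of _ "max R 1"], rule conjI) (use \<open>R > 0\<close> main in auto)
qed

text \<open>Stated along the parameter \<open>r\<close>, with \<open>LL1 r\<close> for \<tau>, so
  that no inverse function occurs. With \<open>A\<close> the reciprocal of the normal main term, the
  characteristic functions contribute at most \<open>(C1 / r) * A\<close>, a multiple of
  \<open>sqrt (LL2 r)\<close> and so \<open>O(1 / sqrt r)\<close>; the normal integral contributes
  \<open>1 / (r^2 * LL2 r)\<close>, which is even \<open>O(1 / r)\<close>.\<close>

lemma tail_saddle_point:
  "\<exists>C>0. \<exists>R>0. \<forall>r\<ge>R. \<bar>prob {\<omega> \<in> space M. G \<omega> > LL1 r} /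
      (exp (LL r) * exp (- LL1 r * r) / (r * sqrt (2 * pi * LL2 r))) - 1\<bar> \<le> C / sqrt r"
proof -
  obtain C1 R1 where C1: "C1 > 0" "R1 > 0" and char: "\<forall>r\<ge>R1.
     integrable lborel (\<lambda>y. char (tilted r) y - char (centered_normal (sqrt (LL2 r))) y) \<and>
     (\<integral>y. cmod (char (tilted r) y - char (centered_normal (sqrt (LL2 r))) y) \<partial>lborel) / (2 * pi) \<le> C1"
    using char_difference_bounded by (elim exE conjE) (rule that)
  obtain C2 where C2: "C2 > 0" "\<And>r. r \<ge> 100 \<Longrightarrow> LL2 r \<le> C2 / r" using sum_var_le by blast
  obtain c3 R3 where c3: "c3 > 0" "R3 > 0" "\<And>r. r \<ge> R3 \<Longrightarrow> LL2 r \<ge> c3 / r" using LL2_ge by blast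
  define C where "C = C1 * sqrt (2 * pi) * sqrt C2 + 1 / c3"
  have C: "C > 0" unfolding C_def using C1 C2 c3 by (intro add_pos_pos mult_pos_pos) auto
  have main: "\<bar>prob {\<omega> \<in> space M. G \<omega> > LL1 r} /
      (exp (LL r) * exp (- LL1 r * r) / (r * sqrt (2 * pi * LL2 r))) - 1\<bar> \<le> C / sqrt r"
    if "r \<ge> max R1 (max R3 100)" for r
  proof -
    have r: "r \<ge> R1" "r \<ge> R3" "r \<ge> 100" "r > 0" using that by auto
    define s where "s = sqrt (LL2 r)"
    have s: "s > 0" "s\<^sup>2 = LL2 r" using LL2_pos[of r] by (auto simp: s_def)
    define A where "A = r * s * sqrt (2 * pi)"
    have A: "A > 0" using r s by (simp add: A_def)
    have A_eq: "A = r * sqrt (2 * pi * LL2 r)" by (simp add: A_def s_def real_sqrt_mult)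
    define T where "T = (\<integral>x. exp (- r * x) * indicator {0<..} x \<partial>tilted r)"
    define N where "N = (\<integral>x. exp (- r * x) * indicator {0<..} x \<partial>centered_normal s)"
    have "\<bar>T - N\<bar> \<le> (\<integral>y. cmod (char (tilted r) y - char (centered_normal s) y) \<partial>lborel) / (2 * pi) / r"
      unfolding T_def N_def using char r
      by (intro laplace_tail_diff_le real_distribution_tilted real_distribution_centered_normal) (auto simp: s_def)
    also have "\<dots> \<le> C1 / r" using char r by (intro divide_right_mono) (auto simp: s_def)
    finally have TN: "\<bar>T - N\<bar> \<le> C1 / r" .
    have NA: "\<bar>N - 1 / A\<bar> \<le> 1 / A * (1 / (r * s)\<^sup>2)"
      unfolding N_def A_def by (rule laplace_tail_centered_normal[OF r(4) s(1)])
    have "\<bar>T * A - 1\<bar> = \<bar>T - 1 / A\<bar> * A" using A by (simp add: field_simps abs_if)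
    also have "\<dots> \<le> (C1 / r + 1 / A * (1 / (r * s)\<^sup>2)) * A"
      using TN NA A by (intro mult_right_mono) auto
    also have "\<dots> = C1 * sqrt (2 * pi) * s + 1 / (r * s)\<^sup>2"
    proof -
      have "C1 / r * A = C1 * sqrt (2 * pi) * s" using r by (simp add: A_def)
      moreover have "1 / A * (1 / (r * s)\<^sup>2) * A = 1 / (r * s)\<^sup>2" using A by simp
      ultimately show ?thesis by (simp only: distrib_right)
    qed
    also have "\<dots> \<le> C1 * sqrt (2 * pi) * (sqrt C2 / sqrt r) + (1 / c3) / sqrt r"
    proof (intro add_mono mult_left_mono)
      show "s \<le> sqrt C2 / sqrt r" unfolding s_def real_sqrt_divide[symmetric] using C2 r by simp
      have "c3 * sqrt r \<le> c3 * r"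
      proof (intro mult_left_mono)
        have "sqrt r \<le> sqrt (r * r)" using r by (intro real_sqrt_le_mono) auto
        thus "sqrt r \<le> r" using r by simp
      qed (use c3 in auto)
      also have "\<dots> = r\<^sup>2 * (c3 / r)" using r by (simp add: power2_eq_square)
      also have "\<dots> \<le> r\<^sup>2 * LL2 r" using c3 r by (intro mult_left_mono) auto
      also have "\<dots> = (r * s)\<^sup>2" using s by (simp add: power_mult_distrib)
      finally have "1 / (r * s)\<^sup>2 \<le> 1 / (c3 * sqrt r)" using c3 r s by (intro divide_left_mono) auto
      thus "1 / (r * s)\<^sup>2 \<le> (1 / c3) / sqrt r" by simp
    qed (use C1 in auto)
    also have "\<dots> = C / sqrt r" by (simp add: C_def add_divide_distrib)
    finally have "\<bar>T * A - 1\<bar> \<le> C / sqrt r" .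
    moreover have "T * A = prob {\<omega> \<in> space M. G \<omega> > LL1 r} /
      (exp (LL r) * exp (- LL1 r * r) / (r * sqrt (2 * pi * LL2 r)))"
      unfolding T_def laplace_tail_tilted A_eq[symmetric]
      by (simp add: exp_diff exp_minus field_simps)
    ultimately show ?thesis by simp
  qed
  show ?thesis
    by (rule exI[of _ C], rule conjI, fact, rule exI[of _ "max R1 (max R3 100)"], rule conjI) (use C1 main in auto)
qed

section \<open>Inversion of the saddle point equation\<close>

lemma strict_mono_LL1: "strict_mono LL1"
  by (rule strict_monoI, rule DERIV_pos_imp_increasing) (use LL1_deriv LL2_pos in blast)+

text \<open>Integrating \<open>LL2 r >= c / r\<close> gives growth at least like
  \<open>c * ln r\<close>.\<close>

lemma filterlim_LL1: "filterlim LL1 at_top at_top"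
proof -
  obtain c R where c: "c > 0" "R > 0" "\<And>r. r \<ge> R \<Longrightarrow> LL2 r \<ge> c / r" using LL2_ge by blast
  have le: "LL1 R - c * ln R + c * ln r \<le> LL1 r" if "r \<ge> R" for r
  proof -
    have "LL1 R - c * ln R \<le> LL1 r - c * ln r"
    proof (rule DERIV_nonneg_imp_nondecreasing[OF that])
      fix x assume x: "R \<le> x" "x \<le> r"
      have "((\<lambda>x. LL1 x - c * ln x) has_real_derivative LL2 x - c / x) (at x)"
        using x c by (auto intro!: derivative_eq_intros LL1_deriv)
      moreover have "LL2 x - c / x \<ge> 0" using c(3)[OF x(1)] by simp
      ultimately show "\<exists>y. ((\<lambda>x. LL1 x - c * ln x) has_real_derivative y) (at x) \<and> 0 \<le> y" by blast
    qed
    thus ?thesis by simp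
  qed
  have "filterlim (\<lambda>r. LL1 R - c * ln R + c * ln r) at_top at_top"
    by (intro filterlim_tendsto_add_at_top[OF tendsto_const] filterlim_tendsto_pos_mult_at_top[OF tendsto_const] ln_at_top c(1))
  thus ?thesis
    by (rule filterlim_at_top_mono) (use le in \<open>auto simp: eventually_at_top_linorder\<close>)
qed

text \<open>The intermediate value theorem to the right of 0 gives existence, and strict
  monotonicity gives uniqueness and \<open>k \<tau> >= R\<close> as soon as
  \<open>\<tau> >= LL1 (max R 0)\<close>. The estimate along \<open>r\<close> is then read at
  \<open>r = k \<tau>\<close>.\<close>

lemma tail_asymptotics:
  defines "k \<equiv> (\<lambda>\<tau>. THE r. LL1 r = \<tau>)"
  shows "\<exists>E. E \<in> O[at_top](\<lambda>\<tau>. 1 / sqrt (k \<tau>)) \<and>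
    (\<forall>\<^sub>F \<tau> in at_top. (\<exists>!r. LL1 r = \<tau>) \<and>
       prob {\<omega> \<in> space M. G \<omega> > \<tau>} =
         exp (LL (k \<tau>)) * exp (- \<tau> * k \<tau>) / (k \<tau> * sqrt (2 * pi * LL2 (k \<tau>))) * (1 + E \<tau>))"
proof -
  have uniq: "\<exists>!r. LL1 r = \<tau>" if \<tau>: "\<tau> \<ge> LL1 0" for \<tau>
  proof -
    have "eventually (\<lambda>r. LL1 r \<ge> \<tau> \<and> r \<ge> 0) at_top"
      using filterlim_LL1 by (intro eventually_conj eventually_ge_at_top) (auto simp: filterlim_at_top)
    then obtain b where "LL1 b \<ge> \<tau>" "b \<ge> 0" by (auto simp: eventually_at_top_linorder)
    moreover have "isCont LL1 x" for x by (rule DERIV_isCont[OF LL1_deriv])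
    ultimately obtain r where "LL1 r = \<tau>" using IVT[of LL1 0 \<tau> b] \<tau> by blast
    thus ?thesis by (intro ex1I[of _ r]) (auto simp: strict_mono_eq[OF strict_mono_LL1])
  qed
  have k_LL1: "k (LL1 r) = r" for r
    unfolding k_def by (rule the_equality) (auto simp: strict_mono_eq[OF strict_mono_LL1])
  have LL1_k: "LL1 (k \<tau>) = \<tau>" if "\<tau> \<ge> LL1 0" for \<tau>
    unfolding k_def by (rule theI'[OF uniq[OF that]])
  have k_ge: "k \<tau> \<ge> R" if "\<tau> \<ge> LL1 (max R 0)" for \<tau> R
  proof -
    have "LL1 0 \<le> LL1 (max R 0)" by (intro monoD[OF strict_mono_mono[OF strict_mono_LL1]]) auto
    hence "LL1 (max R 0) \<le> LL1 (k \<tau>)" using LL1_k[of \<tau>] that by simp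
    hence "max R 0 \<le> k \<tau>" by (simp only: strict_mono_less_eq[OF strict_mono_LL1])
    thus ?thesis by simp
  qed
  obtain C R where C: "C > 0" "R > 0" and main: "\<forall>r\<ge>R. \<bar>prob {\<omega> \<in> space M. G \<omega> > LL1 r} /
      (exp (LL r) * exp (- LL1 r * r) / (r * sqrt (2 * pi * LL2 r))) - 1\<bar> \<le> C / sqrt r"
    using tail_saddle_point by (elim exE conjE) (rule that)
  define P where "P \<tau> = exp (LL (k \<tau>)) * exp (- \<tau> * k \<tau>) / (k \<tau> * sqrt (2 * pi * LL2 (k \<tau>)))" for \<tau>
  \<comment> \<open>Solved from the desired formula. For small \<tau> the \<open>THE\<close> in
    \<open>k\<close> may be unspecified and \<open>E\<close> is arbitrary; only
    \<open>\<tau> >= T\<close> matters, where \<open>P \<tau>\<close> is positive.\<close>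
  define E where "E \<tau> = prob {\<omega> \<in> space M. G \<omega> > \<tau>} / P \<tau> - 1" for \<tau>
  define T where "T = max (LL1 0) (LL1 (max R 0))"
  have bound: "\<bar>E \<tau>\<bar> \<le> C * \<bar>1 / sqrt (k \<tau>)\<bar> \<and> P \<tau> > 0" if "\<tau> \<ge> T" for \<tau>
  proof -
    have k: "k \<tau> \<ge> R" "LL1 (k \<tau>) = \<tau>" using that by (auto simp: T_def intro: k_ge LL1_k)
    have "\<bar>E \<tau>\<bar> \<le> C / sqrt (k \<tau>)" using main[rule_format, OF k(1)] unfolding E_def P_def k(2) .
    thus ?thesis using k C LL2_pos[of "k \<tau>"] by (simp add: P_def)
  qed
  have "E \<in> O[at_top](\<lambda>\<tau>. 1 / sqrt (k \<tau>))"
    by (rule bigoI[of _ C]) (use bound in \<open>auto simp: eventually_at_top_linorder intro!: exI[of _ T]\<close>)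
  moreover have "\<forall>\<^sub>F \<tau> in at_top. (\<exists>!r. LL1 r = \<tau>) \<and> prob {\<omega> \<in> space M. G \<omega> > \<tau>} = P \<tau> * (1 + E \<tau>)"
    using eventually_ge_at_top[of T]
  proof eventually_elim
    case (elim \<tau>)
    have "P \<tau> > 0" using bound[OF elim] by blast
    thus ?case using uniq[of \<tau>] elim by (auto simp: E_def T_def)
  qed
  ultimately show ?thesis unfolding P_def by blast
qed

end

section \<open>Reduction of both tails of \<open>gamma_rand\<close> to the series\<close>

text \<open>The three probabilities exhaust the total mass, so no other value has positive
  probability.\<close>

lemma (in prob_space) has_prime_law_AE:
  assumes p: "prime p" and law: "has_prime_law M p X" and [measurable]: "random_variable borel X"
  shows "AE \<omega> in M. X \<omega> \<in> {1, -1, 0}"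
proof -
  define A where "A c = {\<omega> \<in> space M. X \<omega> = c}" for c
  have A: "A c \<in> events" for c unfolding A_def by measurable
  have "A 1 \<inter> A (-1) = {}" "(A 1 \<union> A (-1)) \<inter> A 0 = {}" by (auto simp: A_def)
  hence "prob (A 1 \<union> A (-1) \<union> A 0) = prob (A 1) + prob (A (-1)) + prob (A 0)"
    by (simp only: finite_measure_Union A sets.Un)
  also have "\<dots> = real p / (2 * (real p + 1)) + real p / (2 * (real p + 1)) + 1 / (real p + 1)"
    using law by (simp only: has_prime_law_def A_def)
  also have "\<dots> = (real p + 1) / (real p + 1)"
  proof -
    have "real p / (2 * x) + real p / (2 * x) = real p / x" for x :: real by simp
    thus ?thesis by (simp only: add_divide_distrib)
  qed
  also have "\<dots> = 1" by simp
  finally have one: "prob (A 1 \<union> A (-1) \<union> A 0) = 1" .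
  have "A 1 \<union> A (-1) \<union> A 0 \<in> events" by (intro sets.Un A)
  from prob_eq_1[OF this] one have "AE \<omega> in M. \<omega> \<in> A 1 \<union> A (-1) \<union> A 0" by (rule iffD1)
  thus ?thesis by eventually_elim (auto simp: A_def)
qed

text \<open>The constants 2/3 and 2 are the values of \<open>p / (p + 1)\<close> and
  \<open>p / (p - 1)\<close> at \<open>p = 2\<close>. The last bound rests on
  \<open>2 / (p^2 - 1) <= 4 / p^2\<close> and makes the difference of the two jumps summable,
  although neither jump is.\<close>

lemma prime_spread_bounds:
  fixes p :: nat
  assumes "prime p"
  shows "2 / 3 * xp p \<le> ln (real p) / (real p + 1)" "ln (real p) / (real p + 1) \<le> 2 * xp p"
    "2 / 3 * xp p \<le> ln (real p) / (real p - 1)" "ln (real p) / (real p - 1) \<le> 2 * xp p"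
    "\<bar>ln (real p) / (real p + 1) - ln (real p) / (real p - 1)\<bar> \<le> 4 * (ln (real p) / real p ^ 2)"
proof -
  have p: "real p \<ge> 2" using prime_ge_2_nat[OF assms] by simp
  have l: "ln (real p) \<ge> 0" using p by simp
  have r: "2 / 3 * (1 / real p) \<le> 1 / (real p + 1)" "1 / (real p + 1) \<le> 2 * (1 / real p)"
    "2 / 3 * (1 / real p) \<le> 1 / (real p - 1)" "1 / (real p - 1) \<le> 2 * (1 / real p)"
    using p by (auto simp: divide_simps)
  show "2 / 3 * xp p \<le> ln (real p) / (real p + 1)" "ln (real p) / (real p + 1) \<le> 2 * xp p"
    "2 / 3 * xp p \<le> ln (real p) / (real p - 1)" "ln (real p) / (real p - 1) \<le> 2 * xp p"
    using mult_left_mono[OF r(1) l] mult_left_mono[OF r(2) l] mult_left_mono[OF r(3) l] mult_left_mono[OF r(4) l]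
    by (simp_all add: xp_def mult_ac)
  have "1 / (real p - 1) - 1 / (real p + 1) = 2 / (real p ^ 2 - 1)"
    using p by (simp add: field_simps power2_eq_square)
  also have "\<dots> \<le> 2 / (real p ^ 2 / 2)"
  proof (rule divide_left_mono)
    have "2 * 2 \<le> real p * real p" using p by (intro mult_mono) auto
    thus "real p ^ 2 / 2 \<le> real p ^ 2 - 1" "(real p ^ 2 - 1) * (real p ^ 2 / 2) > 0" by (auto simp: power2_eq_square)
  qed auto
  finally have "ln (real p) * (1 / (real p - 1) - 1 / (real p + 1)) \<le> ln (real p) * (4 / real p ^ 2)"
    using l by (intro mult_left_mono) auto
  moreover have "ln (real p) / (real p + 1) \<le> ln (real p) / (real p - 1)" using p l by (intro divide_left_mono) auto
  ultimately show "\<bar>ln (real p) / (real p + 1) - ln (real p) / (real p - 1)\<bar> \<le> 4 * (ln (real p) / real p ^ 2)"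
    by (simp add: right_diff_distrib mult_ac)
qed

text \<open>The sign \<open>\<sigma> = 1\<close> gives \<open>gamma_rand X\<close>, the sign \<open>\<sigma> = -1\<close> gives \<open>- gamma_rand X\<close>, so both tails are upper tails of such a series.\<close>

lemma prime_series_gamma_rand:
  fixes \<sigma> :: real
  assumes M: "prob_space M" and indep: "prob_space.indep_vars M (\<lambda>_. borel) X {p. prime p}"
    and law: "\<And>p. prime p \<Longrightarrow> has_prime_law M p (X p)" and \<sigma>: "\<sigma> = 1 \<or> \<sigma> = -1"
  defines "u \<equiv> (\<lambda>p. if prime p then ln (real p) / (real p + \<sigma>) else 0)"
    and "v \<equiv> (\<lambda>p. if prime p then ln (real p) / (real p - \<sigma>) else 0)"
    and "q \<equiv> (\<lambda>p. if prime p then real p / (2 * (real p + 1)) else 1 / 3)"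
    and "Y \<equiv> (\<lambda>p \<omega>. - \<sigma> * (ln (real p) * X p \<omega> / (real p - X p \<omega>)))"
  shows "prime_series M u v q Y"
proof -
  interpret prob_space M by fact
  have rv: "random_variable borel (X p)" if "prime p" for p
    using indep that by (auto simp: indep_vars_def)
  show ?thesis
  proof
    \<comment> \<open>The bounds are demanded at every index; off the primes the default
      \<open>q p = 1 / 3\<close> meets them.\<close>
    show "1 / 3 \<le> q p" "q p \<le> 1 / 2" for p
      using prime_ge_2_nat[of p] by (auto simp: q_def field_simps)
    show "\<not> prime p \<Longrightarrow> u p = 0" "\<not> prime p \<Longrightarrow> v p = 0" for p by (auto simp: u_def v_def)
    show "prime p \<Longrightarrow> 2 / 3 * xp p \<le> u p" "prime p \<Longrightarrow> u p \<le> 2 * xp p"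
      "prime p \<Longrightarrow> 2 / 3 * xp p \<le> v p" "prime p \<Longrightarrow> v p \<le> 2 * xp p" for p
      using prime_spread_bounds[of p] \<sigma> by (auto simp: u_def v_def)
    show "summable (\<lambda>p. \<bar>u p - v p\<bar>)"
    proof (rule summable_comparison_test'[OF summable_mult[OF summable_ln_over_square, of 4]])
      fix p :: nat
      have "0 \<le> ln (real p)" by (cases "p = 0") auto
      thus "norm \<bar>u p - v p\<bar> \<le> 4 * (ln (real p) / real p ^ 2)"
        using prime_spread_bounds(5)[of p] \<sigma> by (auto simp: u_def v_def abs_minus_commute)
    qed
    show "indep_vars (\<lambda>_. borel) Y {p. prime p}"
      unfolding Y_def by (rule indep_vars_compose2[OF indep, where Y = "\<lambda>p x. - \<sigma> * (ln (real p) * x / (real p - x))"]) measurable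
    fix p :: nat assume p: "prime p"
    note [measurable] = rv[OF p]
    have p1: "real p > 1" "ln (real p) > 0" using prime_gt_1_nat[OF p] by auto
    have ae: "AE \<omega> in M. X p \<omega> \<in> {1, -1, 0}" by (rule has_prime_law_AE[OF p law[OF p] rv[OF p]])
    \<comment> \<open>\<open>X p = - \<sigma>\<close> gives the positive jump \<open>u p\<close>,
      with denominator \<open>p + \<sigma>\<close>, and \<open>X p = \<sigma>\<close> the negative
      jump \<open>- v p\<close>, because \<open>\<sigma> * \<sigma> = 1\<close>.\<close>
    have vals: "- \<sigma> * (ln (real p) * x / (real p - x)) = (if x = - \<sigma> then u p else if x = \<sigma> then - v p else 0)"
      if "x \<in> {1, -1, 0}" for x
      using that \<sigma> by (elim insertE disjE emptyE) (simp_all add: u_def v_def p)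
    have aeY: "AE \<omega> in M. Y p \<omega> = (if X p \<omega> = - \<sigma> then u p else if X p \<omega> = \<sigma> then - v p else 0)"
      using ae by eventually_elim (unfold Y_def, rule vals)
    have uv: "u p > 0" "v p > 0" using p1 p \<sigma> by (auto simp: u_def v_def)
    show "AE \<omega> in M. Y p \<omega> \<in> {u p, - v p, 0}"
      using aeY by eventually_elim simp
    have "prob {\<omega> \<in> space M. Y p \<omega> = u p} = prob {\<omega> \<in> space M. X p \<omega> = - \<sigma>}"
    proof (rule finite_measure_eq_AE)
      show "AE \<omega> in M. (\<omega> \<in> {\<omega> \<in> space M. Y p \<omega> = u p}) = (\<omega> \<in> {\<omega> \<in> space M. X p \<omega> = - \<sigma>})"
        using aeY by eventually_elim (use uv \<sigma> in auto)
    qed (unfold Y_def, measurable)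
    also have "\<dots> = q p" using law[OF p] p \<sigma> by (auto simp: has_prime_law_def q_def)
    finally show "prob {\<omega> \<in> space M. Y p \<omega> = u p} = q p" .
    have "prob {\<omega> \<in> space M. Y p \<omega> = - v p} = prob {\<omega> \<in> space M. X p \<omega> = \<sigma>}"
    proof (rule finite_measure_eq_AE)
      show "AE \<omega> in M. (\<omega> \<in> {\<omega> \<in> space M. Y p \<omega> = - v p}) = (\<omega> \<in> {\<omega> \<in> space M. X p \<omega> = \<sigma>})"
        using aeY by eventually_elim (use uv \<sigma> in auto)
    qed (unfold Y_def, measurable)
    also have "\<dots> = q p" using law[OF p] p \<sigma> by (auto simp: has_prime_law_def q_def)
    finally show "prob {\<omega> \<in> space M. Y p \<omega> = - v p} = q p" .
  qed
qed

text \<open>Interface between series and theorem: the series for the sign \<sigma> agrees almost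
  surely with \<open>\<sigma> * gamma_rand X\<close>. The argument \<open>\<sigma> * r\<close>
  records that reflecting the variable reflects its Laplace transform.\<close>

lemma gamma_rand_reduction:
  fixes \<sigma> :: real
  assumes M: "prob_space M" and indep: "prob_space.indep_vars M (\<lambda>_. borel) X {p. prime p}"
    and law: "\<And>p. prime p \<Longrightarrow> has_prime_law M p (X p)" and \<sigma>: "\<sigma> = 1 \<or> \<sigma> = -1"
  obtains LL LL1 LL2 :: "real \<Rightarrow> real" and E :: "real \<Rightarrow> real"
  where "\<And>r. Laplace_real M X (\<sigma> * r) = exp (LL r)"
    "\<And>r. (LL has_real_derivative LL1 r) (at r)" "\<And>r. (LL1 has_real_derivative LL2 r) (at r)"
    "E \<in> O[at_top](\<lambda>\<tau>. 1 / sqrt (THE r. LL1 r = \<tau>))"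
    "\<forall>\<^sub>F \<tau> in at_top. (\<exists>!r. LL1 r = \<tau>) \<and>
       measure M {\<omega> \<in> space M. \<sigma> * gamma_rand X \<omega> > \<tau>} =
         exp (LL (THE r. LL1 r = \<tau>)) * exp (- \<tau> * (THE r. LL1 r = \<tau>)) /
         ((THE r. LL1 r = \<tau>) * sqrt (2 * pi * LL2 (THE r. LL1 r = \<tau>))) * (1 + E \<tau>)"
proof -
  interpret prime_series M "\<lambda>p. if prime p then ln (real p) / (real p + \<sigma>) else 0"
    "\<lambda>p. if prime p then ln (real p) / (real p - \<sigma>) else 0"
    "\<lambda>p. if prime p then real p / (2 * (real p + 1)) else 1 / 3"
    "\<lambda>p \<omega>. - \<sigma> * (ln (real p) * X p \<omega> / (real p - X p \<omega>))" "\<sigma> * euler_mascheroni"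
    by (rule prime_series_gamma_rand[OF M indep law \<sigma>])
  have \<sigma>\<sigma>: "\<sigma> * \<sigma> = 1" using \<sigma> by auto
  define W where "W p \<omega> = (if prime p then ln (real p) * X p \<omega> / (real p - X p \<omega>) else 0)" for p \<omega>
  have Z_eq: "Z p \<omega> = - \<sigma> * W p \<omega>" for p \<omega> unfolding Z_def W_def by (cases "prime p") simp_all
  have G_eq: "AE \<omega> in M. \<sigma> * gamma_rand X \<omega> = G \<omega>"
    using AE_S_tendsto
  proof eventually_elim
    case (elim \<omega>)
    define g where "g = G \<omega>"
    have S_eq: "S n \<omega> = (\<Sum>p<n. - \<sigma> * W p \<omega>)" for n by (simp only: S_def Z_eq)
    have "(\<lambda>p. - \<sigma> * W p \<omega>) sums (g - \<sigma> * euler_mascheroni)"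
      using tendsto_diff[OF elim[folded g_def] tendsto_const[of "\<sigma> * euler_mascheroni"]]
      unfolding sums_def S_eq add_diff_cancel_left' .
    \<comment> \<open>A second multiplication by \<open>- \<sigma>\<close> recovers \<open>W\<close>
      itself, so the \<open>suminf\<close> in \<open>gamma_rand\<close> is evaluated from a proved
      convergence.\<close>
    hence "(\<lambda>p. - \<sigma> * (- \<sigma> * W p \<omega>)) sums (- \<sigma> * (g - \<sigma> * euler_mascheroni))" by (rule sums_mult)
    moreover have "- \<sigma> * (- \<sigma> * W p \<omega>) = (\<sigma> * \<sigma>) * W p \<omega>" for p by simp
    ultimately have "(\<lambda>p. W p \<omega>) sums (- \<sigma> * (g - \<sigma> * euler_mascheroni))" by (simp only: \<sigma>\<sigma> mult_1_left)
    hence sum_W: "(\<Sum>p. W p \<omega>) = - \<sigma> * (g - \<sigma> * euler_mascheroni)" by (rule sums_unique[symmetric])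
    have "\<sigma> * gamma_rand X \<omega> = \<sigma> * euler_mascheroni + (\<sigma> * \<sigma>) * (g - \<sigma> * euler_mascheroni)"
      unfolding gamma_rand_def W_def[symmetric] sum_W by (simp add: algebra_simps)
    hence "\<sigma> * gamma_rand X \<omega> = g" unfolding \<sigma>\<sigma> by simp
    thus ?case unfolding g_def .
  qed
  have gamma_measurable: "gamma_rand X \<in> borel_measurable M"
  proof -
    \<comment> \<open>\<open>X p\<close> is known to be measurable for prime \<open>p\<close> only;
      \<open>W p\<close> inherits measurability at every index from \<open>Z p\<close>.\<close>
    have [measurable]: "W p \<in> borel_measurable M" for p
    proof -
      have "- \<sigma> * Z p \<omega> = (\<sigma> * \<sigma>) * W p \<omega>" for \<omega> unfolding Z_eq by simp
      hence "(\<lambda>\<omega>. - \<sigma> * Z p \<omega>) = W p" unfolding \<sigma>\<sigma> mult_1_left by (rule ext)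
      moreover have "(\<lambda>\<omega>. - \<sigma> * Z p \<omega>) \<in> borel_measurable M" by (intro borel_measurable_times Z_measurable) simp
      ultimately show ?thesis by (simp only:)
    qed
    show ?thesis unfolding gamma_rand_def[abs_def] W_def[symmetric] by measurable
  qed
  note [measurable] = gamma_measurable
  have L: "Laplace_real M X (\<sigma> * r) = exp (LL r)" for r
  proof -
    have "Laplace M X (complex_of_real (\<sigma> * r)) = (\<integral>\<omega>. exp (complex_of_real r * of_real (G \<omega>)) \<partial>M)"
      unfolding Laplace_def
    proof (rule integral_cong_AE)
      show "AE \<omega> in M. exp (complex_of_real (\<sigma> * r) * of_real (gamma_rand X \<omega>)) = exp (complex_of_real r * of_real (G \<omega>))"
        using G_eq
      proof eventually_elim
        case (elim \<omega>)
        have "complex_of_real (\<sigma> * r) * of_real (gamma_rand X \<omega>) = of_real r * of_real (\<sigma> * gamma_rand X \<omega>)" by simp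
        thus ?case by (simp only: elim)
      qed
    qed measurable
    thus ?thesis unfolding Laplace_real_def Laplace_eq by simp
  qed
  have P: "measure M {\<omega> \<in> space M. \<sigma> * gamma_rand X \<omega> > \<tau>} = prob {\<omega> \<in> space M. G \<omega> > \<tau>}" for \<tau>
    by (rule finite_measure_eq_AE) (use G_eq in \<open>eventually_elim, simp\<close>, measurable)
  obtain E where E: "E \<in> O[at_top](\<lambda>\<tau>. 1 / sqrt (THE r. LL1 r = \<tau>))"
    "\<forall>\<^sub>F \<tau> in at_top. (\<exists>!r. LL1 r = \<tau>) \<and>
       prob {\<omega> \<in> space M. G \<omega> > \<tau>} =
         exp (LL (THE r. LL1 r = \<tau>)) * exp (- \<tau> * (THE r. LL1 r = \<tau>)) /
         ((THE r. LL1 r = \<tau>) * sqrt (2 * pi * LL2 (THE r. LL1 r = \<tau>))) * (1 + E \<tau>)"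
    using tail_asymptotics by blast
  show thesis
    by (rule that[OF L LL_deriv LL1_deriv E(1)]) (use E(2) in \<open>simp only: P\<close>)
qed

theorem theorem5p2:
  fixes M :: "'a measure" and X :: "nat \<Rightarrow> 'a \<Rightarrow> real"
  assumes "prob_space M"
    and "prob_space.indep_vars M (\<lambda>_. borel) X {p. prime p}"
    and "\<And>p. prime p \<Longrightarrow> has_prime_law M p (X p)"
  shows "(\<exists>E. E \<in> O[at_top](\<lambda>\<tau>. 1 / sqrt (kappa M X \<tau>)) \<and>
           (\<forall>\<^sub>F \<tau> in at_top.
              (\<exists>!r. deriv (log_Laplace M X) r = \<tau>) \<and>
              measure M {\<omega> \<in> space M. gamma_rand X \<omega> > \<tau>} =
                Laplace_real M X (kappa M X \<tau>) * exp (- \<tau> * kappa M X \<tau>) /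
                (kappa M X \<tau> * sqrt (2 * pi * deriv (deriv (log_Laplace M X)) (kappa M X \<tau>))) *
                (1 + E \<tau>)))
       \<and> (\<exists>E. E \<in> O[at_top](\<lambda>\<tau>. 1 / sqrt (kappa_tilde M X \<tau>)) \<and>
           (\<forall>\<^sub>F \<tau> in at_top.
              (\<exists>!r. deriv (log_Laplace M X) (- r) = - \<tau>) \<and>
              measure M {\<omega> \<in> space M. gamma_rand X \<omega> < - \<tau>} =
                Laplace_real M X (- kappa_tilde M X \<tau>) * exp (- \<tau> * kappa_tilde M X \<tau>) /
                (kappa_tilde M X \<tau> * sqrt (2 * pi * deriv (deriv (log_Laplace M X)) (- kappa_tilde M X \<tau>))) *
                (1 + E \<tau>)))"
proof (rule conjI)
  obtain L L1 L2 E where L: "\<And>r. Laplace_real M X (1 * r) = exp (L r)"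
    and d: "\<And>r. (L has_real_derivative L1 r) (at r)" "\<And>r. (L1 has_real_derivative L2 r) (at r)"
    and E: "E \<in> O[at_top](\<lambda>\<tau>. 1 / sqrt (THE r. L1 r = \<tau>))"
    and tail: "\<forall>\<^sub>F \<tau> in at_top. (\<exists>!r. L1 r = \<tau>) \<and>
       measure M {\<omega> \<in> space M. 1 * gamma_rand X \<omega> > \<tau>} =
         exp (L (THE r. L1 r = \<tau>)) * exp (- \<tau> * (THE r. L1 r = \<tau>)) /
         ((THE r. L1 r = \<tau>) * sqrt (2 * pi * L2 (THE r. L1 r = \<tau>))) * (1 + E \<tau>)"
    by (rule gamma_rand_reduction[OF assms, of 1]) (assumption, simp, rule that, assumption+)
  have ll: "log_Laplace M X = L" using L by (simp add: log_Laplace_def fun_eq_iff)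
  have d1: "deriv L = L1" using d(1) by (intro ext DERIV_imp_deriv)
  have d2: "deriv L1 = L2" using d(2) by (intro ext DERIV_imp_deriv)
  have k: "kappa M X \<tau> = (THE r. L1 r = \<tau>)" for \<tau> by (simp add: kappa_def ll d1)
  show "\<exists>E. E \<in> O[at_top](\<lambda>\<tau>. 1 / sqrt (kappa M X \<tau>)) \<and>
           (\<forall>\<^sub>F \<tau> in at_top.
              (\<exists>!r. deriv (log_Laplace M X) r = \<tau>) \<and>
              measure M {\<omega> \<in> space M. gamma_rand X \<omega> > \<tau>} =
                Laplace_real M X (kappa M X \<tau>) * exp (- \<tau> * kappa M X \<tau>) /
                (kappa M X \<tau> * sqrt (2 * pi * deriv (deriv (log_Laplace M X)) (kappa M X \<tau>))) *
                (1 + E \<tau>))"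
    using E tail L unfolding k ll d1 d2 by (intro exI[of _ E] conjI) simp_all
next
  obtain L L1 L2 E where L: "\<And>r. Laplace_real M X (- 1 * r) = exp (L r)"
    and d: "\<And>r. (L has_real_derivative L1 r) (at r)" "\<And>r. (L1 has_real_derivative L2 r) (at r)"
    and E: "E \<in> O[at_top](\<lambda>\<tau>. 1 / sqrt (THE r. L1 r = \<tau>))"
    and tail: "\<forall>\<^sub>F \<tau> in at_top. (\<exists>!r. L1 r = \<tau>) \<and>
       measure M {\<omega> \<in> space M. - 1 * gamma_rand X \<omega> > \<tau>} =
         exp (L (THE r. L1 r = \<tau>)) * exp (- \<tau> * (THE r. L1 r = \<tau>)) /
         ((THE r. L1 r = \<tau>) * sqrt (2 * pi * L2 (THE r. L1 r = \<tau>))) * (1 + E \<tau>)"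
    by (rule gamma_rand_reduction[OF assms, of "-1"]) (assumption, simp, rule that, assumption+)
  have L': "Laplace_real M X (- r) = exp (L r)" for r using L[of r] by simp
  \<comment> \<open>\<open>L\<close> belongs to \<open>- gamma_rand X\<close>, so the given
    transform is its reflection. The first derivative picks up a sign, which turns
    \<open>deriv (log_Laplace M X) (- r) = - \<tau>\<close> into \<open>L1 r = \<tau>\<close>; the
    second derivative at \<open>- kappa_tilde M X \<tau>\<close> is \<open>L2\<close> at
    \<open>kappa_tilde M X \<tau>\<close>.\<close>
  have ll: "log_Laplace M X = (\<lambda>r. L (- r))"
  proof
    fix r show "log_Laplace M X r = L (- r)" using L'[of "- r"] by (simp add: log_Laplace_def)
  qed
  have d1: "deriv (\<lambda>r. L (- r)) = (\<lambda>r. - L1 (- r))"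
    by (intro ext DERIV_imp_deriv) (use DERIV_mirror[of L] d(1) in \<open>auto intro!: derivative_eq_intros DERIV_chain2[OF d(1)]\<close>)
  have d2: "deriv (\<lambda>r. - L1 (- r)) = (\<lambda>r. L2 (- r))"
    by (intro ext DERIV_imp_deriv) (auto intro!: derivative_eq_intros DERIV_chain2[OF d(2)])
  have k: "kappa_tilde M X \<tau> = (THE r. L1 r = \<tau>)" for \<tau> by (simp add: kappa_tilde_def ll d1)
  have set_eq: "(- 1 * gamma_rand X \<omega> > \<tau>) = (gamma_rand X \<omega> < - \<tau>)" for \<omega> \<tau> by auto
  show "\<exists>E. E \<in> O[at_top](\<lambda>\<tau>. 1 / sqrt (kappa_tilde M X \<tau>)) \<and>
           (\<forall>\<^sub>F \<tau> in at_top.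
              (\<exists>!r. deriv (log_Laplace M X) (- r) = - \<tau>) \<and>
              measure M {\<omega> \<in> space M. gamma_rand X \<omega> < - \<tau>} =
                Laplace_real M X (- kappa_tilde M X \<tau>) * exp (- \<tau> * kappa_tilde M X \<tau>) /
                (kappa_tilde M X \<tau> * sqrt (2 * pi * deriv (deriv (log_Laplace M X)) (- kappa_tilde M X \<tau>))) *
                (1 + E \<tau>))"
    using E tail[unfolded set_eq] unfolding k ll d1 d2 L' by (intro exI[of _ E] conjI) simp_all
qed

end
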